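(* Let $\gamma:[0,\ell_\gamma]\to\mathbb R$ be a normalized profile function, let $m>0$, and let $\widehat{\mathrm{Crit}}^\pm_{m,\gamma}\subset[0,\ell_\gamma]$ be the set of critical points of $\widehat I^\pm_{m,\gamma}$ and $\widehat{\mathrm{Crit}}_{m,\gamma}$ the set of critical points of $\widehat I_{m,\gamma}:\widehat{SS^2_\gamma}\to\mathbb R$. Then, in the coordinates $(t,\varphi)$, $$\widehat{\mathrm{Crit}}_{m,\gamma}=\widehat{\mathrm{Crit}}^-_{m,\gamma}\times\{-\tfrac\pi2\}\ \cup\ \widehat{\mathrm{Crit}}^+_{m,\gamma}\times\{+\tfrac\pi2\}.$$ Moreover, $t\in\widehat{\mathrm{Crit}}^\pm_{m,\gamma}$ if and only if $$\pm m\dot\gamma(t)=\gamma(t).$$ In this case $\{(t,\pm\pi/2,\theta)\mid\theta\in\mathbb R/2\pi\mathbb Z\}$ is the support of a closed orbit of $X^m_\gamma$. These are exactly the periodic orbits of $X^m_\gamma$ whose projection to $S^2_\gamma$ is a latitude. Finally, if $K_m>0$, then $\widehat{\mathrm{Crit}}^+_{m,\gamma}$ contains only the absolute maximizer $\widehat t^+_{m,\gamma}$ of $\widehat I^+_{m,\gamma}$ and $\widehat{\mathrm{Crit}}^-_{m,\gamma}$ contains only the absolute minimizer $\widehat t^-_{m,\gamma}$ of $\widehat I^-_{m,\gamma}$; the complement of $\{(\widehat t^-_{m,\gamma},-\pi/2),(\widehat t^+_{m,\gamma},\pi/2)\}$ in $\widehat{SS^2_\gamma}$ is foliated by closed orbits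 of $\widehat X^m_\gamma$; and the complement of $\{(\widehat t^-_{m,\gamma},-\pi/2,\theta),(\widehat t^+_{m,\gamma},\pi/2,\theta)\mid\theta\in\mathbb R/2\pi\mathbb Z\}$ in $SS^2_\gamma$ is foliated by $X^m_\gamma$-invariant tori.
   Context: A normalized profile function is a smooth $\gamma:[0,\ell_\gamma]\to\mathbb R$ such that: (1) $\gamma(0)=\gamma(\ell_\gamma)=0$ and $\gamma>0$ otherwise; (2) $\dot\gamma(0)=1$, $\dot\gamma(\ell_\gamma)=-1$ and $|\dot\gamma|<1$ on $(0,\ell_\gamma)$; (3) all even derivatives of $\gamma$ vanish at $0$ and $\ell_\gamma$; (4) $\int_0^{\ell_\gamma}\gamma(t)\,dt=2$. The surface of revolution $S^2_\gamma$ is the sphere obtained from $[0,\ell_\gamma]\times\mathbb R/2\pi\mathbb Z$ with coordinates $(t,\theta)$ by collapsing each of the two boundary circles to a point (the poles), with metric $g_\gamma=dt^2+\gamma(t)^2d\theta^2$, area form $\mu_\gamma=\gamma\,dt\wedge d\theta$ and curvature $K=-\ddot\gamma/\gamma$. A latitude is a curve $\{t=t_0\}$, $t_0\in(0,\ell_\gamma)$. On the unit tangent bundle $SS^2_\gamma$ away from the poles use coordinates $(t,\varphi,\theta)$, where the unit vector is $v=\cos\varphi\,\partial_t+\frac{\sin\varphi}{\gamma(t)}\partial_\theta$. Let $X^m_\gamma:=mX+V$ on $SS^2_\gamma$, with $X$ the geodesic vector field and $V=\partial_\varphi$ the generator of the fiberwise rotation; in coordinates $X=\cos\varphi\,\widehat\partial_t-\frac{\dot\gamma\sin\varphi}{\gamma}\partial_\varphi+\frac{\sin\varphi}{\gamma}\widehat\partial_\theta$,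 where $(\widehat\partial_t,\partial_\varphi,\widehat\partial_\theta)$ is the coordinate frame. The magnetic curvature is $K_m:=m^2K+1$. The rotation $\theta\mapsto\theta+\theta'$ acts by isometries and lifts to a free $\mathbb R/2\pi\mathbb Z$-action on $SS^2_\gamma$ generated by $\widehat\partial_\theta$; the quotient $\widehat{SS^2_\gamma}$ is diffeomorphic to $S^2$, and $(t,\varphi)$ are coordinates on it away from the two points given by the fibers over the poles. $\widehat X^m_\gamma$ is the vector field on $\widehat{SS^2_\gamma}$ to which the $\widehat\partial_\theta$-invariant field $X^m_\gamma$ projects. Let $\Gamma$ be the primitive of $\gamma$ with $\Gamma(0)=-1$ (so $\Gamma(\ell_\gamma)=1$). The function $\widehat I_{m,\gamma}:\widehat{SS^2_\gamma}\to\mathbb R$ is the smooth function with $\widehat I_{m,\gamma}(t,\varphi)=m\gamma(t)\sin\varphi-\Gamma(t)$ (an integral of motion of $\widehat X^m_\gamma$), and $\widehat I^\pm_{m,\gamma}(t):=\pm m\gamma(t)-\Gamma(t)$ on $[0,\ell_\gamma]$. *)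

theory Defs
  imports "HOL-Analysis.Analysis"
begin

section \<open>Submanifolds of Euclidean spaces\<close>

text \<open>All manifolds below are smooth submanifolds \<open>M\<close> of a Euclidean space, given by their
  underlying sets.\<close>

text \<open>\<open>C\<^sup>k\<close> maps on an open set, by iterated directional derivatives.\<close>

primrec Ck_on :: "nat \<Rightarrow> 'a::euclidean_space set \<Rightarrow> ('a \<Rightarrow> 'e::euclidean_space) \<Rightarrow> bool" where
  "Ck_on 0 U f \<longleftrightarrow> continuous_on U f"
| "Ck_on (Suc k) U f \<longleftrightarrow>
     f differentiable_on U \<and> (\<forall>v. Ck_on k U (\<lambda>x. frechet_derivative f (at x) v))"

definition smooth_map_on :: "'a::euclidean_space set \<Rightarrow> ('a \<Rightarrow> 'e::euclidean_space) \<Rightarrow> bool" where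
  "smooth_map_on U f \<longleftrightarrow> open U \<and> (\<forall>k. Ck_on k U f)"

text \<open>For \<open>f\<close> smooth near a submanifold \<open>M\<close> (possibly with boundary, such as a compact interval)
  the condition below says that the differential of the restriction of \<open>f\<close> to \<open>M\<close>
  vanishes at \<open>p\<close>: only increments of \<open>f\<close> along \<open>M\<close> enter.\<close>

definition critical_points :: "'e::real_normed_vector set \<Rightarrow> ('e \<Rightarrow> real) \<Rightarrow> 'e set" where
  "critical_points M f = {p \<in> M. (f has_derivative (\<lambda>_. 0)) (at p within M)}"

definition integral_curve ::
  "'e::real_normed_vector set \<Rightarrow> ('e \<Rightarrow> 'e) \<Rightarrow> real set \<Rightarrow> (real \<Rightarrow> 'e) \<Rightarrow> bool" where
  "integral_curve M X J c \<longleftrightarrow>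
     (\<forall>s\<in>J. c s \<in> M \<and> (c has_vector_derivative X (c s)) (at s within J))"

text \<open>\<open>L\<close> is the support of a closed orbit; \<open>T\<close> is the minimal period, so rest points are excluded.\<close>

definition closed_orbit ::
  "'e::real_normed_vector set \<Rightarrow> ('e \<Rightarrow> 'e) \<Rightarrow> 'e set \<Rightarrow> bool" where
  "closed_orbit M X L \<longleftrightarrow>
     (\<exists>c T. 0 < T \<and> integral_curve M X UNIV c \<and> (\<forall>s. c (s + T) = c s) \<and>
            inj_on c {0..<T} \<and> L = range c)"

definition flow_invariant ::
  "'e::real_normed_vector set \<Rightarrow> ('e \<Rightarrow> 'e) \<Rightarrow> 'e set \<Rightarrow> bool" where
  "flow_invariant M X L \<longleftrightarrow> L \<subseteq> M \<and>
     (\<forall>J c. open J \<and> is_interval J \<and> integral_curve M X J c \<and> (\<exists>s\<in>J. c s \<in> L) \<longrightarrow> c ` J \<subseteq> L)"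

text \<open>Smoothly embedded 2-torus: image of an injective immersion of \<open>\<real>\<^sup>2 / \<int>\<^sup>2\<close>, which is
  automatically an embedding by compactness.\<close>

definition embedded_torus :: "'e::euclidean_space set \<Rightarrow> bool" where
  "embedded_torus L \<longleftrightarrow>
     (\<exists>F :: real \<times> real \<Rightarrow> 'e.
        smooth_map_on UNIV F \<and> (\<forall>x. inj (frechet_derivative F (at x))) \<and>
        (\<forall>x y. F x = F y \<longleftrightarrow> fst x - fst y \<in> \<int> \<and> snd x - snd y \<in> \<int>) \<and>
        L = range F)"

text \<open>\<open>\<psi>\<close> is the inverse of a smooth chart of a submanifold, with chart domain \<open>U\<close>.\<close>

definition regular_param ::
  "'a::euclidean_space set \<Rightarrow> ('a \<Rightarrow> 'e::euclidean_space) \<Rightarrow> 'e set \<Rightarrow> bool" where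
  "regular_param D \<psi> U \<longleftrightarrow>
     smooth_map_on D \<psi> \<and> (\<forall>x\<in>D. inj (frechet_derivative \<psi> (at x))) \<and>
     (\<exists>\<kappa>. homeomorphism D U \<psi> \<kappa>)"

text \<open>\<open>F\<close> is (the set of leaves of) a smooth foliation of \<open>W\<close>, with leaves of the dimension of
  \<open>'a\<close> and of codimension the dimension of \<open>'b\<close>. Around every point there is a smooth foliated
  chart with values in \<open>A \<times> B\<close> in which each leaf is a countable union of plaques
  \<open>A \<times> {b}\<close>.\<close>

definition foliation ::
  "'a::euclidean_space itself \<Rightarrow> 'b::euclidean_space itself \<Rightarrow>
   'e::euclidean_space set \<Rightarrow> 'e set set \<Rightarrow> bool" where
  "foliation _ _ W F \<longleftrightarrow>
     \<Union>F = W \<and> disjoint F \<and> (\<forall>L\<in>F. L \<noteq> {} \<and> connected L) \<and>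
     (\<forall>x\<in>W. \<exists>(A::'a set) (B::'b set) \<psi> U.
        x \<in> U \<and> openin (top_of_set W) U \<and> connected A \<and> regular_param (A \<times> B) \<psi> U \<and>
        (\<forall>L\<in>F. \<exists>T. countable T \<and> T \<subseteq> B \<and> L \<inter> U = \<psi> ` (A \<times> T)))"


section \<open>Profile functions\<close>

text \<open>The \<open>n\<close>-th derivative on \<open>{0..l}\<close>, one-sided at the endpoints.\<close>

primrec profile_deriv :: "real \<Rightarrow> (real \<Rightarrow> real) \<Rightarrow> nat \<Rightarrow> real \<Rightarrow> real" where
  "profile_deriv l \<gamma> 0 = \<gamma>"
| "profile_deriv l \<gamma> (Suc n) = (\<lambda>t. vector_derivative (profile_deriv l \<gamma> n) (at t within {0..l}))"

definition normalized_profile :: "real \<Rightarrow> (real \<Rightarrow> real) \<Rightarrow> bool" where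
  "normalized_profile l \<gamma> \<longleftrightarrow> 0 < l \<and>
     (\<forall>n. profile_deriv l \<gamma> n differentiable_on {0..l}) \<and>
     \<gamma> 0 = 0 \<and> \<gamma> l = 0 \<and> (\<forall>t\<in>{0<..<l}. 0 < \<gamma> t) \<and>
     profile_deriv l \<gamma> 1 0 = 1 \<and> profile_deriv l \<gamma> 1 l = -1 \<and>
     (\<forall>t\<in>{0<..<l}. \<bar>profile_deriv l \<gamma> 1 t\<bar> < 1) \<and>
     (\<forall>n. profile_deriv l \<gamma> (2 * n) 0 = 0 \<and> profile_deriv l \<gamma> (2 * n) l = 0) \<and>
     integral {0..l} \<gamma> = 2"

definition Gam :: "(real \<Rightarrow> real) \<Rightarrow> real \<Rightarrow> real" where
  "Gam \<gamma> t = -1 + integral {0..t} \<gamma>"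

definition curvature :: "real \<Rightarrow> (real \<Rightarrow> real) \<Rightarrow> real \<Rightarrow> real" where
  "curvature l \<gamma> t =
     (let k = (\<lambda>s. - profile_deriv l \<gamma> 2 s / \<gamma> s)
      in if t \<in> {0<..<l} then k t else Lim (at t within {0<..<l}) k)"

definition magnetic_curvature :: "real \<Rightarrow> real \<Rightarrow> (real \<Rightarrow> real) \<Rightarrow> real \<Rightarrow> real" where
  "magnetic_curvature m l \<gamma> t = m\<^sup>2 * curvature l \<gamma> t + 1"


section \<open>The surface of revolution and its unit tangent bundle\<close>

text \<open>
  The sphere obtained by collapsing the boundary circles of \<open>{0..l} \<times> \<real>/2\<pi>\<int>\<close> is realised
  as the embedded surface \<open>{(\<gamma> t * cis \<theta>, \<Gamma> t)}\<close> in \<open>\<complex> \<times> \<real>\<close>. This is injective up to the collapsing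
  since \<open>\<Gamma>\<close> is strictly increasing (lemma \<open>surf_pt_eq_iff\<close>). As the even derivatives of \<open>\<gamma>\<close> vanish at
  the poles, near a pole at distance \<open>s\<close> the function \<open>\<gamma>\<close> is \<open>s\<close> times a smooth nonvanishing function
  of \<open>s\<^sup>2\<close>, and \<open>\<Gamma>\<close> is a smooth function of \<open>s\<^sup>2\<close>. Hence the surface is a smooth submanifold on
  which \<open>(t, \<theta>)\<close> are polar coordinates near the poles, which is the smooth structure in which
  \<open>dt\<^sup>2 + \<gamma>\<^sup>2 d\<theta>\<^sup>2\<close> is a smooth metric. That metric, and not the one induced from \<open>\<complex> \<times> \<real>\<close>, is the
  metric of the surface.\<close>

type_synonym space3 = "complex \<times> real"

definition surf_pt :: "(real \<Rightarrow> real) \<Rightarrow> real \<Rightarrow> real \<Rightarrow> space3" where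
  "surf_pt \<gamma> t \<theta> = (complex_of_real (\<gamma> t) * cis \<theta>, Gam \<gamma> t)"

definition latitude :: "(real \<Rightarrow> real) \<Rightarrow> real \<Rightarrow> space3 set" where
  "latitude \<gamma> t = {surf_pt \<gamma> t \<theta> | \<theta>. True}"

definition d_t :: "real \<Rightarrow> (real \<Rightarrow> real) \<Rightarrow> real \<Rightarrow> real \<Rightarrow> space3" where
  "d_t l \<gamma> t \<theta> = vector_derivative (\<lambda>s. surf_pt \<gamma> s \<theta>) (at t within {0..l})"

definition d_theta :: "(real \<Rightarrow> real) \<Rightarrow> real \<Rightarrow> real \<Rightarrow> space3" where
  "d_theta \<gamma> t \<theta> = vector_derivative (\<lambda>s. surf_pt \<gamma> t s) (at \<theta>)"

text \<open>Points of the unit tangent bundle are pairs of a foot point and a tangent vector in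
  \<open>\<complex> \<times> \<real>\<close>. The coordinates \<open>(t, \<phi>, \<theta>)\<close> are used for \<open>0 < t < l\<close> only. At the poles the unit
  tangent vectors are the velocities of the (unit speed) meridians.\<close>

definition bundle_pt ::
  "real \<Rightarrow> (real \<Rightarrow> real) \<Rightarrow> real \<Rightarrow> real \<Rightarrow> real \<Rightarrow> space3 \<times> space3" where
  "bundle_pt l \<gamma> t \<phi> \<theta> =
     (surf_pt \<gamma> t \<theta>, cos \<phi> *\<^sub>R d_t l \<gamma> t \<theta> + (sin \<phi> / \<gamma> t) *\<^sub>R d_theta \<gamma> t \<theta>)"

definition regular_bundle :: "real \<Rightarrow> (real \<Rightarrow> real) \<Rightarrow> (space3 \<times> space3) set" where
  "regular_bundle l \<gamma> = {bundle_pt l \<gamma> t \<phi> \<theta> | t \<phi> \<theta>. t \<in> {0<..<l}}"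

definition unit_bundle :: "real \<Rightarrow> (real \<Rightarrow> real) \<Rightarrow> (space3 \<times> space3) set" where
  "unit_bundle l \<gamma> =
     regular_bundle l \<gamma> \<union> {(surf_pt \<gamma> t \<theta>, d_t l \<gamma> t \<theta>) | t \<theta>. t \<in> {0, l}}"

definition bundle_circle ::
  "real \<Rightarrow> (real \<Rightarrow> real) \<Rightarrow> real \<Rightarrow> real \<Rightarrow> (space3 \<times> space3) set" where
  "bundle_circle l \<gamma> t \<phi> = {bundle_pt l \<gamma> t \<phi> \<theta> | \<theta>. True}"


section \<open>The vector fields\<close>

text \<open>The coordinate frame on the unit tangent bundle away from the poles, and \<open>X\<close> in it.\<close>

definition frame_t :: "real \<Rightarrow> (real \<Rightarrow> real) \<Rightarrow> real \<Rightarrow> real \<Rightarrow> real \<Rightarrow> space3 \<times> space3" where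
  "frame_t l \<gamma> t \<phi> \<theta> = vector_derivative (\<lambda>s. bundle_pt l \<gamma> s \<phi> \<theta>) (at t)"

definition frame_phi :: "real \<Rightarrow> (real \<Rightarrow> real) \<Rightarrow> real \<Rightarrow> real \<Rightarrow> real \<Rightarrow> space3 \<times> space3" where
  "frame_phi l \<gamma> t \<phi> \<theta> = vector_derivative (\<lambda>s. bundle_pt l \<gamma> t s \<theta>) (at \<phi>)"

definition frame_theta :: "real \<Rightarrow> (real \<Rightarrow> real) \<Rightarrow> real \<Rightarrow> real \<Rightarrow> real \<Rightarrow> space3 \<times> space3" where
  "frame_theta l \<gamma> t \<phi> \<theta> = vector_derivative (\<lambda>s. bundle_pt l \<gamma> t \<phi> s) (at \<theta>)"

definition geodesic_coord ::
  "real \<Rightarrow> (real \<Rightarrow> real) \<Rightarrow> real \<Rightarrow> real \<Rightarrow> real \<Rightarrow> space3 \<times> space3" where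
  "geodesic_coord l \<gamma> t \<phi> \<theta> =
     cos \<phi> *\<^sub>R frame_t l \<gamma> t \<phi> \<theta>
     - (profile_deriv l \<gamma> 1 t * sin \<phi> / \<gamma> t) *\<^sub>R frame_phi l \<gamma> t \<phi> \<theta>
     + (sin \<phi> / \<gamma> t) *\<^sub>R frame_theta l \<gamma> t \<phi> \<theta>"

text \<open>A field given in the coordinates \<open>(t, \<phi>, \<theta>)\<close> determines the field on the whole unit tangent
  bundle by continuous extension to the fibres over the poles.\<close>

definition bundle_field ::
  "real \<Rightarrow> (real \<Rightarrow> real) \<Rightarrow> (real \<Rightarrow> real \<Rightarrow> real \<Rightarrow> space3 \<times> space3) \<Rightarrow>
   space3 \<times> space3 \<Rightarrow> space3 \<times> space3" where
  "bundle_field l \<gamma> Y =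
     (let Z = (\<lambda>q. THE w. \<exists>t \<phi> \<theta>. t \<in> {0<..<l} \<and> q = bundle_pt l \<gamma> t \<phi> \<theta> \<and> w = Y t \<phi> \<theta>)
      in (\<lambda>q. if q \<in> regular_bundle l \<gamma> then Z q else Lim (at q within regular_bundle l \<gamma>) Z))"

definition geodesic_field ::
  "real \<Rightarrow> (real \<Rightarrow> real) \<Rightarrow> space3 \<times> space3 \<Rightarrow> space3 \<times> space3" where
  "geodesic_field l \<gamma> = bundle_field l \<gamma> (geodesic_coord l \<gamma>)"

definition vertical_field ::
  "real \<Rightarrow> (real \<Rightarrow> real) \<Rightarrow> space3 \<times> space3 \<Rightarrow> space3 \<times> space3" where
  "vertical_field l \<gamma> = bundle_field l \<gamma> (frame_phi l \<gamma>)"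

definition magnetic_field ::
  "real \<Rightarrow> real \<Rightarrow> (real \<Rightarrow> real) \<Rightarrow> space3 \<times> space3 \<Rightarrow> space3 \<times> space3" where
  "magnetic_field m l \<gamma> q = m *\<^sub>R geodesic_field l \<gamma> q + vertical_field l \<gamma> q"


section \<open>The quotient by rotations\<close>

text \<open>The lift of the rotation \<open>\<theta> \<mapsto> \<theta> + \<alpha>\<close> to the unit tangent bundle.\<close>

definition rotate_bundle :: "real \<Rightarrow> space3 \<times> space3 \<Rightarrow> space3 \<times> space3" where
  "rotate_bundle \<alpha> = (\<lambda>((p, z), (u, w)). ((cis \<alpha> * p, z), (cis \<alpha> * u, w)))"

text \<open>The quotient manifold is realised as the image of the unit tangent bundle under a polynomial
  map which is a submersion onto its image, an embedded sphere, and whose fibres are exactly the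
  orbits of the rotations (lemma \<open>quot_proj_eq_iff\<close>). In the coordinates \<open>(t, \<phi>, \<theta>)\<close> it is
  \<open>(\<gamma> t * cis \<phi>, \<Gamma> t)\<close> (lemma \<open>quot_proj_bundle_pt\<close>).\<close>

definition quot_proj :: "space3 \<times> space3 \<Rightarrow> space3" where
  "quot_proj = (\<lambda>((p, z), (u, w)). (Complex w (Im (cnj p * u)), z))"

definition quot_bundle :: "real \<Rightarrow> (real \<Rightarrow> real) \<Rightarrow> space3 set" where
  "quot_bundle l \<gamma> = quot_proj ` unit_bundle l \<gamma>"

text \<open>The point with coordinates \<open>(t, \<phi>)\<close>, for \<open>0 < t < l\<close>.\<close>

definition quot_pt :: "real \<Rightarrow> (real \<Rightarrow> real) \<Rightarrow> real \<times> real \<Rightarrow> space3" where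
  "quot_pt l \<gamma> = (\<lambda>(t, \<phi>). quot_proj (bundle_pt l \<gamma> t \<phi> 0))"

definition quot_magnetic_field ::
  "real \<Rightarrow> real \<Rightarrow> (real \<Rightarrow> real) \<Rightarrow> space3 \<Rightarrow> space3" where
  "quot_magnetic_field m l \<gamma> y =
     (THE w. \<forall>q\<in>unit_bundle l \<gamma>. quot_proj q = y \<longrightarrow>
               w = frechet_derivative quot_proj (at q) (magnetic_field m l \<gamma> q))"

text \<open>In this realisation of the quotient the first integral is the restriction of a linear map
  (lemma \<open>first_integral_quot_pt\<close>).\<close>

definition first_integral :: "real \<Rightarrow> space3 \<Rightarrow> real" where
  "first_integral m = (\<lambda>(a, z). m * Im a - z)"

text \<open>The sign \<open>\<sigma>\<close> is \<open>1\<close> or \<open>-1\<close>, corresponding to \<open>\<phi> = \<sigma> * pi / 2\<close>.\<close>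

definition integral_pm :: "real \<Rightarrow> real \<Rightarrow> (real \<Rightarrow> real) \<Rightarrow> real \<Rightarrow> real" where
  "integral_pm \<sigma> m \<gamma> t = \<sigma> * m * \<gamma> t - Gam \<gamma> t"

definition Crit_pm :: "real \<Rightarrow> real \<Rightarrow> real \<Rightarrow> (real \<Rightarrow> real) \<Rightarrow> real set" where
  "Crit_pm \<sigma> m l \<gamma> = critical_points {0..l} (integral_pm \<sigma> m \<gamma>)"

definition Crit :: "real \<Rightarrow> real \<Rightarrow> (real \<Rightarrow> real) \<Rightarrow> space3 set" where
  "Crit m l \<gamma> = critical_points (quot_bundle l \<gamma>) (first_integral m)"


section \<open>Adequacy of the realisations\<close>

lemma normalized_profileD:
  assumes "normalized_profile l \<gamma>"
  shows "0 < l" "\<gamma> 0 = 0" "\<gamma> l = 0" "t \<in> {0<..<l} \<Longrightarrow> 0 < \<gamma> t" "integral {0..l} \<gamma> = 2"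
    and "profile_deriv l \<gamma> n differentiable_on {0..l}"
  using assms unfolding normalized_profile_def by blast+

lemma profile_deriv_1:
  assumes "normalized_profile l \<gamma>" "t \<in> {0..l}"
  shows "(\<gamma> has_real_derivative profile_deriv l \<gamma> 1 t) (at t within {0..l})"
proof -
  have "profile_deriv l \<gamma> 0 differentiable_on {0..l}"
    by (rule normalized_profileD(6)[OF assms(1)])
  then have "\<gamma> differentiable (at t within {0..l})"
    using assms(2) by (simp add: differentiable_on_def)
  then have "(\<gamma> has_vector_derivative vector_derivative \<gamma> (at t within {0..l})) (at t within {0..l})"
    by (simp add: vector_derivative_works)
  then show ?thesis
    by (simp add: has_real_derivative_iff_has_vector_derivative)
qed

lemma Gam_deriv:
  assumes "normalized_profile l \<gamma>" "t \<in> {0..l}"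
  shows "(Gam \<gamma> has_real_derivative \<gamma> t) (at t within {0..l})"
proof -
  have "continuous_on {0..l} \<gamma>"
    using profile_deriv_1[OF assms(1)] by (meson DERIV_continuous continuous_on_eq_continuous_within)
  then have "((\<lambda>u. integral {0..u} \<gamma>) has_real_derivative \<gamma> t) (at t within {0..l})"
    using assms(2) by (rule integral_has_real_derivative)
  then show ?thesis
    unfolding Gam_def by (auto intro!: derivative_eq_intros)
qed

lemma Gam_strict_mono:
  assumes "normalized_profile l \<gamma>" "0 \<le> s" "s < t" "t \<le> l"
  shows "Gam \<gamma> s < Gam \<gamma> t"
proof (rule DERIV_pos_imp_increasing_open[OF assms(3)])
  fix x assume x: "s < x" "x < t"
  then have "(Gam \<gamma> has_real_derivative \<gamma> x) (at x)"
    using Gam_deriv[OF assms(1), of x] assms(2,4) at_within_Icc_at[of 0 x l] by auto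
  moreover have "0 < \<gamma> x"
    by (rule normalized_profileD(4)[OF assms(1)]) (use assms x in auto)
  ultimately show "\<exists>y. (Gam \<gamma> has_real_derivative y) (at x) \<and> 0 < y" by blast
next
  have "continuous_on {0..l} (Gam \<gamma>)"
    using Gam_deriv[OF assms(1)] by (meson DERIV_continuous continuous_on_eq_continuous_within)
  then show "continuous_on {s..t} (Gam \<gamma>)"
    by (rule continuous_on_subset) (use assms in auto)
qed

lemma Gam_ends:
  assumes "normalized_profile l \<gamma>"
  shows "Gam \<gamma> 0 = -1" "Gam \<gamma> l = 1"
  by (simp_all add: Gam_def normalized_profileD[OF assms])

lemma Gam_eq_iff:
  assumes "normalized_profile l \<gamma>" "s \<in> {0..l}" "t \<in> {0..l}"
  shows "Gam \<gamma> s = Gam \<gamma> t \<longleftrightarrow> s = t"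
  using Gam_strict_mono[OF assms(1), of s t] Gam_strict_mono[OF assms(1), of t s] assms(2,3)
  by (metis atLeastAtMost_iff less_irrefl linorder_less_linear)

lemma surf_pt_eq_iff:
  assumes "normalized_profile l \<gamma>" "t \<in> {0..l}" "t' \<in> {0..l}"
  shows "surf_pt \<gamma> t \<theta> = surf_pt \<gamma> t' \<theta>' \<longleftrightarrow> t = t' \<and> (t \<in> {0, l} \<or> cis \<theta> = cis \<theta>')"
proof -
  have "\<gamma> t = 0 \<longleftrightarrow> t \<in> {0, l}"
    using normalized_profileD(2,3)[OF assms(1)] normalized_profileD(4)[OF assms(1), of t] assms(2)
    by (cases "t = 0 \<or> t = l") force+
  then show ?thesis
    using Gam_eq_iff[OF assms] by (auto simp: surf_pt_def)
qed

lemma d_t_eq: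
  assumes "normalized_profile l \<gamma>" "t \<in> {0..l}"
  shows "d_t l \<gamma> t \<theta> = (profile_deriv l \<gamma> 1 t * cis \<theta>, \<gamma> t)"
  unfolding d_t_def
proof (rule vector_derivative_within)
  show "at t within {0..l} \<noteq> bot"
    using normalized_profileD(1)[OF assms(1)] assms(2) by (simp add: trivial_limit_within islimpt_Icc)
  have "((\<lambda>s. of_real (\<gamma> s) * cis \<theta>) has_vector_derivative
          of_real (profile_deriv l \<gamma> 1 t) * cis \<theta>) (at t within {0..l})"
    by (intro has_vector_derivative_mult_left has_vector_derivative_of_real
        profile_deriv_1[OF assms])
  then show "((\<lambda>s. surf_pt \<gamma> s \<theta>) has_vector_derivative
      (profile_deriv l \<gamma> 1 t * cis \<theta>, \<gamma> t)) (at t within {0..l})"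
    unfolding surf_pt_def using Gam_deriv[OF assms]
    by (intro has_vector_derivative_Pair)
       (simp_all add: has_real_derivative_iff_has_vector_derivative)
qed

lemma cis_has_vector_derivative:
  "(cis has_vector_derivative \<i> * cis \<theta>) (at \<theta> within S)"
proof -
  have "((\<lambda>x. Complex (cos x) (sin x)) has_vector_derivative Complex (- sin \<theta>) (cos \<theta>)) (at \<theta> within S)"
    unfolding has_vector_derivative_complex_iff by (auto intro!: derivative_eq_intros)
  moreover have "cis = (\<lambda>x. Complex (cos x) (sin x))" by (simp add: fun_eq_iff complex_eq_iff)
  moreover have "\<i> * cis \<theta> = Complex (- sin \<theta>) (cos \<theta>)" by (simp add: complex_eq_iff)
  ultimately show ?thesis by simp
qed

lemma d_theta_eq: "d_theta \<gamma> t \<theta> = (\<gamma> t * (\<i> * cis \<theta>), 0)"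
  unfolding d_theta_def surf_pt_def
  by (rule vector_derivative_at, rule has_vector_derivative_Pair,
      rule has_vector_derivative_mult_right, rule cis_has_vector_derivative, rule has_vector_derivative_const)

lemma bundle_pt_eq:
  assumes "normalized_profile l \<gamma>" "t \<in> {0<..<l}"
  shows "bundle_pt l \<gamma> t \<phi> \<theta> =
    ((\<gamma> t * cis \<theta>, Gam \<gamma> t),
     (Complex (cos \<phi> * profile_deriv l \<gamma> 1 t) (sin \<phi>) * cis \<theta>, cos \<phi> * \<gamma> t))"
proof -
  have "\<gamma> t \<noteq> 0" using normalized_profileD(4)[OF assms] by simp
  then show ?thesis
    using assms(2)
    by (simp add: bundle_pt_def surf_pt_def d_t_eq[OF assms(1)] d_theta_eq complex_eq_iff
        scaleR_conv_of_real algebra_simps del: profile_deriv.simps One_nat_def)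
qed

lemma pole_bundle_pt_eq:
  assumes "normalized_profile l \<gamma>" "t \<in> {0, l}"
  shows "(surf_pt \<gamma> t \<theta>, d_t l \<gamma> t \<theta>) = ((0, Gam \<gamma> t), (profile_deriv l \<gamma> 1 t * cis \<theta>, 0))"
  using assms(2) normalized_profileD(1-3)[OF assms(1)]
  by (auto simp: surf_pt_def d_t_eq[OF assms(1)] simp del: profile_deriv.simps One_nat_def)

lemma quot_proj_bundle_pt:
  assumes "normalized_profile l \<gamma>" "t \<in> {0<..<l}"
  shows "quot_proj (bundle_pt l \<gamma> t \<phi> \<theta>) = (\<gamma> t * cis \<phi>, Gam \<gamma> t)"
proof -
  have im: "Im (cnj (\<gamma> t * cis \<theta>) * (Complex a b * cis \<theta>)) = \<gamma> t * b" for a b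
  proof -
    have "cnj (\<gamma> t * cis \<theta>) * (Complex a b * cis \<theta>) = \<gamma> t * Complex a b * (cis (-\<theta>) * cis \<theta>)"
      by (simp add: cis_cnj algebra_simps)
    then have "cnj (\<gamma> t * cis \<theta>) * (Complex a b * cis \<theta>) = \<gamma> t * Complex a b"
      unfolding cis_mult by simp
    then have "Im (cnj (\<gamma> t * cis \<theta>) * (Complex a b * cis \<theta>)) = Im (\<gamma> t * Complex a b)"
      by (rule arg_cong)
    then show ?thesis by simp
  qed
  then show ?thesis
    unfolding bundle_pt_eq[OF assms] quot_proj_def prod.case im
    by (simp add: complex_eq_iff)
qed

lemma quot_proj_pole:
  assumes "normalized_profile l \<gamma>" "t \<in> {0, l}"
  shows "quot_proj (surf_pt \<gamma> t \<theta>, d_t l \<gamma> t \<theta>) = (0, Gam \<gamma> t)"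
  by (simp add: pole_bundle_pt_eq[OF assms] quot_proj_def complex_eq_iff)

lemma first_integral_quot_pt:
  assumes "normalized_profile l \<gamma>" "t \<in> {0<..<l}"
  shows "first_integral m (quot_pt l \<gamma> (t, \<phi>)) = m * \<gamma> t * sin \<phi> - Gam \<gamma> t"
  by (simp add: quot_pt_def quot_proj_bundle_pt[OF assms] first_integral_def)

lemma rotate_bundle_pt:
  assumes "normalized_profile l \<gamma>" "t \<in> {0<..<l}"
  shows "rotate_bundle \<alpha> (bundle_pt l \<gamma> t \<phi> \<theta>) = bundle_pt l \<gamma> t \<phi> (\<theta> + \<alpha>)"
  by (simp add: rotate_bundle_def bundle_pt_eq[OF assms] cis_mult[symmetric] mult_ac
      del: profile_deriv.simps One_nat_def)

lemma quot_proj_rotate: "quot_proj (rotate_bundle \<alpha> q) = quot_proj q"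
proof -
  obtain p z u w where q: "q = ((p, z), (u, w))" by (metis surj_pair)
  have "cnj (cis \<alpha> * p) * (cis \<alpha> * u) = (cis (-\<alpha>) * cis \<alpha>) * (cnj p * u)"
    by (simp add: cis_cnj algebra_simps)
  then have eq: "cnj (cis \<alpha> * p) * (cis \<alpha> * u) = cnj p * u"
    unfolding cis_mult by simp
  show ?thesis unfolding q quot_proj_def rotate_bundle_def prod.case eq ..
qed

lemma quot_proj_eq_iff:
  assumes np: "normalized_profile l \<gamma>" and q: "q \<in> unit_bundle l \<gamma>" and q': "q' \<in> unit_bundle l \<gamma>"
  shows "quot_proj q = quot_proj q' \<longleftrightarrow> (\<exists>\<alpha>. q' = rotate_bundle \<alpha> q)"
proof
  assume eq: "quot_proj q = quot_proj q'"
  have cases: "(\<exists>t \<phi> \<theta>. t \<in> {0<..<l} \<and> x = bundle_pt l \<gamma> t \<phi> \<theta> \<and> quot_proj x = (\<gamma> t * cis \<phi>, Gam \<gamma> t)) \<or>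
      (\<exists>t \<theta>. t \<in> {0, l} \<and> x = ((0, Gam \<gamma> t), (profile_deriv l \<gamma> 1 t * cis \<theta>, 0)) \<and>
             quot_proj x = (0, Gam \<gamma> t))"
    if "x \<in> unit_bundle l \<gamma>" for x
  proof -
    from that consider (reg) t \<phi> \<theta> where "t \<in> {0<..<l}" "x = bundle_pt l \<gamma> t \<phi> \<theta>"
      | (pole) t \<theta> where "t \<in> {0, l}" "x = (surf_pt \<gamma> t \<theta>, d_t l \<gamma> t \<theta>)"
      unfolding unit_bundle_def regular_bundle_def by blast
    then show ?thesis
    proof cases
      case reg
      then show ?thesis using quot_proj_bundle_pt[OF np reg(1)] by metis
    next
      case pole
      then show ?thesis using quot_proj_pole[OF np pole(1)] pole_bundle_pt_eq[OF np pole(1)] by metis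
    qed
  qed
  have l: "0 < l" by (rule normalized_profileD(1)[OF np])
  from cases[OF q] show "\<exists>\<alpha>. q' = rotate_bundle \<alpha> q"
  proof (elim disjE exE conjE)
    fix t \<phi> \<theta> assume t: "t \<in> {0<..<l}" and x: "q = bundle_pt l \<gamma> t \<phi> \<theta>"
      and y: "quot_proj q = (\<gamma> t * cis \<phi>, Gam \<gamma> t)"
    from cases[OF q'] show ?thesis
    proof (elim disjE exE conjE)
      fix t' \<phi>' \<theta>' assume t': "t' \<in> {0<..<l}" and x': "q' = bundle_pt l \<gamma> t' \<phi>' \<theta>'"
        and y': "quot_proj q' = (\<gamma> t' * cis \<phi>', Gam \<gamma> t')"
      have "Gam \<gamma> t = Gam \<gamma> t'" using eq unfolding y y' by simp
      then have tt: "t' = t" using Gam_eq_iff[OF np, of t t'] t t' by simp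
      have "\<gamma> t \<noteq> 0" using normalized_profileD(4)[OF np t] by simp
      then have "cis \<phi>' = cis \<phi>" using eq unfolding y y' tt by simp
      then have "cos \<phi>' = cos \<phi>" "sin \<phi>' = sin \<phi>" by (simp_all add: complex_eq_iff)
      then have "q' = bundle_pt l \<gamma> t \<phi> \<theta>'" by (simp add: x' tt bundle_pt_def)
      then have "q' = rotate_bundle (\<theta>' - \<theta>) q" by (simp add: x rotate_bundle_pt[OF np t])
      then show ?thesis by blast
    next
      fix t' \<theta>' assume t': "t' \<in> {0, l}" and y': "quot_proj q' = (0, Gam \<gamma> t')"
      have "Gam \<gamma> t = Gam \<gamma> t'" using eq unfolding y y' by simp
      then have "t = t'" using Gam_eq_iff[OF np, of t t'] t t' l by auto
      then show ?thesis using t t' by auto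
    qed
  next
    fix t \<theta> assume t: "t \<in> {0, l}" and y: "quot_proj q = (0, Gam \<gamma> t)"
      and x: "q = ((0, Gam \<gamma> t), (profile_deriv l \<gamma> 1 t * cis \<theta>, 0))"
    from cases[OF q'] show ?thesis
    proof (elim disjE exE conjE)
      fix t' \<phi>' assume t': "t' \<in> {0<..<l}" and y': "quot_proj q' = (\<gamma> t' * cis \<phi>', Gam \<gamma> t')"
      have "Gam \<gamma> t = Gam \<gamma> t'" using eq unfolding y y' by simp
      then have "t = t'" using Gam_eq_iff[OF np, of t t'] t t' l by auto
      then show ?thesis using t t' by auto
    next
      fix t' \<theta>' assume t': "t' \<in> {0, l}" and y': "quot_proj q' = (0, Gam \<gamma> t')"
        and x': "q' = ((0, Gam \<gamma> t'), (profile_deriv l \<gamma> 1 t' * cis \<theta>', 0))"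
      have "Gam \<gamma> t = Gam \<gamma> t'" using eq unfolding y y' by simp
      then have tt: "t' = t" using Gam_eq_iff[OF np, of t t'] t t' l by auto
      have rot: "cis (\<theta>' - \<theta>) * (a * cis \<theta>) = a * cis \<theta>'" for a
        by (simp add: mult.left_commute[of _ a] cis_mult)
      have "q' = rotate_bundle (\<theta>' - \<theta>) q"
        unfolding x x' tt rotate_bundle_def prod.case rot by simp
      then show ?thesis by blast
    qed
  qed
next
  assume "\<exists>\<alpha>. q' = rotate_bundle \<alpha> q"
  then show "quot_proj q = quot_proj q'" by (auto simp: quot_proj_rotate)
qed

end

theory Submission
  imports Defs
begin

text \<open>In the height coordinate \<open>z = \<Gamma> t\<close> the quotient is the surface \<open>|a|\<^sup>2 = G z\<close> with
  \<open>G (\<Gamma> t) = (\<gamma> t)\<^sup>2\<close>, \<open>G' = 2 g\<close>, \<open>g (\<Gamma> t) = \<gamma>' t\<close> and \<open>g' = - K\<close>; the boundary conditions on \<open>\<gamma>\<close>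
  make \<open>G\<close> smooth up to the poles \<open>z = \<plusminus>1\<close>. With \<open>a = x + i y\<close> the quotient field becomes
  \<open>(x', y', z') = (m g z - y, x, m x)\<close> and the first integral becomes the linear function \<open>m y - z\<close>, so
  that its level sets are the plane sections \<open>y = (z + c)/m\<close>, \<open>x\<^sup>2 = H c z = G z - (z + c)\<^sup>2/m\<^sup>2\<close>.
  If \<open>K\<^sub>m > 0\<close> then \<open>H c\<close> is strictly concave, hence the regular level sets are ovals, which are
  parametrised smoothly, jointly in \<open>c\<close>, by polar coordinates around a point of the \<open>z\<close>-axis. As the
  quotient field is a nonvanishing multiple of the velocity of this parametrisation, the ovals are
  closed orbits. Rotating smooth local sections of the bundle along the ovals gives the tori, which are
  level sets of the first integral on the unit tangent bundle and hence invariant.\<close>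

section \<open>Calculus of iterated differentiability\<close>

text \<open>The poles shape the development. There \<gamma> vanishes, (t, \<phi>) are not
  coordinates, and the fields are known only as limits. The height z repairs this because d/dz =
  (1/\<gamma>) d/dt preserves the functions whose odd derivatives vanish at both ends, and \<gamma>'
  is one of them. The price is that G and g are smooth only on the closed interval [-1, 1], so
  smoothness is expressed by towers of one-sided derivatives. An oval through a pole touches the end
  of that interval: the implicit function theorem is applied to a continuation of G that is merely
  C^1, and higher smoothness of the radius is recovered by a bootstrap that evaluates g only inside
  [-1, 1]. The circle action on the unit tangent bundle has no global section. The local section
  \<theta> = p \<phi>, with p = 1 or p = -1, breaks down only over the pole of height -p, where the
  first integral equals p. Hence every level c is served by a p different from c, and its torus can
  be written down explicitly even when the oval passes through a pole.\<close>

lemma Ck_on_Suc_imp: "Ck_on (Suc k) U f \<Longrightarrow> Ck_on k U f"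
proof (induction k arbitrary: f)
  case 0
  then show ?case by (simp add: differentiable_imp_continuous_on)
next
  case (Suc k)
  have "f differentiable_on U" "\<And>v. Ck_on (Suc k) U (\<lambda>x. frechet_derivative f (at x) v)"
    using Suc.prems by auto
  then show ?case using Suc.IH by simp
qed

lemma Ck_on_cong:
  assumes "open U" "\<And>x. x \<in> U \<Longrightarrow> f x = g x" "Ck_on k U f"
  shows "Ck_on k U g"
  using assms(2,3)
proof (induction k arbitrary: f g)
  case 0
  then show ?case using continuous_on_cong[of U U f g] by simp
next
  case (Suc k)
  have d: "(f has_derivative frechet_derivative f (at x)) (at x)" if "x \<in> U" for x
    using Suc.prems(2) that assms(1)
    by (auto simp: differentiable_on_eq_differentiable_at frechet_derivative_works)
  have d': "(g has_derivative frechet_derivative f (at x)) (at x)" if "x \<in> U" for x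
    using has_derivative_transform_within_open[OF d[OF that] assms(1) that] Suc.prems(1) by simp
  have eq: "frechet_derivative g (at x) = frechet_derivative f (at x)" if "x \<in> U" for x
    using frechet_derivative_at[OF d'[OF that]] by simp
  have "Ck_on k U (\<lambda>x. frechet_derivative g (at x) v)" for v
    by (rule Suc.IH[of "\<lambda>x. frechet_derivative f (at x) v"]) (use eq Suc.prems(2) in auto)
  moreover have "g differentiable_on U"
    unfolding differentiable_on_eq_differentiable_at[OF assms(1)]
    using d' differentiable_def by blast
  ultimately show ?case by simp
qed

text \<open>\<open>frechet_derivative\<close> is a choice term. This rule and
  \<open>Ck_on_SucE\<close> allow any explicit derivative on the open set to take its place, so that
  the inductions below can use the sum, product and chain rules directly.\<close>

lemma Ck_on_SucI:
  assumes U: "open U" and d: "\<And>x. x \<in> U \<Longrightarrow> (f has_derivative f' x) (at x)"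
    and c: "\<And>v. Ck_on k U (\<lambda>x. f' x v)"
  shows "Ck_on (Suc k) U f"
proof -
  have "frechet_derivative f (at x) = f' x" if "x \<in> U" for x
    using frechet_derivative_at[OF d[OF that]] by simp
  then have "Ck_on k U (\<lambda>x. frechet_derivative f (at x) v)" for v
    by (intro Ck_on_cong[OF U _ c[of v]]) simp
  moreover have "f differentiable_on U"
    unfolding differentiable_on_eq_differentiable_at[OF U] using d differentiable_def by blast
  ultimately show ?thesis by simp
qed

lemma Ck_on_SucE:
  assumes "open U" "Ck_on (Suc k) U f"
  obtains f' where "\<And>x. x \<in> U \<Longrightarrow> (f has_derivative f' x) (at x)"
    and "\<And>v. Ck_on k U (\<lambda>x. f' x v)" and "Ck_on k U f"
proof (rule that)
  show "(f has_derivative frechet_derivative f (at x)) (at x)" if "x \<in> U" for x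
    using assms that by (auto simp: differentiable_on_eq_differentiable_at frechet_derivative_works)
  show "Ck_on k U (\<lambda>x. frechet_derivative f (at x) v)" for v
    using assms by simp
  show "Ck_on k U f" by (rule Ck_on_Suc_imp[OF assms(2)])
qed

section \<open>Closure of C^k maps under algebraic operations and affine substitutions\<close>

lemma Ck_on_const [intro]: "open U \<Longrightarrow> Ck_on k U (\<lambda>x. c)"
proof (induction k arbitrary: c)
  case (Suc k)
  show ?case by (rule Ck_on_SucI[where f' = "\<lambda>x v. 0"]) (use Suc in auto)
qed auto

lemma Ck_on_add:
  assumes "open U" "Ck_on k U f" "Ck_on k U g"
  shows "Ck_on k U (\<lambda>x. f x + g x)"
  using assms(2,3)
proof (induction k arbitrary: f g)
  case 0 then show ?case by (simp add: continuous_on_add)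
next
  case (Suc k)
  obtain f' where f: "\<And>x. x \<in> U \<Longrightarrow> (f has_derivative f' x) (at x)" "\<And>v. Ck_on k U (\<lambda>x. f' x v)"
    by (rule Ck_on_SucE[OF assms(1) Suc.prems(1)]) blast
  obtain g' where g: "\<And>x. x \<in> U \<Longrightarrow> (g has_derivative g' x) (at x)" "\<And>v. Ck_on k U (\<lambda>x. g' x v)"
    by (rule Ck_on_SucE[OF assms(1) Suc.prems(2)]) blast
  show ?case
    by (rule Ck_on_SucI[OF assms(1), where f' = "\<lambda>x v. f' x v + g' x v"])
      (rule has_derivative_add[OF f(1) g(1)] Suc.IH[OF f(2) g(2)] | assumption)+
qed

lemma Ck_on_bounded_linear:
  fixes f :: "'b::euclidean_space \<Rightarrow> 'c::euclidean_space" and g :: "'a::euclidean_space \<Rightarrow> 'b"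
  assumes "bounded_linear f" "open U" "Ck_on k U g"
  shows "Ck_on k U (\<lambda>x. f (g x))"
  using assms(3)
proof (induction k arbitrary: g)
  case 0 then show ?case by (simp add: bounded_linear.continuous_on[OF assms(1)])
next
  case (Suc k)
  obtain g' where g: "\<And>x. x \<in> U \<Longrightarrow> (g has_derivative g' x) (at x)" "\<And>v. Ck_on k U (\<lambda>x. g' x v)"
    by (rule Ck_on_SucE[OF assms(2) Suc.prems(1)]) blast
  show ?case
    by (rule Ck_on_SucI[OF assms(2), where f' = "\<lambda>x v. f (g' x v)"])
      (rule bounded_linear.has_derivative[OF assms(1) g(1)] Suc.IH[OF g(2)] | assumption)+
qed

text \<open>The product rule pairs f with g' and f' with g, so the induction also needs the
  undifferentiated factors one order lower; \<open>Ck_on_SucE\<close> returns them as its third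
  fact.\<close>

lemma Ck_on_bounded_bilinear:
  fixes prod :: "'b::euclidean_space \<Rightarrow> 'c::euclidean_space \<Rightarrow> 'd::euclidean_space"
    and f :: "'a::euclidean_space \<Rightarrow> 'b" and g :: "'a \<Rightarrow> 'c"
  assumes prod: "bounded_bilinear prod" and "open U" "Ck_on k U f" "Ck_on k U g"
  shows "Ck_on k U (\<lambda>x. prod (f x) (g x))"
  using assms(3,4)
proof (induction k arbitrary: f g)
  case 0 then show ?case by (simp add: bounded_bilinear.continuous_on[OF prod])
next
  case (Suc k)
  obtain f' where f: "\<And>x. x \<in> U \<Longrightarrow> (f has_derivative f' x) (at x)" "\<And>v. Ck_on k U (\<lambda>x. f' x v)"
      "Ck_on k U f"
    by (rule Ck_on_SucE[OF assms(2) Suc.prems(1)]) blast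
  obtain g' where g: "\<And>x. x \<in> U \<Longrightarrow> (g has_derivative g' x) (at x)" "\<And>v. Ck_on k U (\<lambda>x. g' x v)"
      "Ck_on k U g"
    by (rule Ck_on_SucE[OF assms(2) Suc.prems(2)]) blast
  show ?case
    by (rule Ck_on_SucI[OF assms(2), where f' = "\<lambda>x v. prod (f x) (g' x v) + prod (f' x v) (g x)"])
      (rule bounded_bilinear.FDERIV[OF prod f(1) g(1)] Ck_on_add[OF assms(2)]
        Suc.IH[OF f(3) g(2)] Suc.IH[OF f(2) g(3)] | assumption)+
qed

lemma Ck_on_linear:
  assumes "open U" "bounded_linear L"
  shows "Ck_on k U L"
proof (cases k)
  case 0
  then show ?thesis using linear_continuous_on[OF assms(2)] by simp
next
  case (Suc j)
  show ?thesis unfolding Suc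
    by (rule Ck_on_SucI[OF assms(1), where f' = "\<lambda>x. L"])
      (use assms bounded_linear_imp_has_derivative in auto)
qed

text \<open>An affine inner map has a constant derivative, so the induction closes without a general
  chain rule. It serves to pass to open subsets, to drop a variable, and to rescale the angles of a
  torus to unit period.\<close>

lemma Ck_on_affine_comp:
  assumes U: "open U" and V: "open V" and L: "bounded_linear L" and "\<And>x. x \<in> U \<Longrightarrow> a + L x \<in> V"
    and "Ck_on k V f"
  shows "Ck_on k U (\<lambda>x. f (a + L x))"
  using assms(4,5)
proof (induction k arbitrary: f)
  case 0
  have "continuous_on U (\<lambda>x. a + L x)"
    by (intro continuous_intros linear_continuous_on L)
  from continuous_on_compose2[OF _ this, of V f] have "continuous_on U (\<lambda>x. f (a + L x))"
    using 0 by auto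
  then show ?case by simp
next
  case (Suc k)
  obtain f' where f: "\<And>x. x \<in> V \<Longrightarrow> (f has_derivative f' x) (at x)" "\<And>v. Ck_on k V (\<lambda>x. f' x v)"
    by (rule Ck_on_SucE[OF V Suc.prems(2)]) blast
  show ?case
  proof (rule Ck_on_SucI[OF U])
    fix x assume x: "x \<in> U"
    have "((\<lambda>x. a + L x) has_derivative L) (at x)"
      using has_derivative_add[OF has_derivative_const bounded_linear_imp_has_derivative[OF L]] by simp
    from has_derivative_compose[OF this f(1)[OF Suc.prems(1)[OF x]]]
    show "((\<lambda>x. f (a + L x)) has_derivative (\<lambda>v. f' (a + L x) (L v))) (at x)" .
  next
    show "Ck_on k U (\<lambda>x. f' (a + L x) (L v))" for v
      using Suc.IH[OF Suc.prems(1) f(2)] by simp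
  qed
qed

text \<open>Successive derivatives are taken within \<open>S\<close>, which need not be open: the outer functions of
  the compositions below live on compact intervals whose endpoints are attained at the poles.\<close>

definition deriv_tower :: "real set \<Rightarrow> (nat \<Rightarrow> real \<Rightarrow> real) \<Rightarrow> bool" where
  "deriv_tower S F \<longleftrightarrow> (\<forall>n. \<forall>x\<in>S. (F n has_real_derivative F (Suc n) x) (at x within S))"

lemma deriv_towerD:
  "deriv_tower S F \<Longrightarrow> x \<in> S \<Longrightarrow> (F n has_real_derivative F (Suc n) x) (at x within S)"
  by (simp add: deriv_tower_def)

lemma deriv_tower_continuous: "deriv_tower S F \<Longrightarrow> continuous_on S (F n)"
  by (meson DERIV_continuous deriv_towerD continuous_on_eq_continuous_within)

lemma deriv_tower_subset: "deriv_tower S F \<Longrightarrow> T \<subseteq> S \<Longrightarrow> deriv_tower T F"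
  unfolding deriv_tower_def by (meson DERIV_subset subsetD)

lemma deriv_tower_shift: "deriv_tower S F \<Longrightarrow> deriv_tower S (\<lambda>n. F (n + k))"
  by (auto simp: deriv_tower_def)

text \<open>The derivative of \<open>F n\<close> after h is \<open>F (Suc n)\<close> after h times
  h', which has the same form; hence the induction ranges over all n. Restricting the outer
  derivative to the image of h makes one-sided derivatives sufficient even where h touches the
  boundary of \<open>S\<close>.\<close>

lemma Ck_on_deriv_tower:
  assumes U: "open U" and F: "deriv_tower S F" and h: "Ck_on k U h" and hS: "\<And>x. x \<in> U \<Longrightarrow> h x \<in> S"
  shows "Ck_on k U (\<lambda>x. F n (h x))"
  using h
proof (induction k arbitrary: n)
  case 0
  have "continuous_on U (\<lambda>x. F n (h x))"
    by (rule continuous_on_compose2[OF deriv_tower_continuous[OF F]]) (use 0 hS in auto)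
  then show ?case by simp
next
  case (Suc k)
  obtain h' where h: "\<And>x. x \<in> U \<Longrightarrow> (h has_derivative h' x) (at x)" "\<And>v. Ck_on k U (\<lambda>x. h' x v)"
      "Ck_on k U h"
    by (rule Ck_on_SucE[OF U Suc.prems(1)]) blast
  show ?case
  proof (rule Ck_on_SucI[OF U])
    fix x assume x: "x \<in> U"
    have 1: "(h has_derivative h' x) (at x within U)"
      by (rule has_derivative_at_withinI[OF h(1)[OF x]])
    have "(F n has_derivative (*) (F (Suc n) (h x))) (at (h x) within S)"
      using deriv_towerD[OF F hS[OF x], of n] by (simp add: has_field_derivative_def)
    then have "(F n has_derivative (*) (F (Suc n) (h x))) (at (h x) within h ` U)"
      by (rule has_derivative_subset) (use hS in auto)
    from has_derivative_in_compose[OF 1 this]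
    show "((\<lambda>x. F n (h x)) has_derivative (\<lambda>v. F (Suc n) (h x) * h' x v)) (at x)"
      using U x by (simp add: at_within_open[of x U])
  next
    show "Ck_on k U (\<lambda>x. F (Suc n) (h x) * h' x v)" for v
      by (rule Ck_on_bounded_bilinear[OF bounded_bilinear_mult U Suc.IH[OF h(3)] h(2)])
  qed
qed

text \<open>A shift by a quarter period differentiates the sine, so a single formula describes all
  derivatives; the entry with index 1 is the cosine.\<close>

lemma deriv_tower_sin: "deriv_tower UNIV (\<lambda>n x. sin (x + real n * (pi / 2)))"
  unfolding deriv_tower_def
proof (intro allI ballI)
  fix n and x :: real
  have "((\<lambda>x. sin (x + real n * (pi / 2))) has_real_derivative cos (x + real n * (pi / 2))) (at x)"
    by (auto intro!: derivative_eq_intros)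
  moreover have "cos (x + real n * (pi / 2)) = sin ((x + real n * (pi / 2)) + pi / 2)"
    by (subst sin_add) simp
  moreover have "(x + real n * (pi / 2)) + pi / 2 = x + real (Suc n) * (pi / 2)"
    by (simp add: algebra_simps add_divide_distrib)
  ultimately show "((\<lambda>x. sin (x + real n * (pi / 2))) has_real_derivative
      sin (x + real (Suc n) * (pi / 2))) (at x)"
    by metis
qed

lemma deriv_tower_recip: "deriv_tower (- {0}) (\<lambda>n x. (- 1) ^ n * fact n * inverse x ^ Suc n)"
  unfolding deriv_tower_def
proof (intro allI ballI)
  fix n and x :: real assume "x \<in> - {0}"
  then have x: "x \<noteq> 0" by simp
  have "((\<lambda>x. inverse x ^ Suc n) has_real_derivative
      real (Suc n) * (- (inverse x ^ Suc (Suc 0)) * inverse x ^ (Suc n - Suc 0))) (at x within - {0})"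
    by (rule DERIV_power[OF DERIV_inverse[OF x]])
  from DERIV_cmult[OF this, of "(- 1) ^ n * fact n"]
  show "((\<lambda>x. (- 1) ^ n * fact n * inverse x ^ Suc n) has_real_derivative
      (- 1) ^ Suc n * fact (Suc n) * inverse x ^ Suc (Suc n)) (at x within - {0})"
    by (rule DERIV_cong) (simp add: algebra_simps)
qed

lemma Ck_on_mult:
  fixes f g :: "'a::euclidean_space \<Rightarrow> real"
  shows "open U \<Longrightarrow> Ck_on k U f \<Longrightarrow> Ck_on k U g \<Longrightarrow> Ck_on k U (\<lambda>x. f x * g x)"
  by (rule Ck_on_bounded_bilinear[OF bounded_bilinear_mult])

lemma Ck_on_minus: "open U \<Longrightarrow> Ck_on k U f \<Longrightarrow> Ck_on k U (\<lambda>x. - f x)"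
  by (rule Ck_on_bounded_linear[OF bounded_linear_minus[OF bounded_linear_ident]])

lemma Ck_on_diff: "open U \<Longrightarrow> Ck_on k U f \<Longrightarrow> Ck_on k U g \<Longrightarrow> Ck_on k U (\<lambda>x. f x - g x)"
  using Ck_on_add[of U k f "\<lambda>x. - g x"] Ck_on_minus[of U k g] by simp

lemma Ck_on_sin: "open U \<Longrightarrow> Ck_on k U f \<Longrightarrow> Ck_on k U (\<lambda>x. sin (f x :: real))"
  using Ck_on_deriv_tower[OF _ deriv_tower_sin, of U k f 0] by simp

lemma Ck_on_cos: "open U \<Longrightarrow> Ck_on k U f \<Longrightarrow> Ck_on k U (\<lambda>x. cos (f x :: real))"
  using Ck_on_deriv_tower[OF _ deriv_tower_sin, of U k f 1] by (simp add: sin_add)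

lemma Ck_on_divide:
  fixes f g :: "'a::euclidean_space \<Rightarrow> real"
  assumes U: "open U" and "Ck_on k U f" "Ck_on k U g" "\<And>x. x \<in> U \<Longrightarrow> g x \<noteq> 0"
  shows "Ck_on k U (\<lambda>x. f x / g x)"
proof -
  have "Ck_on k U (\<lambda>x. inverse (g x))"
    using Ck_on_deriv_tower[OF U deriv_tower_recip assms(3), of 0] assms(4) by simp
  from Ck_on_mult[OF U assms(2) this] show ?thesis by (simp add: divide_inverse)
qed

lemma Ck_on_Pair:
  assumes "open U" "Ck_on k U f" "Ck_on k U g"
  shows "Ck_on k U (\<lambda>x. (f x, g x))"
proof -
  have 1: "Ck_on k U (\<lambda>x. (f x, 0))"
    using Ck_on_bounded_linear[OF bounded_linear_Pair[OF bounded_linear_ident bounded_linear_zero] assms(1,2)]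
    by simp
  have 2: "Ck_on k U (\<lambda>x. (0, g x))"
    using Ck_on_bounded_linear[OF bounded_linear_Pair[OF bounded_linear_zero bounded_linear_ident] assms(1,3)]
    by simp
  show ?thesis using Ck_on_add[OF assms(1) 1 2] by simp
qed

lemma Ck_on_complex_mult:
  fixes f g :: "'a::euclidean_space \<Rightarrow> complex"
  shows "open U \<Longrightarrow> Ck_on k U f \<Longrightarrow> Ck_on k U g \<Longrightarrow> Ck_on k U (\<lambda>x. f x * g x)"
  by (rule Ck_on_bounded_bilinear[OF bounded_bilinear_mult])

lemma Ck_on_of_real: "open U \<Longrightarrow> Ck_on k U f \<Longrightarrow> Ck_on k U (\<lambda>x. complex_of_real (f x))"
  by (rule Ck_on_bounded_linear[OF bounded_linear_of_real])

lemma Ck_on_Complex: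
  assumes "open U" "Ck_on k U f" "Ck_on k U g"
  shows "Ck_on k U (\<lambda>x. Complex (f x) (g x))"
proof -
  have "Ck_on k U (\<lambda>x. complex_of_real (f x) + \<i> * complex_of_real (g x))"
    using assms by (intro Ck_on_add Ck_on_complex_mult Ck_on_of_real Ck_on_const) auto
  then show ?thesis by (simp add: Complex_eq)
qed

lemma Ck_on_cis:
  assumes "open U" "Ck_on k U f" shows "Ck_on k U (\<lambda>x. cis (f x))"
proof -
  have "cis = (\<lambda>x. Complex (cos x) (sin x))" by (simp add: fun_eq_iff complex_eq_iff)
  then have "(\<lambda>x. cis (f x)) = (\<lambda>x. Complex (cos (f x)) (sin (f x)))" by metis
  then show ?thesis using Ck_on_Complex[OF assms(1) Ck_on_cos[OF assms] Ck_on_sin[OF assms]] by metis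
qed

lemma Ck_on_cnj: "open U \<Longrightarrow> Ck_on k U f \<Longrightarrow> Ck_on k U (\<lambda>x. cnj (f x))"
  by (rule Ck_on_bounded_linear[OF bounded_linear_cnj])

lemmas Ck_on_intros =
  Ck_on_const Ck_on_add Ck_on_diff Ck_on_minus Ck_on_mult Ck_on_divide Ck_on_sin Ck_on_cos
  Ck_on_Pair Ck_on_complex_mult Ck_on_of_real Ck_on_Complex Ck_on_cis Ck_on_cnj

section \<open>Smooth functions of one variable on a set\<close>

definition smooth1 :: "real set \<Rightarrow> (real \<Rightarrow> real) \<Rightarrow> bool" where
  "smooth1 S f \<longleftrightarrow> (\<exists>F. F 0 = f \<and> deriv_tower S F)"

lemma smooth1E:
  assumes "smooth1 S f"
  obtains F where "F 0 = f" "deriv_tower S F"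
  using assms unfolding smooth1_def by blast

lemma smooth1_subset: "smooth1 S f \<Longrightarrow> T \<subseteq> S \<Longrightarrow> smooth1 T f"
  unfolding smooth1_def using deriv_tower_subset by blast

lemma smooth1_deriv:
  assumes "smooth1 S f"
  obtains f' where "\<And>x. x \<in> S \<Longrightarrow> (f has_real_derivative f' x) (at x within S)" "smooth1 S f'"
proof -
  from assms obtain F where F: "F 0 = f" "deriv_tower S F" by (rule smooth1E)
  then have "smooth1 S (F 1)" unfolding smooth1_def using deriv_tower_shift[OF F(2), of 1] by auto
  with that[of "F 1"] F deriv_towerD[OF F(2), of _ 0] show thesis by auto
qed

lemma smooth1_continuous: "smooth1 S f \<Longrightarrow> continuous_on S f"
  by (metis smooth1E deriv_tower_continuous)

text \<open>Dependent choice strings the derivatives supplied one at a time into a single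
  tower.\<close>

lemma smooth1_coinduct:
  assumes "P f" and step: "\<And>f. P f \<Longrightarrow> \<exists>f'. (\<forall>x\<in>S. (f has_real_derivative f' x) (at x within S)) \<and> P f'"
  shows "smooth1 S f"
proof -
  have "\<exists>F. \<forall>n. (P (F n) \<and> (n = 0 \<longrightarrow> F n = f)) \<and>
      (\<forall>x\<in>S. (F n has_real_derivative F (Suc n) x) (at x within S))"
    by (rule dependent_nat_choice) (use assms in auto)
  then show ?thesis unfolding smooth1_def deriv_tower_def by blast
qed

lemma has_real_derivative_transform_on:
  assumes "x \<in> S" "\<And>y. y \<in> S \<Longrightarrow> g y = f y" "(f has_real_derivative d) (at x within S)"
  shows "(g has_real_derivative d) (at x within S)"
  using has_derivative_transform[of x S g f, OF assms(1,2)] assms(3)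
  unfolding has_field_derivative_def by blast

text \<open>The closure of the smooth functions under the field operations is closed under
  differentiation, hence consists of smooth functions.\<close>

inductive smooth_alg :: "real set \<Rightarrow> (real \<Rightarrow> real) \<Rightarrow> bool" for S where
  "smooth1 S f \<Longrightarrow> smooth_alg S f"
| "smooth_alg S f \<Longrightarrow> smooth_alg S g \<Longrightarrow> smooth_alg S (\<lambda>x. f x + g x)"
| "smooth_alg S f \<Longrightarrow> smooth_alg S g \<Longrightarrow> smooth_alg S (\<lambda>x. f x * g x)"
| "smooth_alg S f \<Longrightarrow> (\<And>x. x \<in> S \<Longrightarrow> f x \<noteq> 0) \<Longrightarrow> smooth_alg S (\<lambda>x. inverse (f x))"

lemma smooth1_const: "smooth1 S (\<lambda>x. c)"
proof -
  have "deriv_tower S (\<lambda>n x. if n = 0 then c else 0)"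
    unfolding deriv_tower_def by auto
  then show ?thesis unfolding smooth1_def by (intro exI conjI) (rule ext, auto)
qed

lemma smooth_alg_smooth1: "smooth_alg S f \<Longrightarrow> smooth1 S f"
proof (rule smooth1_coinduct[of "smooth_alg S"])
  fix f assume "smooth_alg S f"
  then show "\<exists>f'. (\<forall>x\<in>S. (f has_real_derivative f' x) (at x within S)) \<and> smooth_alg S f'"
  proof induction
    case (1 f)
    then show ?case by (metis smooth1_deriv smooth_alg.intros(1))
  next
    case (2 f g)
    then obtain f' g' where "\<forall>x\<in>S. (f has_real_derivative f' x) (at x within S)" "smooth_alg S f'"
      "\<forall>x\<in>S. (g has_real_derivative g' x) (at x within S)" "smooth_alg S g'" by blast
    then show ?case
      by (intro exI[of _ "\<lambda>x. f' x + g' x"] conjI ballI smooth_alg.intros(2) DERIV_add) auto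
  next
    case (3 f g)
    then obtain f' g' where *: "\<forall>x\<in>S. (f has_real_derivative f' x) (at x within S)" "smooth_alg S f'"
      "\<forall>x\<in>S. (g has_real_derivative g' x) (at x within S)" "smooth_alg S g'" by blast
    have "smooth_alg S (\<lambda>x. f' x * g x + g' x * f x)"
      by (intro smooth_alg.intros(2,3) 3 *)
    with * show ?case
      by (intro exI[of _ "\<lambda>x. f' x * g x + g' x * f x"] conjI ballI DERIV_mult) auto
  next
    case (4 f)
    then obtain f' where *: "\<forall>x\<in>S. (f has_real_derivative f' x) (at x within S)" "smooth_alg S f'"
      by blast
    have "smooth_alg S (\<lambda>x. - 1 * (f' x * (inverse (f x) * inverse (f x))))"
      by (intro smooth_alg.intros(3,4) smooth_alg.intros(1)[OF smooth1_const] 4 *)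
    moreover have "((\<lambda>x. inverse (f x)) has_real_derivative - 1 * (f' x * (inverse (f x) * inverse (f x))))
        (at x within S)" if "x \<in> S" for x
      using DERIV_inverse_fun[of f "f' x" x S] * 4(2) that by (simp add: mult_ac)
    ultimately show ?case
      by (intro exI[of _ "\<lambda>x. - 1 * (f' x * (inverse (f x) * inverse (f x)))"] conjI ballI)
  qed
qed

lemma smooth1_add: "smooth1 S f \<Longrightarrow> smooth1 S g \<Longrightarrow> smooth1 S (\<lambda>x. f x + g x)"
  by (rule smooth_alg_smooth1, rule smooth_alg.intros(2)) (rule smooth_alg.intros(1), assumption)+

lemma smooth1_mult: "smooth1 S f \<Longrightarrow> smooth1 S g \<Longrightarrow> smooth1 S (\<lambda>x. f x * g x)"
  by (rule smooth_alg_smooth1, rule smooth_alg.intros(3)) (rule smooth_alg.intros(1), assumption)+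

lemma smooth1_diff: "smooth1 S f \<Longrightarrow> smooth1 S g \<Longrightarrow> smooth1 S (\<lambda>x. f x - g x)"
  using smooth1_add[of S f "\<lambda>x. - 1 * g x"] smooth1_mult[OF smooth1_const, of S g "- 1"] by simp

lemma smooth1_divide:
  assumes "smooth1 S f" "smooth1 S g" "\<And>x. x \<in> S \<Longrightarrow> g x \<noteq> 0"
  shows "smooth1 S (\<lambda>x. f x / g x)"
proof -
  have "smooth1 S (\<lambda>x. inverse (g x))"
    by (rule smooth_alg_smooth1, rule smooth_alg.intros(4), rule smooth_alg.intros(1)) (use assms in auto)
  from smooth1_mult[OF assms(1) this] show ?thesis by (simp add: divide_inverse)
qed

text \<open>Hadamard's lemma: the quotient is \<open>\<integral>\<^sub>0\<^sup>1 f'(e + s (x - e)) ds\<close>.\<close>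

lemma smooth1_factor:
  assumes "smooth1 {a..b} f" and e: "e \<in> {a..b}" and fe: "f e = 0"
  obtains q where "smooth1 {a..b} q" "\<And>x. x \<in> {a..b} \<Longrightarrow> f x = (x - e) * q x"
proof -
  obtain F where F: "F 0 = f" "deriv_tower {a..b} F" by (rule smooth1E[OF assms(1)])
  define h where "h = (\<lambda>x s :: real. e + s * (x - e))"
  have h_mem: "h x s \<in> {a..b}" if "x \<in> {a..b}" "s \<in> {0..1}" for x s
  proof -
    have "h x s = (1 - s) *\<^sub>R e + s *\<^sub>R x" by (simp add: h_def algebra_simps)
    moreover have "(1 - s) *\<^sub>R e + s *\<^sub>R x \<in> {a..b}"
      using that e by (intro convexD[OF convex_real_interval(5)]) auto
    ultimately show ?thesis by simp
  qed
  define Q where "Q = (\<lambda>n x. integral (cbox 0 1) (\<lambda>s. s ^ n * F (Suc n) (h x s)))"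
  have cont: "continuous_on ({a..b} \<times> cbox 0 1) (\<lambda>(x, s). s ^ k * F n (h x s))" for k n
    unfolding split_beta
  proof (intro continuous_intros)
    have "continuous_on ({a..b} \<times> {0..1}) (\<lambda>p. h (fst p) (snd p))"
      unfolding h_def by (intro continuous_intros)
    from continuous_on_compose2[OF deriv_tower_continuous[OF F(2), of n] this]
    show "continuous_on ({a..b} \<times> cbox 0 1) (\<lambda>p. F n (h (fst p) (snd p)))"
      using h_mem by force
  qed
  have "deriv_tower {a..b} Q"
    unfolding deriv_tower_def
  proof (intro allI ballI)
    fix n x assume x: "x \<in> {a..b}"
    show "(Q n has_real_derivative Q (Suc n) x) (at x within {a..b})"
      unfolding Q_def
    proof (rule leibniz_rule_field_derivative)
      fix x s assume xs: "x \<in> {a..b}" "s \<in> cbox 0 (1::real)"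
      have d1: "((\<lambda>x. h x s) has_real_derivative s) (at x within {a..b})"
        unfolding h_def by (auto intro!: derivative_eq_intros)
      have "(F (Suc n) has_real_derivative F (Suc (Suc n)) (h x s)) (at (h x s) within {a..b})"
        by (rule deriv_towerD[OF F(2)]) (use h_mem xs in auto)
      then have "(F (Suc n) has_real_derivative F (Suc (Suc n)) (h x s))
          (at (h x s) within (\<lambda>x. h x s) ` {a..b})"
        by (rule DERIV_subset) (use h_mem xs in auto)
      from DERIV_cmult[OF DERIV_image_chain[OF this d1], of "s ^ n"]
      show "((\<lambda>x. s ^ n * F (Suc n) (h x s)) has_real_derivative
          s ^ Suc n * F (Suc (Suc n)) (h x s)) (at x within {a..b})"
        by (simp add: o_def mult_ac)
    next
      fix x assume x: "x \<in> {a..b}"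
      have "continuous_on (cbox 0 1) (\<lambda>s. (\<lambda>(x, s). s ^ n * F (Suc n) (h x s)) (x, s))"
        by (rule continuous_on_compose2[OF cont]) (use x in \<open>auto intro!: continuous_intros\<close>)
      then show "(\<lambda>s. s ^ n * F (Suc n) (h x s)) integrable_on cbox 0 1"
        by (intro integrable_continuous) simp
    next
      show "continuous_on ({a..b} \<times> cbox 0 1) (\<lambda>(x, t). t ^ Suc n * F (Suc (Suc n)) (h x t))"
        by (rule cont)
    qed (use x in auto)
  qed
  then have "smooth1 {a..b} (Q 0)" unfolding smooth1_def by blast
  moreover have "f x = (x - e) * Q 0 x" if x: "x \<in> {a..b}" for x
  proof -
    have "((\<lambda>s. F 0 (h x s)) has_vector_derivative (x - e) * F 1 (h x s)) (at s within {0..1})"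
      if "s \<in> {0..1}" for s
    proof -
      have d1: "((\<lambda>s. h x s) has_real_derivative (x - e)) (at s within {0..1})"
        unfolding h_def by (auto intro!: derivative_eq_intros)
      have "(F 0 has_real_derivative F 1 (h x s)) (at (h x s) within {a..b})"
        using deriv_towerD[OF F(2) h_mem[OF x that], of 0] by simp
      then have "(F 0 has_real_derivative F 1 (h x s)) (at (h x s) within h x ` {0..1})"
        by (rule DERIV_subset) (use h_mem x in auto)
      from DERIV_image_chain[OF this d1] show ?thesis
        by (simp add: o_def mult_ac has_real_derivative_iff_has_vector_derivative)
    qed
    from fundamental_theorem_of_calculus[of 0 1, OF _ this]
    have "integral {0..1} (\<lambda>s. (x - e) * F 1 (h x s)) = F 0 (h x 1) - F 0 (h x 0)"
      by (intro integral_unique) auto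
    then show ?thesis by (simp add: Q_def h_def F(1) fe)
  qed
  ultimately show ?thesis by (rule that)
qed

section \<open>Leibniz rule and uniqueness for derivative towers\<close>

lemma Leibniz_sum:
  fixes a :: "nat \<Rightarrow> nat \<Rightarrow> real"
  shows "(\<Sum>i\<le>n. real (n choose i) * (a (Suc i) (n - i) + a i (Suc (n - i)))) =
    (\<Sum>i\<le>Suc n. real (Suc n choose i) * a i (Suc n - i))"
proof -
  \<comment> \<open>The sum may be extended to the index Suc n, whose binomial coefficient is zero;
    splitting off the index 0 then aligns it for Pascal's rule.\<close>
  have 1: "(\<Sum>i\<le>n. real (n choose i) * a i (Suc n - i)) =
      a 0 (Suc n) + (\<Sum>i\<le>n. real (n choose Suc i) * a (Suc i) (n - i))"
  proof -
    have "(\<Sum>i\<le>n. real (n choose i) * a i (Suc n - i)) = (\<Sum>i\<le>Suc n. real (n choose i) * a i (Suc n - i))"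
      by simp
    then show ?thesis by (simp add: sum.atMost_Suc_shift del: sum.atMost_Suc)
  qed
  have "(\<Sum>i\<le>Suc n. real (Suc n choose i) * a i (Suc n - i)) =
      a 0 (Suc n) + (\<Sum>i\<le>n. (real (n choose i) + real (n choose Suc i)) * a (Suc i) (n - i))"
    by (simp add: sum.atMost_Suc_shift del: sum.atMost_Suc)
  also have "\<dots> = (\<Sum>i\<le>n. real (n choose i) * a (Suc i) (n - i)) +
      (a 0 (Suc n) + (\<Sum>i\<le>n. real (n choose Suc i) * a (Suc i) (n - i)))"
    by (simp add: algebra_simps sum.distrib)
  also have "\<dots> = (\<Sum>i\<le>n. real (n choose i) * a (Suc i) (n - i)) + (\<Sum>i\<le>n. real (n choose i) * a i (Suc n - i))"
    by (simp only: 1)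
  also have "\<dots> = (\<Sum>i\<le>n. real (n choose i) * (a (Suc i) (n - i) + a i (Suc (n - i))))"
    by (simp add: sum.distrib[symmetric] algebra_simps Suc_diff_le)
  finally show ?thesis by simp
qed

lemma deriv_tower_mult:
  assumes "deriv_tower S F" "deriv_tower S H"
  shows "deriv_tower S (\<lambda>n x. \<Sum>i\<le>n. real (n choose i) * (F i x * H (n - i) x))"
  unfolding deriv_tower_def
proof (intro allI ballI)
  fix n x assume x: "x \<in> S"
  have "((\<lambda>x. \<Sum>i\<le>n. real (n choose i) * (F i x * H (n - i) x)) has_real_derivative
      (\<Sum>i\<le>n. real (n choose i) * (F (Suc i) x * H (n - i) x + H (Suc (n - i)) x * F i x))) (at x within S)"
    by (intro DERIV_sum DERIV_cmult DERIV_mult deriv_towerD assms x)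
  moreover have "(\<Sum>i\<le>n. real (n choose i) * (F (Suc i) x * H (n - i) x + H (Suc (n - i)) x * F i x)) =
      (\<Sum>i\<le>Suc n. real (Suc n choose i) * (F i x * H (Suc n - i) x))"
    using Leibniz_sum[of n "\<lambda>i j. F i x * H j x"] by (simp add: mult.commute)
  ultimately show "((\<lambda>x. \<Sum>i\<le>n. real (n choose i) * (F i x * H (n - i) x)) has_real_derivative
      (\<Sum>i\<le>Suc n. real (Suc n choose i) * (F i x * H (Suc n - i) x))) (at x within S)"
    by simp
qed

text \<open>One-sided derivatives on a nondegenerate interval are unique, also at the endpoints.
  This lets the tower of a product be compared with its Leibniz expansion at the poles, where the
  parity argument takes place.\<close>

lemma deriv_tower_unique:
  assumes F: "deriv_tower {a..b} F" and H: "deriv_tower {a..b} H" and "a < b"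
    and "\<And>x. x \<in> {a..b} \<Longrightarrow> F 0 x = H 0 x" and "x \<in> {a..b}"
  shows "F n x = H n x"
  using assms(5)
proof (induction n arbitrary: x)
  case 0 then show ?case by (rule assms(4))
next
  case (Suc n)
  have "(H n has_real_derivative F (Suc n) x) (at x within {a..b})"
    by (rule has_real_derivative_transform_on[OF Suc.prems _ deriv_towerD[OF F Suc.prems]])
      (use Suc.IH in simp)
  moreover have "(H n has_real_derivative H (Suc n) x) (at x within {a..b})"
    by (rule deriv_towerD[OF H Suc.prems])
  moreover have "at x within {a..b} \<noteq> bot"
    using Suc.prems assms(3) by (simp add: trivial_limit_within islimpt_Icc)
  ultimately show ?case
    unfolding has_real_derivative_iff_has_vector_derivative by (rule vector_derivative_unique_within[rotated])
qed

section \<open>The profile as a function of the height\<close>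

lemma has_real_derivative_unique_Icc:
  assumes "(f has_real_derivative c) (at x within {a..b})" "(f has_real_derivative d) (at x within {a..b})"
    and "a < b" "x \<in> {a..b}"
  shows "c = d"
proof -
  have "at x within {a..b} \<noteq> bot"
    using assms(3,4) by (simp add: trivial_limit_within islimpt_Icc)
  then show ?thesis
    using assms(1,2) unfolding has_real_derivative_iff_has_vector_derivative
    by (rule vector_derivative_unique_within)
qed

locale profile =
  fixes l :: real and \<gamma> :: "real \<Rightarrow> real"
  assumes np: "normalized_profile l \<gamma>"
begin

definition d\<gamma> :: "real \<Rightarrow> real" where "d\<gamma> = profile_deriv l \<gamma> 1"

lemmas l_pos = normalized_profileD(1)[OF np]
lemmas \<gamma>_ends = normalized_profileD(2,3)[OF np]
lemmas \<gamma>_pos = normalized_profileD(4)[OF np]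

lemma \<gamma>_nonneg: "t \<in> {0..l} \<Longrightarrow> 0 \<le> \<gamma> t"
  using \<gamma>_pos[of t] \<gamma>_ends by (cases "t = 0 \<or> t = l") (force intro: less_imp_le)+

lemma d\<gamma>_ends: "d\<gamma> 0 = 1" "d\<gamma> l = -1"
  and abs_d\<gamma>: "t \<in> {0<..<l} \<Longrightarrow> \<bar>d\<gamma> t\<bar> < 1"
  using np unfolding normalized_profile_def d\<gamma>_def by blast+

lemma even_derivs: "profile_deriv l \<gamma> (2 * n) 0 = 0" "profile_deriv l \<gamma> (2 * n) l = 0"
  using np unfolding normalized_profile_def by blast+

lemma tower_\<gamma>: "deriv_tower {0..l} (profile_deriv l \<gamma>)"
  unfolding deriv_tower_def
proof (intro allI ballI)
  fix n t assume t: "t \<in> {0..l}"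
  have "profile_deriv l \<gamma> n differentiable (at t within {0..l})"
    using normalized_profileD(6)[OF np, of n] t by (simp add: differentiable_on_def)
  then show "(profile_deriv l \<gamma> n has_real_derivative profile_deriv l \<gamma> (Suc n) t) (at t within {0..l})"
    by (simp add: vector_derivative_works has_real_derivative_iff_has_vector_derivative)
qed

lemma smooth1_\<gamma>: "smooth1 {0..l} \<gamma>"
  unfolding smooth1_def using tower_\<gamma> by (intro exI[of _ "profile_deriv l \<gamma>"]) auto

lemma \<gamma>_deriv: "t \<in> {0..l} \<Longrightarrow> (\<gamma> has_real_derivative d\<gamma> t) (at t within {0..l})"
  unfolding d\<gamma>_def by (rule profile_deriv_1[OF np])

lemma \<gamma>_deriv_at: "t \<in> {0<..<l} \<Longrightarrow> (\<gamma> has_real_derivative d\<gamma> t) (at t)"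
  using \<gamma>_deriv[of t] at_within_Icc_at[of 0 t l] by simp

lemma d\<gamma>_deriv: "t \<in> {0..l} \<Longrightarrow> (d\<gamma> has_real_derivative profile_deriv l \<gamma> 2 t) (at t within {0..l})"
  unfolding d\<gamma>_def using deriv_towerD[OF tower_\<gamma>, of t 1] by (simp add: numeral_2_eq_2)

lemma d\<gamma>_deriv_at: "t \<in> {0<..<l} \<Longrightarrow> (d\<gamma> has_real_derivative profile_deriv l \<gamma> 2 t) (at t)"
  using d\<gamma>_deriv[of t] at_within_Icc_at[of 0 t l] by simp

lemma Gam_deriv_at: "t \<in> {0<..<l} \<Longrightarrow> (Gam \<gamma> has_real_derivative \<gamma> t) (at t)"
  using Gam_deriv[OF np, of t] at_within_Icc_at[of 0 t l] by simp

lemma cont_\<gamma>: "continuous_on {0..l} \<gamma>"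
  by (rule smooth1_continuous[OF smooth1_\<gamma>])

lemma cont_d\<gamma>: "continuous_on {0..l} d\<gamma>"
  unfolding d\<gamma>_def by (rule deriv_tower_continuous[OF tower_\<gamma>])

lemma cont_Gam: "continuous_on {0..l} (Gam \<gamma>)"
  using Gam_deriv[OF np] by (meson DERIV_continuous continuous_on_eq_continuous_within)

text \<open>The zeros of \<gamma> at the ends are simple because its slopes there are 1 and -1, so
  the cofactor left after removing t and t - l vanishes nowhere.\<close>

lemma \<gamma>_factor:
  obtains e where "smooth1 {0..l} e" "\<And>t. t \<in> {0..l} \<Longrightarrow> \<gamma> t = t * (t - l) * e t"
    "\<And>t. t \<in> {0..l} \<Longrightarrow> e t \<noteq> 0"
proof -
  obtain q where q: "smooth1 {0..l} q" "\<And>x. x \<in> {0..l} \<Longrightarrow> \<gamma> x = (x - 0) * q x"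
    using smooth1_factor[OF smooth1_\<gamma>, of 0] l_pos \<gamma>_ends by auto
  have "q l = 0" using q(2)[of l] \<gamma>_ends l_pos by simp
  then obtain e where e: "smooth1 {0..l} e" "\<And>x. x \<in> {0..l} \<Longrightarrow> q x = (x - l) * e x"
    using smooth1_factor[OF q(1), of l] l_pos by auto
  have eq: "\<gamma> t = t * (t - l) * e t" if "t \<in> {0..l}" for t
    using q(2)[OF that] e(2)[OF that] by simp
  obtain e' where e': "\<And>t. t \<in> {0..l} \<Longrightarrow> (e has_real_derivative e' t) (at t within {0..l})"
    by (rule smooth1_deriv[OF e(1)]) blast
  \<comment> \<open>At an endpoint only one of the three terms survives, a nonzero multiple of
    \<open>e t\<close>; so \<open>e t = 0\<close> would contradict the slope there.\<close>
  have d: "d\<gamma> t = (t - l) * e t + t * e t + t * (t - l) * e' t" if t: "t \<in> {0..l}" for t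
  proof (rule has_real_derivative_unique_Icc[OF \<gamma>_deriv[OF t] _ l_pos t])
    have "((\<lambda>t. t * (t - l) * e t) has_real_derivative (t - l) * e t + t * e t + t * (t - l) * e' t)
        (at t within {0..l})"
      by (auto intro!: derivative_eq_intros e' t simp: algebra_simps)
    then show "(\<gamma> has_real_derivative (t - l) * e t + t * e t + t * (t - l) * e' t) (at t within {0..l})"
      by (rule has_real_derivative_transform_on[OF t, rotated]) (rule eq)
  qed
  have "e t \<noteq> 0" if t: "t \<in> {0..l}" for t
  proof
    assume 0: "e t = 0"
    consider "t = 0" | "t = l" | "t \<in> {0<..<l}" using t by force
    then show False
      by cases (use d[OF t] d\<gamma>_ends 0 eq[OF t] \<gamma>_pos[of t] in auto)
  qed
  with e(1) eq show thesis by (rule that)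
qed

text \<open>Both functions contain the factors t and t - l, which cancel; what remains is a division
  by the nowhere vanishing cofactor of \<gamma>.\<close>

lemma divide_by_\<gamma>:
  assumes "smooth1 {0..l} h" "h 0 = 0" "h l = 0"
  obtains q where "smooth1 {0..l} q" "\<And>t. t \<in> {0..l} \<Longrightarrow> h t = \<gamma> t * q t"
proof -
  obtain e where e: "smooth1 {0..l} e" "\<And>t. t \<in> {0..l} \<Longrightarrow> \<gamma> t = t * (t - l) * e t"
    "\<And>t. t \<in> {0..l} \<Longrightarrow> e t \<noteq> 0" by (rule \<gamma>_factor) blast
  obtain h1 where h1: "smooth1 {0..l} h1" "\<And>x. x \<in> {0..l} \<Longrightarrow> h x = (x - 0) * h1 x"
    using smooth1_factor[OF assms(1), of 0] l_pos assms(2) by auto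
  have "h1 l = 0" using h1(2)[of l] assms(3) l_pos by simp
  then obtain h2 where h2: "smooth1 {0..l} h2" "\<And>x. x \<in> {0..l} \<Longrightarrow> h1 x = (x - l) * h2 x"
    using smooth1_factor[OF h1(1), of l] l_pos by auto
  show thesis
  proof (rule that[OF smooth1_divide[OF h2(1) e(1,3)]])
    fix t assume t: "t \<in> {0..l}"
    show "h t = \<gamma> t * (h2 t / e t)"
      using h1(2)[OF t] h2(2)[OF t] e(2,3)[OF t] by simp
  qed
qed

text \<open>Functions whose odd derivatives vanish at both poles: the restrictions of smooth functions
  invariant under reflection in either pole.\<close>

definition even_ends :: "(real \<Rightarrow> real) \<Rightarrow> bool" where
  "even_ends f \<longleftrightarrow> (\<exists>F. F 0 = f \<and> deriv_tower {0..l} F \<and>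
     (\<forall>n. F (Suc (2 * n)) 0 = 0 \<and> F (Suc (2 * n)) l = 0))"

lemma even_ends_smooth1: "even_ends f \<Longrightarrow> smooth1 {0..l} f"
  unfolding even_ends_def smooth1_def by blast

lemma even_ends_d\<gamma>: "even_ends d\<gamma>"
proof -
  have "profile_deriv l \<gamma> (Suc (2 * n) + 1) 0 = 0 \<and> profile_deriv l \<gamma> (Suc (2 * n) + 1) l = 0" for n
    using even_derivs[of "Suc n"] by simp
  then show ?thesis
    unfolding even_ends_def d\<gamma>_def using deriv_tower_shift[OF tower_\<gamma>, of 1]
    by (intro exI[of _ "\<lambda>n. profile_deriv l \<gamma> (n + 1)"]) (auto simp del: profile_deriv.simps)
qed

text \<open>The derivation \<open>f'/\<gamma>\<close>, which is the derivative with respect to the height \<open>\<Gamma>\<close>, preserves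
  this class; the parity of the quotient comes from comparing Leibniz expansions at the poles.\<close>

lemma even_ends_step:
  assumes "even_ends f"
  shows "\<exists>q. (\<forall>t\<in>{0..l}. (f has_real_derivative \<gamma> t * q t) (at t within {0..l})) \<and> even_ends q"
proof -
  obtain F where F: "F 0 = f" "deriv_tower {0..l} F"
      "\<And>n. F (Suc (2 * n)) 0 = 0" "\<And>n. F (Suc (2 * n)) l = 0"
    using assms unfolding even_ends_def by blast
  have "smooth1 {0..l} (F 1)"
    unfolding smooth1_def using deriv_tower_shift[OF F(2), of 1] by auto
  then obtain q where q: "smooth1 {0..l} q" "\<And>t. t \<in> {0..l} \<Longrightarrow> F 1 t = \<gamma> t * q t"
    using divide_by_\<gamma>[of "F 1"] F(3)[of 0] F(4)[of 0] by auto
  obtain Q where Q: "Q 0 = q" "deriv_tower {0..l} Q" by (rule smooth1E[OF q(1)])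
  have leib: "F (n + 1) t = (\<Sum>i\<le>n. real (n choose i) * (Q i t * profile_deriv l \<gamma> (n - i) t))"
    if "t \<in> {0..l}" for n t
    by (rule deriv_tower_unique[OF deriv_tower_shift[OF F(2)] deriv_tower_mult[OF Q(2) tower_\<gamma>] l_pos _ that])
      (use q(2) Q(1) in \<open>simp add: mult.commute\<close>)
  have odd: "Q (Suc (2 * n)) p = 0" if p: "p \<in> {0, l}" for n p
  proof (induction n rule: less_induct)
    case (less n)
    have pm: "p \<in> {0..l}" using p l_pos by auto
    have "p = 0 \<or> p = l" using p by blast
    then have p1: "profile_deriv l \<gamma> 1 p \<noteq> 0" using d\<gamma>_ends unfolding d\<gamma>_def by auto
    \<comment> \<open>The Leibniz terms of order 2 n + 2 of f' = \<gamma> q at the pole. For even i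
      the derivative of \<gamma> has even order and vanishes there; the terms with odd i below 2 n +
      1 vanish by induction. The total is an odd derivative of f, hence zero. So the one remaining
      term, i = 2 n + 1, is zero, and its factor \<gamma>' is not.\<close>
    define a where "a = (\<lambda>i. real (2 * n + 2 choose i) * (Q i p * profile_deriv l \<gamma> (2 * n + 2 - i) p))"
    have "a i = 0" if "i \<le> 2 * n + 2" "i \<noteq> 2 * n + 1" for i
    proof (cases "even i")
      case True
      then obtain j where "i = 2 * j" by blast
      then have "2 * n + 2 - i = 2 * (n + 1 - j)" by simp
      then have "profile_deriv l \<gamma> (2 * n + 2 - i) p = 0"
        using even_derivs[of "n + 1 - j"] p by (auto simp del: profile_deriv.simps)
      then show ?thesis by (simp only: a_def mult_zero_right)
    next
      case False
      then obtain j where j: "i = Suc (2 * j)" by (metis oddE Suc_eq_plus1)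
      with that have "j < n" by simp
      from less.IH[OF this] j show ?thesis by (simp add: a_def)
    qed
    then have "(\<Sum>i\<le>2 * n + 2. a i) = a (2 * n + 1)"
      using sum.mono_neutral_right[of "{..2 * n + 2}" "{2 * n + 1}" a] by auto
    moreover have "(\<Sum>i\<le>2 * n + 2. a i) = F (2 * n + 2 + 1) p"
      unfolding a_def by (rule leib[OF pm, symmetric])
    moreover have "F (2 * n + 2 + 1) p = 0"
      using F(3,4)[of "Suc n"] p by auto
    ultimately have "a (2 * n + 1) = 0" by simp
    moreover have "2 * n + 2 - (2 * n + 1) = 1" "2 * n + 2 choose (2 * n + 1) \<noteq> 0"
      by (simp_all del: binomial_Suc_Suc)
    ultimately have "Q (2 * n + 1) p = 0" using p1 unfolding a_def by (simp only: mult_eq_0_iff of_nat_eq_0_iff) simp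
    then show ?case by simp
  qed
  have "even_ends q"
    unfolding even_ends_def using Q odd by blast
  moreover have "(f has_real_derivative \<gamma> t * q t) (at t within {0..l})" if "t \<in> {0..l}" for t
    using deriv_towerD[OF F(2) that, of 0] q(2)[OF that] F(1) by simp
  ultimately show ?thesis by blast
qed

section \<open>The inverse of the height function and derivatives with respect to the height\<close>

definition \<tau> :: "real \<Rightarrow> real" where "\<tau> = the_inv_into {0..l} (Gam \<gamma>)"

lemma inj_Gam: "inj_on (Gam \<gamma>) {0..l}"
  using Gam_eq_iff[OF np] by (auto intro!: inj_onI)

lemma Gam_mem: "t \<in> {0..l} \<Longrightarrow> Gam \<gamma> t \<in> {-1..1}"
  using Gam_strict_mono[OF np, of 0 t] Gam_strict_mono[OF np, of t l] Gam_ends[OF np]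
  by (cases "t = 0"; cases "t = l") auto

lemma Gam_mem_open: "t \<in> {0<..<l} \<Longrightarrow> Gam \<gamma> t \<in> {-1<..<1}"
  using Gam_strict_mono[OF np, of 0 t] Gam_strict_mono[OF np, of t l] Gam_ends[OF np] by auto

lemma Gam_image: "Gam \<gamma> ` {0..l} = {-1..1}"
proof
  show "Gam \<gamma> ` {0..l} \<subseteq> {-1..1}" using Gam_mem by blast
  show "{-1..1} \<subseteq> Gam \<gamma> ` {0..l}"
  proof
    fix z :: real assume "z \<in> {-1..1}"
    then show "z \<in> Gam \<gamma> ` {0..l}"
      using IVT'[of "Gam \<gamma>" 0 z l] Gam_ends[OF np] l_pos cont_Gam by force
  qed
qed

lemma \<tau>_mem: "z \<in> {-1..1} \<Longrightarrow> \<tau> z \<in> {0..l}"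
  unfolding \<tau>_def using the_inv_into_into[OF inj_Gam, of z "{0..l}"] Gam_image by auto

lemma Gam_\<tau>: "z \<in> {-1..1} \<Longrightarrow> Gam \<gamma> (\<tau> z) = z"
  unfolding \<tau>_def using f_the_inv_into_f[OF inj_Gam, of z] Gam_image by auto

lemma \<tau>_Gam: "t \<in> {0..l} \<Longrightarrow> \<tau> (Gam \<gamma> t) = t"
  unfolding \<tau>_def by (rule the_inv_into_f_f[OF inj_Gam])

lemma \<tau>_ends: "\<tau> (-1) = 0" "\<tau> 1 = l"
  using \<tau>_Gam[of 0] \<tau>_Gam[of l] Gam_ends[OF np] l_pos by auto

lemma \<tau>_mem_open: "z \<in> {-1<..<1} \<Longrightarrow> \<tau> z \<in> {0<..<l}"
  using \<tau>_mem[of z] Gam_\<tau>[of z] Gam_ends[OF np]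
  by (cases "\<tau> z = 0"; cases "\<tau> z = l") auto

lemma cont_\<tau>: "continuous_on {-1..1} \<tau>"
  using continuous_on_inv[OF cont_Gam compact_Icc, of \<tau>] \<tau>_Gam Gam_image by simp

lemma \<tau>_deriv:
  assumes z: "z \<in> {-1<..<1}"
  shows "(\<tau> has_real_derivative inverse (\<gamma> (\<tau> z))) (at z)"
proof (rule DERIV_inverse_function[of "Gam \<gamma>" _ _ _ "-1" 1])
  show "(Gam \<gamma> has_real_derivative \<gamma> (\<tau> z)) (at (\<tau> z))"
    by (rule Gam_deriv_at[OF \<tau>_mem_open[OF z]])
  show "\<gamma> (\<tau> z) \<noteq> 0" using \<gamma>_pos[OF \<tau>_mem_open[OF z]] by simp
  show "isCont \<tau> z"
    using continuous_on_interior[OF cont_\<tau>, of z] z by simp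
qed (use z Gam_\<tau> in auto)

text \<open>The inverse height \<tau> has derivative 1/\<gamma>, which is unbounded at the poles, so
  the chain rule covers only the interior. The formula is integrated over the interior, and the
  fundamental theorem with the continuous integrand returns the derivative at the endpoints.\<close>

lemma height_deriv:
  assumes f: "continuous_on {0..l} f" and q: "continuous_on {0..l} q"
    and d: "\<And>t. t \<in> {0<..<l} \<Longrightarrow> (f has_real_derivative \<gamma> t * q t) (at t)"
    and z: "z \<in> {-1..1}"
  shows "((\<lambda>z. f (\<tau> z)) has_real_derivative q (\<tau> z)) (at z within {-1..1})"
proof -
  have c: "continuous_on {-1..1} (\<lambda>z. f (\<tau> z))" "continuous_on {-1..1} (\<lambda>z. q (\<tau> z))"
    using continuous_on_compose2[OF f cont_\<tau>] continuous_on_compose2[OF q cont_\<tau>] \<tau>_mem by blast+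
  have int: "((\<lambda>z. f (\<tau> z)) has_real_derivative q (\<tau> z)) (at z)" if z: "z \<in> {-1<..<1}" for z
  proof -
    have "\<gamma> (\<tau> z) \<noteq> 0" using \<gamma>_pos[OF \<tau>_mem_open[OF z]] by simp
    then have "\<gamma> (\<tau> z) * q (\<tau> z) * inverse (\<gamma> (\<tau> z)) = q (\<tau> z)" by simp
    with DERIV_chain2[OF d[OF \<tau>_mem_open[OF z]] \<tau>_deriv[OF z]] show ?thesis by metis
  qed
  have eq: "f (\<tau> y) = f (\<tau> (-1)) + integral {-1..y} (\<lambda>z. q (\<tau> z))" if y: "y \<in> {-1..1}" for y
  proof -
    have "((\<lambda>z. q (\<tau> z)) has_integral f (\<tau> y) - f (\<tau> (-1))) {-1..y}"
    proof (rule fundamental_theorem_of_calculus_interior)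
      show "continuous_on {-1..y} (\<lambda>z. f (\<tau> z))"
        by (rule continuous_on_subset[OF c(1)]) (use y in auto)
      show "((\<lambda>z. f (\<tau> z)) has_vector_derivative q (\<tau> x)) (at x)" if "x \<in> {-1<..<y}" for x
        using int[of x] that y by (simp add: has_real_derivative_iff_has_vector_derivative)
    qed (use y in auto)
    then show ?thesis by (simp add: integral_unique)
  qed
  have "((\<lambda>y. f (\<tau> (-1)) + integral {-1..y} (\<lambda>z. q (\<tau> z))) has_real_derivative q (\<tau> z)) (at z within {-1..1})"
    using integral_has_real_derivative[OF c(2) z] by (auto intro!: derivative_eq_intros)
  then show ?thesis
    by (rule has_real_derivative_transform_on[OF z, rotated]) (rule eq)
qed

definition G :: "real \<Rightarrow> real" where "G z = (\<gamma> (\<tau> z))\<^sup>2"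
definition g :: "real \<Rightarrow> real" where "g z = d\<gamma> (\<tau> z)"

lemma G_Gam: "t \<in> {0..l} \<Longrightarrow> G (Gam \<gamma> t) = (\<gamma> t)\<^sup>2"
  and g_Gam: "t \<in> {0..l} \<Longrightarrow> g (Gam \<gamma> t) = d\<gamma> t"
  by (simp_all add: G_def g_def \<tau>_Gam)

lemma G_deriv: "z \<in> {-1..1} \<Longrightarrow> (G has_real_derivative 2 * g z) (at z within {-1..1})"
  unfolding G_def g_def
proof (rule height_deriv[of "\<lambda>t. (\<gamma> t)\<^sup>2" "\<lambda>t. 2 * d\<gamma> t"])
  show "((\<lambda>t. (\<gamma> t)\<^sup>2) has_real_derivative \<gamma> t * (2 * d\<gamma> t)) (at t)" if "t \<in> {0<..<l}" for t
    using DERIV_power[OF \<gamma>_deriv_at[OF that], of 2] by (simp add: mult_ac)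
qed (intro continuous_intros cont_\<gamma> cont_d\<gamma>)+

text \<open>The z-derivatives of g arise by iterating \<open>even_ends_step\<close> from
  \<open>d\<gamma>\<close>: each iterate is again of even type, which makes the next division by
  \<gamma> possible.\<close>

lemma smooth1_g: "smooth1 {-1..1} g"
proof -
  have "\<exists>q. \<forall>n. (even_ends (q n) \<and> (n = 0 \<longrightarrow> q n = d\<gamma>)) \<and>
      (\<forall>t\<in>{0..l}. (q n has_real_derivative \<gamma> t * q (Suc n) t) (at t within {0..l}))"
  proof (rule dependent_nat_choice)
    show "\<exists>f. even_ends f \<and> ((0::nat) = 0 \<longrightarrow> f = d\<gamma>)" using even_ends_d\<gamma> by blast
    fix f n assume "even_ends f \<and> ((n::nat) = 0 \<longrightarrow> f = d\<gamma>)"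
    then show "\<exists>q. (even_ends q \<and> (Suc n = 0 \<longrightarrow> q = d\<gamma>)) \<and>
        (\<forall>t\<in>{0..l}. (f has_real_derivative \<gamma> t * q t) (at t within {0..l}))"
      using even_ends_step[of f] by blast
  qed
  then obtain q where q: "\<And>n. even_ends (q n)" "q 0 = d\<gamma>"
    "\<And>n t. t \<in> {0..l} \<Longrightarrow> (q n has_real_derivative \<gamma> t * q (Suc n) t) (at t within {0..l})"
    by blast
  have "deriv_tower {-1..1} (\<lambda>n z. q n (\<tau> z))"
    unfolding deriv_tower_def
  proof (intro allI ballI)
    fix n and z :: real assume z: "z \<in> {-1..1}"
    show "((\<lambda>z. q n (\<tau> z)) has_real_derivative q (Suc n) (\<tau> z)) (at z within {-1..1})"
    proof (rule height_deriv[OF _ _ _ z])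
      show "(q n has_real_derivative \<gamma> t * q (Suc n) t) (at t)" if "t \<in> {0<..<l}" for t
        using q(3)[of t n] at_within_Icc_at[of 0 t l] that by simp
    qed (intro smooth1_continuous even_ends_smooth1 q(1))+
  qed
  then show ?thesis
    unfolding smooth1_def using q(2) by (intro exI[of _ "\<lambda>n z. q n (\<tau> z)"]) (auto simp: g_def fun_eq_iff)
qed

lemma smooth1_G: "smooth1 {-1..1} G"
proof -
  have "smooth1 {-1..1} (\<lambda>z. 2 * g z)" by (intro smooth1_mult smooth1_const smooth1_g)
  then obtain F where F: "F 0 = (\<lambda>z. 2 * g z)" "deriv_tower {-1..1} F" by (rule smooth1E)
  have "deriv_tower {-1..1} (case_nat G F)"
    unfolding deriv_tower_def
  proof (intro allI ballI)
    fix n and z :: real assume z: "z \<in> {-1..1}"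
    show "(case_nat G F n has_real_derivative case_nat G F (Suc n) z) (at z within {-1..1})"
      by (cases n) (use F(1) G_deriv[OF z] deriv_towerD[OF F(2) z] in auto)
  qed
  then show ?thesis unfolding smooth1_def by (intro exI[of _ "case_nat G F"]) simp
qed

lemma G_ends: "G (-1) = 0" "G 1 = 0" and g_ends: "g (-1) = 1" "g 1 = -1"
  by (simp_all add: G_def g_def \<tau>_ends \<gamma>_ends d\<gamma>_ends)

lemma G_pos: "z \<in> {-1<..<1} \<Longrightarrow> 0 < G z"
  unfolding G_def by (rule zero_less_power[OF \<gamma>_pos[OF \<tau>_mem_open]])

lemma g_deriv_open:
  assumes z: "z \<in> {-1<..<1}"
  shows "(g has_real_derivative profile_deriv l \<gamma> 2 (\<tau> z) / \<gamma> (\<tau> z)) (at z)"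
  using DERIV_chain2[OF d\<gamma>_deriv_at[OF \<tau>_mem_open[OF z]] \<tau>_deriv[OF z]]
  unfolding g_def by (simp add: divide_inverse)

text \<open>At the pole p both 1 + p g and G vanish, and the zero of G is simple since G' = 2 g is
  nonzero there; the quotient is therefore smooth. The opposite pole is left out, because there G
  vanishes while 1 + p g equals 2. This quotient is what makes the section \<open>sec\<close> smooth
  over a pole.\<close>

lemma ex_cap:
  assumes "p \<in> {-1, 1}"
  shows "\<exists>\<kappa>. smooth1 ({-1..1} - {- p}) \<kappa> \<and> (\<forall>z\<in>{-1..1} - {- p}. 1 + p * g z = \<kappa> z * G z)"
proof -
  have p: "p = 1 \<or> p = -1" using assms by blast
  have pm: "p \<in> {-1..1}" using p by auto
  have s: "smooth1 {-1..1} (\<lambda>z. 1 + p * g z)"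
    by (intro smooth1_add smooth1_mult smooth1_const smooth1_g)
  obtain A where A: "smooth1 {-1..1} A" "\<And>z. z \<in> {-1..1} \<Longrightarrow> 1 + p * g z = (z - p) * A z"
    by (rule smooth1_factor[OF s pm]) (use p g_ends in auto)
  obtain B where B: "smooth1 {-1..1} B" "\<And>z. z \<in> {-1..1} \<Longrightarrow> G z = (z - p) * B z"
    by (rule smooth1_factor[OF smooth1_G pm]) (use p G_ends in auto)
  obtain B' where B': "\<And>z. z \<in> {-1..1} \<Longrightarrow> (B has_real_derivative B' z) (at z within {-1..1})"
    by (rule smooth1_deriv[OF B(1)]) blast
  have "((\<lambda>z. (z - p) * B z) has_real_derivative B p) (at p within {-1..1})"
    by (auto intro!: derivative_eq_intros B' pm)
  then have "(G has_real_derivative B p) (at p within {-1..1})"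
    by (rule has_real_derivative_transform_on[OF pm, rotated]) (rule B(2))
  then have "B p = 2 * g p"
    using G_deriv[OF pm] by (rule has_real_derivative_unique_Icc) (use pm in auto)
  then have Bp: "B p \<noteq> 0" using p g_ends by auto
  have nz: "B z \<noteq> 0" if z: "z \<in> {-1..1} - {- p}" for z
  proof (cases "z = p")
    case False
    then have "z \<in> {-1<..<1}" using z p by force
    then show ?thesis using G_pos[of z] B(2)[of z] by auto
  qed (use Bp in simp)
  have "1 + p * g z = A z / B z * G z" if z: "z \<in> {-1..1} - {- p}" for z
    using A(2)[of z] B(2)[of z] nz[OF z] z by simp
  moreover have "smooth1 ({-1..1} - {- p}) (\<lambda>z. A z / B z)"
    by (intro smooth1_divide smooth1_subset[OF A(1)] smooth1_subset[OF B(1)] nz) auto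
  ultimately show ?thesis by blast
qed

end

section \<open>The vector fields on the unit tangent bundle and on the quotient\<close>

lemma quot_proj_eq: "quot_proj q = (Complex (snd (snd q)) (Im (cnj (fst (fst q)) * fst (snd q))), snd (fst q))"
  by (simp add: quot_proj_def split_beta)

lemma quot_proj_has_derivative:
  "(quot_proj has_derivative (\<lambda>v. (Complex (snd (snd v))
      (Im (cnj (fst (fst v)) * fst (snd q) + cnj (fst (fst q)) * fst (snd v))), snd (fst v)))) (at q within S)"
proof -
  have eq: "quot_proj = (\<lambda>q. (of_real (snd (snd q)) + \<i> * of_real (Im (cnj (fst (fst q)) * fst (snd q))), snd (fst q)))"
    by (auto simp: quot_proj_eq Complex_eq)
  have "((\<lambda>q. (of_real (snd (snd q)) + \<i> * of_real (Im (cnj (fst (fst q)) * fst (snd q))), snd (fst q)))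
      has_derivative (\<lambda>v. (of_real (snd (snd v)) +
        \<i> * of_real (Im (cnj (fst (fst v)) * fst (snd q) + cnj (fst (fst q)) * fst (snd v))), snd (fst v)))) (at q within S)"
    by (rule has_derivative_eq_rhs, (rule derivative_intros)+) (simp add: fun_eq_iff algebra_simps)
  then show ?thesis by (simp add: eq Complex_eq)
qed

lemma continuous_on_quot_proj: "continuous_on S quot_proj"
  by (rule has_derivative_continuous_on[OF quot_proj_has_derivative])

section \<open>Explicit formulas for bundle points, frames and fields, including the poles\<close>

context profile
begin

text \<open>Unlike \<open>bundle_pt\<close> this formula contains no division by \<gamma>, so it
  also makes sense at the ends of the interval and is used to approach the poles.\<close>

definition bpt :: "real \<Rightarrow> real \<Rightarrow> real \<Rightarrow> space3 \<times> space3" where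
  "bpt t \<phi> \<theta> = ((\<gamma> t * cis \<theta>, Gam \<gamma> t), (Complex (cos \<phi> * d\<gamma> t) (sin \<phi>) * cis \<theta>, cos \<phi> * \<gamma> t))"

lemma bundle_pt_bpt: "t \<in> {0<..<l} \<Longrightarrow> bundle_pt l \<gamma> t \<phi> \<theta> = bpt t \<phi> \<theta>"
  unfolding bpt_def d\<gamma>_def by (rule bundle_pt_eq[OF np])

lemma unit_bundle_cases:
  assumes "q \<in> unit_bundle l \<gamma>"
  obtains (reg) t \<phi> \<theta> where "t \<in> {0<..<l}" "q = bpt t \<phi> \<theta>" "q = bundle_pt l \<gamma> t \<phi> \<theta>" "q \<in> regular_bundle l \<gamma>"
  | (pole) t \<theta> where "t \<in> {0, l}" "q = ((0, Gam \<gamma> t), (d\<gamma> t * cis \<theta>, 0))" "q \<notin> regular_bundle l \<gamma>"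
proof -
  consider (1) t \<phi> \<theta> where "t \<in> {0<..<l}" "q = bundle_pt l \<gamma> t \<phi> \<theta>"
    | (2) t \<theta> where "t \<in> {0, l}" "q = (surf_pt \<gamma> t \<theta>, d_t l \<gamma> t \<theta>)"
    using assms unfolding unit_bundle_def regular_bundle_def by blast
  then show thesis
  proof cases
    case 1
    then show ?thesis using reg bundle_pt_bpt[OF 1(1)] unfolding regular_bundle_def by blast
  next
    case 2
    have eq: "q = ((0, Gam \<gamma> t), (d\<gamma> t * cis \<theta>, 0))"
      unfolding 2(2) d\<gamma>_def by (rule pole_bundle_pt_eq[OF np 2(1)])
    have "q \<notin> regular_bundle l \<gamma>"
    proof
      assume "q \<in> regular_bundle l \<gamma>"
      then obtain s \<phi> \<theta>' where s: "s \<in> {0<..<l}" "q = bundle_pt l \<gamma> s \<phi> \<theta>'"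
        unfolding regular_bundle_def by blast
      then have "Gam \<gamma> s = Gam \<gamma> t" using eq by (simp add: bundle_pt_bpt bpt_def)
      then have "s = t" using Gam_eq_iff[OF np, of s t] s(1) 2(1) l_pos by auto
      then show False using s(1) 2(1) by auto
    qed
    then show ?thesis using pole[OF 2(1) eq] by blast
  qed
qed

lemma bpt_mem: "t \<in> {0<..<l} \<Longrightarrow> bpt t \<phi> \<theta> \<in> regular_bundle l \<gamma>"
  unfolding regular_bundle_def using bundle_pt_bpt[of t \<phi> \<theta>, symmetric] by blast

lemma regular_bundleE:
  assumes "q \<in> regular_bundle l \<gamma>"
  obtains t \<phi> \<theta> where "t \<in> {0<..<l}" "q = bpt t \<phi> \<theta>"
proof -
  from assms obtain t \<phi> \<theta> where "t \<in> {0<..<l}" "q = bundle_pt l \<gamma> t \<phi> \<theta>"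
    unfolding regular_bundle_def by blast
  with that show thesis using bundle_pt_bpt by simp
qed

lemma regular_subset: "regular_bundle l \<gamma> \<subseteq> unit_bundle l \<gamma>"
  unfolding unit_bundle_def by blast

lemma pole_mem: "t \<in> {0, l} \<Longrightarrow> ((0, Gam \<gamma> t), (d\<gamma> t * cis \<theta>, 0)) \<in> unit_bundle l \<gamma>"
  unfolding unit_bundle_def d\<gamma>_def using pole_bundle_pt_eq[OF np, of t \<theta>, symmetric] by blast

lemma bpt_eqD:
  assumes "t \<in> {0<..<l}" "t' \<in> {0<..<l}" "bpt t \<phi> \<theta> = bpt t' \<phi>' \<theta>'"
  shows "t' = t" "cis \<theta>' = cis \<theta>" "cis \<phi>' = cis \<phi>"
proof -
  have "Gam \<gamma> t = Gam \<gamma> t'" using assms(3) by (simp add: bpt_def)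
  then show t: "t' = t" using Gam_eq_iff[OF np, of t t'] assms(1,2) by simp
  have nz: "\<gamma> t \<noteq> 0" using \<gamma>_pos[OF assms(1)] by simp
  show \<theta>: "cis \<theta>' = cis \<theta>" using assms(3) nz unfolding t bpt_def by simp
  have "Complex (cos \<phi> * d\<gamma> t) (sin \<phi>) = Complex (cos \<phi>' * d\<gamma> t) (sin \<phi>')" "cos \<phi> = cos \<phi>'"
    using assms(3) nz unfolding t bpt_def \<theta> by simp_all
  then show "cis \<phi>' = cis \<phi>" by (simp add: complex_eq_iff)
qed

lemma frame_t_eq:
  assumes t: "t \<in> {0<..<l}"
  shows "frame_t l \<gamma> t \<phi> \<theta> =
    ((d\<gamma> t * cis \<theta>, \<gamma> t), (Complex (cos \<phi> * profile_deriv l \<gamma> 2 t) 0 * cis \<theta>, cos \<phi> * d\<gamma> t))"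
  unfolding frame_t_def
proof (rule vector_derivative_at)
  have d: "(\<gamma> has_vector_derivative d\<gamma> t) (at t)" "(Gam \<gamma> has_vector_derivative \<gamma> t) (at t)"
    "(d\<gamma> has_vector_derivative profile_deriv l \<gamma> 2 t) (at t)"
    using \<gamma>_deriv_at[OF t] Gam_deriv_at[OF t] d\<gamma>_deriv_at[OF t]
    by (simp_all add: has_real_derivative_iff_has_vector_derivative)
  have c: "((\<lambda>s. Complex (cos \<phi> * d\<gamma> s) (sin \<phi>)) has_vector_derivative
      Complex (cos \<phi> * profile_deriv l \<gamma> 2 t) 0) (at t)"
    unfolding has_vector_derivative_complex_iff using d\<gamma>_deriv_at[OF t]
    by (auto intro!: derivative_eq_intros simp del: profile_deriv.simps)
  have "((\<lambda>s. bpt s \<phi> \<theta>) has_vector_derivative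
      ((d\<gamma> t * cis \<theta>, \<gamma> t), (Complex (cos \<phi> * profile_deriv l \<gamma> 2 t) 0 * cis \<theta>, cos \<phi> * d\<gamma> t))) (at t)"
    unfolding bpt_def
    by (intro has_vector_derivative_Pair has_vector_derivative_mult_left has_vector_derivative_of_real
        has_vector_derivative_mult_right d c)
      (use \<gamma>_deriv_at[OF t] d\<gamma>_deriv_at[OF t] in simp_all)
  then show "((\<lambda>s. bundle_pt l \<gamma> s \<phi> \<theta>) has_vector_derivative
      ((d\<gamma> t * cis \<theta>, \<gamma> t), (Complex (cos \<phi> * profile_deriv l \<gamma> 2 t) 0 * cis \<theta>, cos \<phi> * d\<gamma> t))) (at t)"
    by (rule has_vector_derivative_transform_within_open[where S = "{0<..<l}"])
      (use t bundle_pt_bpt in auto)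
qed

lemma bpt_deriv_phi:
  "((\<lambda>s. bpt t s \<theta>) has_vector_derivative
     ((0, 0), (Complex (- sin \<phi> * d\<gamma> t) (cos \<phi>) * cis \<theta>, - sin \<phi> * \<gamma> t))) (at \<phi> within S)"
proof -
  have c: "((\<lambda>s. Complex (cos s * d\<gamma> t) (sin s)) has_vector_derivative
      Complex (- sin \<phi> * d\<gamma> t) (cos \<phi>)) (at \<phi> within S)"
    unfolding has_vector_derivative_complex_iff by (auto intro!: derivative_eq_intros)
  have d: "((\<lambda>s. cos s * \<gamma> t) has_vector_derivative - sin \<phi> * \<gamma> t) (at \<phi> within S)"
    unfolding has_real_derivative_iff_has_vector_derivative[symmetric] by (auto intro!: derivative_eq_intros)
  show ?thesis
    unfolding bpt_def
    by (intro has_vector_derivative_Pair has_vector_derivative_mult_left has_vector_derivative_const c d)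
qed

lemma frame_phi_eq:
  assumes t: "t \<in> {0<..<l}"
  shows "frame_phi l \<gamma> t \<phi> \<theta> = ((0, 0), (Complex (- sin \<phi> * d\<gamma> t) (cos \<phi>) * cis \<theta>, - sin \<phi> * \<gamma> t))"
  unfolding frame_phi_def bundle_pt_bpt[OF t] by (rule vector_derivative_at[OF bpt_deriv_phi])

lemma bpt_deriv_theta:
  "((\<lambda>s. bpt t \<phi> s) has_vector_derivative
     ((\<gamma> t * (\<i> * cis \<theta>), 0), (Complex (cos \<phi> * d\<gamma> t) (sin \<phi>) * (\<i> * cis \<theta>), 0))) (at \<theta> within S)"
  unfolding bpt_def
  by (intro has_vector_derivative_Pair has_vector_derivative_mult_right has_vector_derivative_const
      cis_has_vector_derivative)

lemma frame_theta_eq: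
  assumes t: "t \<in> {0<..<l}"
  shows "frame_theta l \<gamma> t \<phi> \<theta> =
    ((\<gamma> t * (\<i> * cis \<theta>), 0), (Complex (cos \<phi> * d\<gamma> t) (sin \<phi>) * (\<i> * cis \<theta>), 0))"
  unfolding frame_theta_def bundle_pt_bpt[OF t] by (rule vector_derivative_at[OF bpt_deriv_theta])

text \<open>The first pair is the tangent vector itself, as befits a geodesic field. In the second
  the three frame vectors are combined so that the reciprocal of \<gamma> occurs only in
  \<open>(1 - (d\<gamma> t)\<^sup>2) / \<gamma> t\<close>, a quantity with limit zero at the
  poles.\<close>

lemma geodesic_coord_eq:
  assumes t: "t \<in> {0<..<l}"
  shows "geodesic_coord l \<gamma> t \<phi> \<theta> =
    ((Complex (cos \<phi> * d\<gamma> t) (sin \<phi>) * cis \<theta>, cos \<phi> * \<gamma> t),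
     (of_real (profile_deriv l \<gamma> 2 t * (cos \<phi>)\<^sup>2 - (1 - (d\<gamma> t)\<^sup>2) / \<gamma> t * (sin \<phi>)\<^sup>2) * cis \<theta>, d\<gamma> t))"
proof -
  define c s k d D where "c = cos \<phi>" "s = sin \<phi>" "k = inverse (\<gamma> t)" "d = d\<gamma> t"
    "D = profile_deriv l \<gamma> 2 t"
  note defs = this
  have k: "\<gamma> t * k = 1" using \<gamma>_pos[OF t] by (simp add: defs)
  have sc: "c * c + s * s = 1" unfolding defs by (rule sin_cos_squared_add3)
  have 1: "complex_of_real c * (d * cis \<theta>) + of_real (s * k) * (\<gamma> t * (\<i> * cis \<theta>)) = Complex (c * d) s * cis \<theta>"
  proof -
    have "complex_of_real c * (d * cis \<theta>) + of_real (s * k) * (\<gamma> t * (\<i> * cis \<theta>)) =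
        (of_real (c * d) + of_real (s * (\<gamma> t * k)) * \<i>) * cis \<theta>"
      by (simp add: algebra_simps)
    then show ?thesis unfolding k by (simp add: Complex_eq mult.commute)
  qed
  have "complex_of_real c * Complex (c * D) 0 - of_real (d * s * k) * Complex (- s * d) c +
      of_real (s * k) * (\<i> * Complex (c * d) s) = of_real (D * c\<^sup>2 - (1 - d\<^sup>2) * k * s\<^sup>2)"
    by (simp add: complex_eq_iff power2_eq_square algebra_simps)
  then have "(complex_of_real c * Complex (c * D) 0 - of_real (d * s * k) * Complex (- s * d) c +
      of_real (s * k) * (\<i> * Complex (c * d) s)) * cis \<theta> = of_real (D * c\<^sup>2 - (1 - d\<^sup>2) * k * s\<^sup>2) * cis \<theta>"
    by (rule arg_cong)
  then have 2: "complex_of_real c * (Complex (c * D) 0 * cis \<theta>) - of_real (d * s * k) * (Complex (- s * d) c * cis \<theta>) +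
      of_real (s * k) * (Complex (c * d) s * (\<i> * cis \<theta>)) = of_real (D * c\<^sup>2 - (1 - d\<^sup>2) * k * s\<^sup>2) * cis \<theta>"
    by (simp only: ring_distribs mult_ac)
  have "c * (c * d) - d * s * k * (- s * \<gamma> t) = (c * c + s * s * (\<gamma> t * k)) * d"
    by (simp add: algebra_simps)
  then have 3: "c * (c * d) - d * s * k * (- s * \<gamma> t) = d" unfolding k using sc by simp
  show ?thesis
    unfolding geodesic_coord_def frame_t_eq[OF t] frame_phi_eq[OF t] frame_theta_eq[OF t] d\<gamma>_def[symmetric]
      divide_inverse defs[symmetric]
    using 1 2 3 by (simp add: scaleR_conv_of_real del: of_real_mult of_real_diff)
qed

text \<open>The coordinates \<open>(\<phi>, \<theta>)\<close> are determined up to \<open>2\<pi>\<close> by a regular point, so that the definite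
  description in \<^const>\<open>bundle_field\<close> has a unique solution for \<open>2\<pi>\<close>-periodic fields.\<close>

lemma bundle_field_regular:
  assumes t: "t \<in> {0<..<l}"
    and per: "\<And>\<phi>' \<theta>'. cis \<phi>' = cis \<phi> \<Longrightarrow> cis \<theta>' = cis \<theta> \<Longrightarrow> Y t \<phi>' \<theta>' = Y t \<phi> \<theta>"
  shows "(THE w. \<exists>t' \<phi>' \<theta>'. t' \<in> {0<..<l} \<and> bpt t \<phi> \<theta> = bundle_pt l \<gamma> t' \<phi>' \<theta>' \<and> w = Y t' \<phi>' \<theta>') = Y t \<phi> \<theta>"
    and "bundle_field l \<gamma> Y (bpt t \<phi> \<theta>) = Y t \<phi> \<theta>"
proof -
  show 1: "(THE w. \<exists>t' \<phi>' \<theta>'. t' \<in> {0<..<l} \<and> bpt t \<phi> \<theta> = bundle_pt l \<gamma> t' \<phi>' \<theta>' \<and> w = Y t' \<phi>' \<theta>') = Y t \<phi> \<theta>"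
  proof (rule the_equality)
    show "\<exists>t' \<phi>' \<theta>'. t' \<in> {0<..<l} \<and> bpt t \<phi> \<theta> = bundle_pt l \<gamma> t' \<phi>' \<theta>' \<and> Y t \<phi> \<theta> = Y t' \<phi>' \<theta>'"
      using t by (intro exI[of _ t] exI[of _ \<phi>] exI[of _ \<theta>]) (simp add: bundle_pt_bpt)
  next
    fix w assume "\<exists>t' \<phi>' \<theta>'. t' \<in> {0<..<l} \<and> bpt t \<phi> \<theta> = bundle_pt l \<gamma> t' \<phi>' \<theta>' \<and> w = Y t' \<phi>' \<theta>'"
    then obtain t' \<phi>' \<theta>' where *: "t' \<in> {0<..<l}" "bpt t \<phi> \<theta> = bundle_pt l \<gamma> t' \<phi>' \<theta>'" "w = Y t' \<phi>' \<theta>'"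
      by blast
    note eq = bpt_eqD[OF t *(1) *(2)[unfolded bundle_pt_bpt[OF *(1)]]]
    show "w = Y t \<phi> \<theta>" unfolding *(3) eq(1) by (rule per[OF eq(3,2)])
  qed
  show "bundle_field l \<gamma> Y (bpt t \<phi> \<theta>) = Y t \<phi> \<theta>"
    unfolding bundle_field_def Let_def if_P[OF bpt_mem[OF t]] by (rule 1)
qed

text \<open>The coordinate field is replaced by an expression \<open>W\<close> in the ambient
  coordinates, whose limit can be computed. Since \<open>W\<close> is a function of the point, the
  periodicity in \<phi> and \<theta> demanded by \<open>bundle_field_regular\<close> is
  automatic.\<close>

lemma bundle_field_pole:
  assumes q: "q \<notin> regular_bundle l \<gamma>" "at q within regular_bundle l \<gamma> \<noteq> bot"
    and lim: "(W \<longlongrightarrow> w) (at q within regular_bundle l \<gamma>)"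
    and W: "\<And>t \<phi> \<theta>. t \<in> {0<..<l} \<Longrightarrow> W (bpt t \<phi> \<theta>) = Y t \<phi> \<theta>"
  shows "bundle_field l \<gamma> Y q = w"
proof -
  define Z where "Z = (\<lambda>q. THE w. \<exists>t \<phi> \<theta>. t \<in> {0<..<l} \<and> q = bundle_pt l \<gamma> t \<phi> \<theta> \<and> w = Y t \<phi> \<theta>)"
  have "Z q' = W q'" if q': "q' \<in> regular_bundle l \<gamma>" for q'
  proof -
    obtain t \<phi> \<theta> where t: "t \<in> {0<..<l}" "q' = bpt t \<phi> \<theta>"
      by (rule regular_bundleE[OF q'])
    have "Y t \<phi>' \<theta>' = Y t \<phi> \<theta>" if "cis \<phi>' = cis \<phi>" "cis \<theta>' = cis \<theta>" for \<phi>' \<theta>'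
    proof -
      have "cos \<phi>' = cos \<phi>" "sin \<phi>' = sin \<phi>" using that(1) by (simp_all add: complex_eq_iff)
      then have "bpt t \<phi>' \<theta>' = bpt t \<phi> \<theta>" using that(2) by (simp add: bpt_def)
      then show ?thesis unfolding W[OF t(1), symmetric] by (rule arg_cong)
    qed
    from bundle_field_regular(1)[of t \<phi> \<theta> Y, OF t(1) this] show ?thesis
      unfolding Z_def t(2) W[OF t(1)] .
  qed
  then have "(Z \<longlongrightarrow> w) (at q within regular_bundle l \<gamma>)"
    using Lim_transform_eventually[OF lim] by (auto simp: eventually_at_filter)
  from tendsto_Lim[OF q(2) this] show ?thesis
    unfolding bundle_field_def Let_def if_not_P[OF q(1)] Z_def .
qed

text \<open>\<open>Lim\<close> is unspecified along a trivial filter, so regular points must be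
  shown to accumulate at a pole vector: those on a meridian with \<phi> = 0 do.\<close>

lemma pole_limit_point:
  assumes t0: "t0 \<in> {0, l}"
  shows "at ((0, Gam \<gamma> t0), (d\<gamma> t0 * cis \<theta>, 0)) within regular_bundle l \<gamma> \<noteq> bot"
proof
  let ?q = "((0, Gam \<gamma> t0), (d\<gamma> t0 * cis \<theta>, 0)) :: space3 \<times> space3"
  assume bot: "at ?q within regular_bundle l \<gamma> = bot"
  have t0m: "t0 \<in> {0..l}" and \<gamma>0: "\<gamma> t0 = 0" using t0 l_pos \<gamma>_ends by auto
  let ?F = "at t0 within {0<..<l}"
  have lim: "(f \<longlongrightarrow> f t0) ?F" if "continuous_on {0..l} f" for f :: "real \<Rightarrow> real"
    using that t0m unfolding continuous_on_def by (meson greaterThanLessThan_subseteq_atLeastAtMost_iff order_refl tendsto_within_subset)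
  have "((\<lambda>t. bpt t 0 \<theta>) \<longlongrightarrow> bpt t0 0 \<theta>) ?F"
    unfolding bpt_def by (intro tendsto_intros lim cont_\<gamma> cont_Gam) (simp add: Complex_eq, intro tendsto_intros lim cont_d\<gamma>)
  moreover have "bpt t0 0 \<theta> = ?q" by (simp add: bpt_def \<gamma>0 complex_eq_iff)
  ultimately have "((\<lambda>t. bpt t 0 \<theta>) \<longlongrightarrow> ?q) ?F" by simp
  moreover have "\<forall>\<^sub>F t in ?F. bpt t 0 \<theta> \<in> regular_bundle l \<gamma> \<and> bpt t 0 \<theta> \<noteq> ?q"
  proof -
    have "bpt t 0 \<theta> \<in> regular_bundle l \<gamma> \<and> bpt t 0 \<theta> \<noteq> ?q" if "t \<in> {0<..<l}" for t
    proof
      show "bpt t 0 \<theta> \<in> regular_bundle l \<gamma>" by (rule bpt_mem[OF that])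
      show "bpt t 0 \<theta> \<noteq> ?q" using \<gamma>_pos[OF that] by (simp add: bpt_def)
    qed
    then show ?thesis by (auto simp: eventually_at_filter)
  qed
  ultimately have "filterlim (\<lambda>t. bpt t 0 \<theta>) (at ?q within regular_bundle l \<gamma>) ?F"
    by (simp add: filterlim_at)
  then have "?F = bot" unfolding bot filterlim_def by (simp add: bot_unique filtermap_bot_iff)
  moreover have "?F \<noteq> bot"
    using t0 l_pos by (auto simp: trivial_limit_within islimpt_greaterThanLessThan1 islimpt_greaterThanLessThan2)
  ultimately show False by blast
qed

text \<open>Differentiating 1 - (\<gamma>')^2 = \<gamma> b at a pole gives -2 \<gamma>' \<gamma>'' =
  \<gamma>' b, and \<gamma>'' vanishes there as an even derivative; hence b vanishes too.\<close>

lemma curvature_defect: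
  obtains b where "continuous_on {0..l} b" "\<And>t. t \<in> {0..l} \<Longrightarrow> 1 - (d\<gamma> t)\<^sup>2 = \<gamma> t * b t" "b 0 = 0" "b l = 0"
proof -
  have sd: "smooth1 {0..l} d\<gamma>" by (rule even_ends_smooth1[OF even_ends_d\<gamma>])
  have "smooth1 {0..l} (\<lambda>t. 1 - d\<gamma> t * d\<gamma> t)"
    by (rule smooth1_diff[OF smooth1_const smooth1_mult[OF sd sd]])
  then obtain b where b: "smooth1 {0..l} b" "\<And>t. t \<in> {0..l} \<Longrightarrow> 1 - d\<gamma> t * d\<gamma> t = \<gamma> t * b t"
    by (rule divide_by_\<gamma>) (use d\<gamma>_ends in auto)
  obtain b' where b': "\<And>t. t \<in> {0..l} \<Longrightarrow> (b has_real_derivative b' t) (at t within {0..l})"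
    by (rule smooth1_deriv[OF b(1)]) blast
  have "b t = 0" if t: "t \<in> {0, l}" for t
  proof -
    have tm: "t \<in> {0..l}" using t l_pos by auto
    have "((\<lambda>t. \<gamma> t * b t) has_real_derivative d\<gamma> t * b t + b' t * \<gamma> t) (at t within {0..l})"
      by (rule DERIV_mult[OF \<gamma>_deriv[OF tm] b'[OF tm]])
    then have 1: "((\<lambda>t. 1 - d\<gamma> t * d\<gamma> t) has_real_derivative d\<gamma> t * b t + b' t * \<gamma> t) (at t within {0..l})"
      by (rule has_real_derivative_transform_on[OF tm, rotated]) (rule b(2))
    have 2: "((\<lambda>t. 1 - d\<gamma> t * d\<gamma> t) has_real_derivative
        0 - (profile_deriv l \<gamma> 2 t * d\<gamma> t + profile_deriv l \<gamma> 2 t * d\<gamma> t)) (at t within {0..l})"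
      by (intro DERIV_diff DERIV_mult DERIV_const d\<gamma>_deriv[OF tm])
    have "profile_deriv l \<gamma> 2 t = 0" using even_derivs[of 1] t by (auto simp del: profile_deriv.simps)
    with has_real_derivative_unique_Icc[OF 1 2 l_pos tm] t \<gamma>_ends d\<gamma>_ends
    show "b t = 0" by auto
  qed
  with that[of b] b smooth1_continuous[OF b(1)] show thesis by (auto simp: power2_eq_square)
qed

lemma bpt_height: "snd (fst (bpt t \<phi> \<theta>)) = Gam \<gamma> t"
  by (simp add: bpt_def)

lemma bpt_Im: "Im (cnj (\<gamma> t * cis \<theta>) * (Complex a b * cis \<theta>)) = \<gamma> t * b"
proof -
  have "cnj (\<gamma> t * cis \<theta>) * (Complex a b * cis \<theta>) = \<gamma> t * Complex a b * (cis (-\<theta>) * cis \<theta>)"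
    by (simp add: cis_cnj algebra_simps)
  then have "cnj (\<gamma> t * cis \<theta>) * (Complex a b * cis \<theta>) = \<gamma> t * Complex a b"
    unfolding cis_mult by simp
  then have "Im (cnj (\<gamma> t * cis \<theta>) * (Complex a b * cis \<theta>)) = Im (\<gamma> t * Complex a b)"
    by (rule arg_cong)
  then show ?thesis by simp
qed

text \<open>The height is a coordinate of the ambient space, so continuous functions of it have
  limits at the poles although (t, \<phi>, \<theta>) break down; limits of the fields are expressed
  through such functions.\<close>

lemma tendsto_height:
  assumes f: "continuous_on {-1..1} f" and q: "q \<in> unit_bundle l \<gamma>"
  shows "((\<lambda>q'. f (snd (fst q'))) \<longlongrightarrow> f (snd (fst q))) (at q within regular_bundle l \<gamma>)"
proof -
  have h: "snd (fst q') \<in> {-1..1}" if "q' \<in> unit_bundle l \<gamma>" for q'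
    using that Gam_mem l_pos by (cases rule: unit_bundle_cases) (auto simp: bpt_def)
  have "continuous_on (unit_bundle l \<gamma>) (\<lambda>q'. f (snd (fst q')))"
    by (rule continuous_on_compose2[OF f]) (use h in \<open>auto intro!: continuous_intros\<close>)
  then show ?thesis
    using q regular_subset unfolding continuous_on_def by (meson tendsto_within_subset)
qed

lemma geodesic_field_bpt:
  "t \<in> {0<..<l} \<Longrightarrow> geodesic_field l \<gamma> (bpt t \<phi> \<theta>) = geodesic_coord l \<gamma> t \<phi> \<theta>"
  unfolding geodesic_field_def
  by (rule bundle_field_regular(2)) (auto simp: geodesic_coord_eq complex_eq_iff simp del: profile_deriv.simps)

lemma vertical_field_bpt:
  "t \<in> {0<..<l} \<Longrightarrow> vertical_field l \<gamma> (bpt t \<phi> \<theta>) = frame_phi l \<gamma> t \<phi> \<theta>"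
  unfolding vertical_field_def
  by (rule bundle_field_regular(2)) (auto simp: frame_phi_eq complex_eq_iff)

text \<open>The acceleration depends on \<phi>, which need not converge at the pole. It is squeezed
  by |\<gamma>''| + |b|, a function of the height alone that vanishes at both poles.\<close>

lemma geodesic_field_pole:
  assumes t0: "t0 \<in> {0, l}" and q: "q = ((0, Gam \<gamma> t0), (d\<gamma> t0 * cis \<theta>, 0))" "q \<notin> regular_bundle l \<gamma>"
  shows "geodesic_field l \<gamma> q = ((d\<gamma> t0 * cis \<theta>, 0), (0, d\<gamma> t0))"
proof -
  let ?F = "at q within regular_bundle l \<gamma>"
  have t0m: "t0 \<in> {0..l}" using t0 l_pos by auto
  have qM: "q \<in> unit_bundle l \<gamma>" unfolding q(1) by (rule pole_mem[OF t0])
  have h0: "snd (fst q) = Gam \<gamma> t0" by (simp add: q)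
  obtain b where b: "continuous_on {0..l} b" "\<And>t. t \<in> {0..l} \<Longrightarrow> 1 - (d\<gamma> t)\<^sup>2 = \<gamma> t * b t" "b 0 = 0" "b l = 0"
    by (rule curvature_defect) blast
  define a where "a = (\<lambda>z. \<bar>profile_deriv l \<gamma> 2 (\<tau> z)\<bar> + \<bar>b (\<tau> z)\<bar>)"
  have "continuous_on {-1..1} a"
    unfolding a_def using \<tau>_mem
    by (intro continuous_intros continuous_on_compose2[OF b(1) cont_\<tau>]
        continuous_on_compose2[OF deriv_tower_continuous[OF tower_\<gamma>] cont_\<tau>]) auto
  from tendsto_height[OF this qM] have "((\<lambda>q'. a (snd (fst q'))) \<longlongrightarrow> a (Gam \<gamma> t0)) ?F" by (simp add: h0)
  moreover have "a (Gam \<gamma> t0) = 0"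
    using t0 even_derivs[of 1] b(3,4) by (auto simp: a_def \<tau>_Gam[OF t0m] simp del: profile_deriv.simps)
  ultimately have alim: "((\<lambda>q'. a (snd (fst q'))) \<longlongrightarrow> 0) ?F" by simp
  define E where "E = (\<lambda>q'. fst (snd (geodesic_field l \<gamma> q')))"
  have "\<forall>\<^sub>F q' in ?F. norm (E q') \<le> a (snd (fst q'))"
  proof -
    have "norm (E q') \<le> a (snd (fst q'))" if q': "q' \<in> regular_bundle l \<gamma>" for q'
    proof -
      obtain t \<phi> \<theta> where t: "t \<in> {0<..<l}" "q' = bpt t \<phi> \<theta>"
        by (rule regular_bundleE[OF q'])
      have tm: "t \<in> {0..l}" and nz: "\<gamma> t \<noteq> 0" using t(1) \<gamma>_pos[OF t(1)] by auto
      have k: "(1 - (d\<gamma> t)\<^sup>2) / \<gamma> t = b t" using b(2)[OF tm] nz by simp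
      let ?x = "profile_deriv l \<gamma> 2 t"
      have "norm (E q') = \<bar>?x * (cos \<phi>)\<^sup>2 - b t * (sin \<phi>)\<^sup>2\<bar>"
        unfolding E_def t(2) geodesic_field_bpt[OF t(1)] geodesic_coord_eq[OF t(1)] k
        by (simp add: norm_mult del: profile_deriv.simps of_real_diff of_real_mult)
      also have "\<dots> \<le> \<bar>?x * (cos \<phi>)\<^sup>2\<bar> + \<bar>b t * (sin \<phi>)\<^sup>2\<bar>" by (rule abs_triangle_ineq4)
      also have "\<dots> \<le> \<bar>?x\<bar> + \<bar>b t\<bar>"
        unfolding abs_mult by (intro add_mono mult_right_le_one_le) (auto simp: abs_square_le_1 simp del: profile_deriv.simps)
      finally show ?thesis by (simp add: a_def t(2) bpt_height \<tau>_Gam[OF tm] del: profile_deriv.simps)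
    qed
    then show ?thesis by (auto simp: eventually_at_filter)
  qed
  then have Elim: "(E \<longlongrightarrow> 0) ?F" by (rule Lim_null_comparison[OF _ alim])
  have glim: "((\<lambda>q'. g (snd (fst q'))) \<longlongrightarrow> d\<gamma> t0) ?F"
    using tendsto_height[OF smooth1_continuous[OF smooth1_g] qM] by (simp add: h0 g_Gam[OF t0m])
  have ulim: "((\<lambda>q'. snd q') \<longlongrightarrow> (d\<gamma> t0 * cis \<theta>, 0)) ?F"
    using tendsto_snd[OF tendsto_ident_at, of q "regular_bundle l \<gamma>"] by (simp add: q)
  show ?thesis
    unfolding geodesic_field_def
  proof (rule bundle_field_pole[OF q(2)])
    show "?F \<noteq> bot" unfolding q(1) by (rule pole_limit_point[OF t0])
    show "((\<lambda>q'. (snd q', (E q', g (snd (fst q'))))) \<longlongrightarrow> ((d\<gamma> t0 * cis \<theta>, 0), (0, d\<gamma> t0))) ?F"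
      by (intro tendsto_Pair ulim Elim glim)
    fix t \<phi> \<theta> assume t: "t \<in> {0<..<l}"
    then have "t \<in> {0..l}" by simp
    with geodesic_coord_eq[OF t, of \<phi> \<theta>]
    show "(snd (bpt t \<phi> \<theta>), (E (bpt t \<phi> \<theta>), g (snd (fst (bpt t \<phi> \<theta>))))) = geodesic_coord l \<gamma> t \<phi> \<theta>"
      unfolding E_def geodesic_field_bpt[OF t] bpt_height by (simp add: bpt_def g_Gam del: profile_deriv.simps)
  qed
qed

text \<open>At a pole the infinitesimal fibre rotation is a quarter turn of the complex component of
  the vector, with sense given by g = 1 or g = -1. Nearby the field differs from i g times that
  component by at most 1 - g^2, which tends to zero.\<close>

lemma vertical_field_pole:
  assumes t0: "t0 \<in> {0, l}" and q: "q = ((0, Gam \<gamma> t0), (d\<gamma> t0 * cis \<theta>, 0))" "q \<notin> regular_bundle l \<gamma>"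
  shows "vertical_field l \<gamma> q = ((0, 0), (\<i> * d\<gamma> t0 * (d\<gamma> t0 * cis \<theta>), 0))"
proof -
  let ?F = "at q within regular_bundle l \<gamma>"
  have t0m: "t0 \<in> {0..l}" using t0 l_pos by auto
  have qM: "q \<in> unit_bundle l \<gamma>" unfolding q(1) by (rule pole_mem[OF t0])
  have h0: "snd (fst q) = Gam \<gamma> t0" by (simp add: q)
  have cg: "continuous_on {-1..1} g" by (rule smooth1_continuous[OF smooth1_g])
  have glim: "((\<lambda>q'. g (snd (fst q'))) \<longlongrightarrow> d\<gamma> t0) ?F"
    using tendsto_height[OF cg qM] by (simp add: h0 g_Gam[OF t0m])
  have dd: "d\<gamma> t0 * d\<gamma> t0 = 1" using t0 d\<gamma>_ends by auto
  have plim: "((\<lambda>q'. fst (fst q')) \<longlongrightarrow> 0) ?F"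
    using tendsto_fst[OF tendsto_fst[OF tendsto_ident_at], of q "regular_bundle l \<gamma>"] by (simp add: q)
  have ulim: "((\<lambda>q'. fst (snd q')) \<longlongrightarrow> d\<gamma> t0 * cis \<theta>) ?F"
    using tendsto_fst[OF tendsto_snd[OF tendsto_ident_at], of q "regular_bundle l \<gamma>"] by (simp add: q)
  define E where "E = (\<lambda>q'. fst (snd (vertical_field l \<gamma> q')) - \<i> * of_real (g (snd (fst q'))) * fst (snd q'))"
  have Ebpt: "E (bpt t \<phi> \<theta>) = \<i> * of_real (cos \<phi> * (1 - d\<gamma> t * d\<gamma> t)) * cis \<theta>" if t: "t \<in> {0<..<l}" for t \<phi> \<theta>
  proof -
    have "t \<in> {0..l}" using t by simp
    then show ?thesis
      unfolding E_def vertical_field_bpt[OF t] frame_phi_eq[OF t] bpt_height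
      by (simp add: g_Gam bpt_def complex_eq_iff algebra_simps)
  qed
  have "((\<lambda>q'. 1 - g (snd (fst q')) * g (snd (fst q'))) \<longlongrightarrow> 1 - d\<gamma> t0 * d\<gamma> t0) ?F"
    by (intro tendsto_intros glim)
  then have alim: "((\<lambda>q'. 1 - g (snd (fst q')) * g (snd (fst q'))) \<longlongrightarrow> 0) ?F" by (simp add: dd)
  have "\<forall>\<^sub>F q' in ?F. norm (E q') \<le> 1 - g (snd (fst q')) * g (snd (fst q'))"
  proof -
    have "norm (E q') \<le> 1 - g (snd (fst q')) * g (snd (fst q'))" if q': "q' \<in> regular_bundle l \<gamma>" for q'
    proof -
      obtain t \<phi> \<theta> where t: "t \<in> {0<..<l}" "q' = bpt t \<phi> \<theta>"
        by (rule regular_bundleE[OF q'])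
      have tm: "t \<in> {0..l}" using t(1) by simp
      have "\<bar>d\<gamma> t\<bar> * \<bar>d\<gamma> t\<bar> \<le> 1 * 1" by (rule mult_mono) (use abs_d\<gamma>[OF t(1)] in auto)
      then have nn: "0 \<le> 1 - d\<gamma> t * d\<gamma> t" by (simp flip: abs_mult)
      have "norm (E q') = \<bar>cos \<phi>\<bar> * (1 - d\<gamma> t * d\<gamma> t)"
        unfolding t(2) Ebpt[OF t(1)] using nn by (simp add: norm_mult abs_mult del: of_real_diff of_real_mult)
      also have "\<dots> \<le> 1 * (1 - d\<gamma> t * d\<gamma> t)" by (rule mult_right_mono) (use nn in auto)
      finally show ?thesis by (simp add: t(2) bpt_height g_Gam[OF tm])
    qed
    then show ?thesis by (auto simp: eventually_at_filter)
  qed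
  then have Elim: "(E \<longlongrightarrow> 0) ?F" by (rule Lim_null_comparison[OF _ alim])
  show ?thesis
    unfolding vertical_field_def
  proof (rule bundle_field_pole[OF q(2)])
    show "?F \<noteq> bot" unfolding q(1) by (rule pole_limit_point[OF t0])
    have "((\<lambda>q'. ((0, 0), (\<i> * of_real (g (snd (fst q'))) * fst (snd q') + E q',
        - Im (cnj (fst (fst q')) * fst (snd q'))))) \<longlongrightarrow>
      ((0, 0), (\<i> * of_real (d\<gamma> t0) * (d\<gamma> t0 * cis \<theta>) + 0, - Im (cnj 0 * (d\<gamma> t0 * cis \<theta>))))) ?F"
      by (intro tendsto_intros ulim Elim glim plim)
    then show "((\<lambda>q'. ((0, 0), (\<i> * of_real (g (snd (fst q'))) * fst (snd q') + E q',
        - Im (cnj (fst (fst q')) * fst (snd q'))))) \<longlongrightarrow>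
      ((0, 0), (\<i> * d\<gamma> t0 * (d\<gamma> t0 * cis \<theta>), 0))) ?F" by simp
    fix t \<phi> \<theta> assume t: "t \<in> {0<..<l}"
    have "Im (cnj (fst (fst (bpt t \<phi> \<theta>))) * fst (snd (bpt t \<phi> \<theta>))) = sin \<phi> * \<gamma> t"
      unfolding bpt_def fst_conv snd_conv bpt_Im by simp
    then show "((0, 0), (\<i> * of_real (g (snd (fst (bpt t \<phi> \<theta>)))) * fst (snd (bpt t \<phi> \<theta>)) + E (bpt t \<phi> \<theta>),
        - Im (cnj (fst (fst (bpt t \<phi> \<theta>))) * fst (snd (bpt t \<phi> \<theta>))))) = frame_phi l \<gamma> t \<phi> \<theta>"
      unfolding E_def vertical_field_bpt[OF t] frame_phi_eq[OF t] by simp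
  qed
qed

lemma magnetic_field_bpt:
  assumes t: "t \<in> {0<..<l}"
  shows "magnetic_field m l \<gamma> (bpt t \<phi> \<theta>) =
    ((m * (Complex (cos \<phi> * d\<gamma> t) (sin \<phi>) * cis \<theta>), m * (cos \<phi> * \<gamma> t)),
     (Complex (m * (profile_deriv l \<gamma> 2 t * (cos \<phi>)\<^sup>2 - (1 - (d\<gamma> t)\<^sup>2) / \<gamma> t * (sin \<phi>)\<^sup>2) - sin \<phi> * d\<gamma> t) (cos \<phi>) * cis \<theta>,
      m * d\<gamma> t - sin \<phi> * \<gamma> t))"
  unfolding magnetic_field_def geodesic_field_bpt[OF t] vertical_field_bpt[OF t] geodesic_coord_eq[OF t] frame_phi_eq[OF t]
  by (simp add: complex_eq_iff scaleR_conv_of_real algebra_simps del: profile_deriv.simps)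

text \<open>Of the acceleration only the component along the parallels enters below.\<close>

lemma magnetic_field_form:
  assumes q: "q \<in> unit_bundle l \<gamma>"
  obtains a where "magnetic_field m l \<gamma> q = (m *\<^sub>R snd q, (a, m * g (snd (fst q)) - Im (cnj (fst (fst q)) * fst (snd q))))"
    and "Im (cnj (fst (fst q)) * a) = snd (snd q)"
  using q
proof (cases rule: unit_bundle_cases)
  case (reg t \<phi> \<theta>)
  have tm: "t \<in> {0..l}" using reg(1) by simp
  have Im: "Im (cnj (fst (fst q)) * (Complex a b * cis \<theta>)) = \<gamma> t * b" for a b
    unfolding reg(2) bpt_def fst_conv by (rule bpt_Im)
  show ?thesis
  proof (rule that[of "fst (snd (magnetic_field m l \<gamma> q))"])
    show "Im (cnj (fst (fst q)) * fst (snd (magnetic_field m l \<gamma> q))) = snd (snd q)"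
      unfolding reg(2) magnetic_field_bpt[OF reg(1)] fst_conv snd_conv Im[unfolded reg(2)]
      by (simp add: bpt_def)
    have "Im (cnj (fst (fst q)) * fst (snd q)) = \<gamma> t * sin \<phi>"
      using Im unfolding reg(2) bpt_def by simp
    then show "magnetic_field m l \<gamma> q = (m *\<^sub>R snd q, (fst (snd (magnetic_field m l \<gamma> q)),
        m * g (snd (fst q)) - Im (cnj (fst (fst q)) * fst (snd q))))"
      unfolding reg(2) magnetic_field_bpt[OF reg(1)]
      by (simp add: bpt_height g_Gam[OF tm]) (simp add: bpt_def scaleR_conv_of_real)
  qed
next
  case (pole t \<theta>)
  have tm: "t \<in> {0..l}" using pole(1) l_pos by auto
  show ?thesis
  proof (rule that)
    show "magnetic_field m l \<gamma> q = (m *\<^sub>R snd q, (\<i> * d\<gamma> t * (d\<gamma> t * cis \<theta>),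
        m * g (snd (fst q)) - Im (cnj (fst (fst q)) * fst (snd q))))"
      unfolding magnetic_field_def geodesic_field_pole[OF pole] vertical_field_pole[OF pole]
      by (simp add: pole(2) g_Gam[OF tm])
    show "Im (cnj (fst (fst q)) * (\<i> * d\<gamma> t * (d\<gamma> t * cis \<theta>))) = snd (snd q)"
      by (simp add: pole(2))
  qed
qed

section \<open>The projected field on the quotient and its first integral\<close>

text \<open>The result depends on q only through its projection, which makes
  \<open>quot_magnetic_field\<close> well defined. Of the unspecified acceleration only its pairing
  with the foot point enters, and that is known from \<open>magnetic_field_form\<close>.\<close>

lemma quot_field_at:
  assumes q: "q \<in> unit_bundle l \<gamma>" and y: "quot_proj q = (a, z)"
  shows "frechet_derivative quot_proj (at q) (magnetic_field m l \<gamma> q) =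
    (Complex (m * g z - Im a) (Re a), m * Re a)"
proof -
  obtain b where b: "magnetic_field m l \<gamma> q = (m *\<^sub>R snd q, (b, m * g (snd (fst q)) - Im (cnj (fst (fst q)) * fst (snd q))))"
    and Im: "Im (cnj (fst (fst q)) * b) = snd (snd q)" by (rule magnetic_field_form[OF q])
  \<comment> \<open>The foot point moves along the vector itself, so its contribution to the
    derivative of the pairing drops out.\<close>
  have "Im (cnj (m *\<^sub>R fst (snd q)) * fst (snd q)) = 0"
    by (simp add: algebra_simps)
  moreover have a: "z = snd (fst q)" "Re a = snd (snd q)" "Im a = Im (cnj (fst (fst q)) * fst (snd q))"
    using y by (auto simp: quot_proj_eq)
  ultimately show ?thesis
    unfolding frechet_derivative_at[OF quot_proj_has_derivative, symmetric] b
    using Im by simp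
qed

lemma quot_bundle_eq: "quot_bundle l \<gamma> = {(a, z). z \<in> {-1..1} \<and> (cmod a)\<^sup>2 = G z}"
proof (intro set_eqI iffI)
  fix y assume "y \<in> quot_bundle l \<gamma>"
  then obtain q where q: "q \<in> unit_bundle l \<gamma>" "y = quot_proj q" unfolding quot_bundle_def by blast
  from q(1) show "y \<in> {(a, z). z \<in> {-1..1} \<and> (cmod a)\<^sup>2 = G z}"
  proof (cases rule: unit_bundle_cases)
    case (reg t \<phi> \<theta>)
    then have "t \<in> {0..l}" by simp
    then show ?thesis using quot_proj_bundle_pt[OF np reg(1), of \<phi> \<theta>] Gam_mem[of t] G_Gam[of t]
      by (simp add: q(2) reg(3) norm_mult power_mult_distrib)
  next
    case (pole t \<theta>)
    then have "t \<in> {0..l}" "\<gamma> t = 0" using l_pos \<gamma>_ends by auto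
    then show ?thesis using Gam_mem[of t] G_Gam[of t] by (simp add: q(2) pole(2) quot_proj_eq complex_eq_iff)
  qed
next
  fix y assume "y \<in> {(a, z). z \<in> {-1..1} \<and> (cmod a)\<^sup>2 = G z}"
  then obtain a z where y: "y = (a, z)" "z \<in> {-1..1}" "(cmod a)\<^sup>2 = G z" by blast
  show "y \<in> quot_bundle l \<gamma>"
  proof (cases "z \<in> {-1<..<1}")
    case True
    define t where "t = \<tau> z"
    have t: "t \<in> {0<..<l}" "Gam \<gamma> t = z"
      unfolding t_def by (rule \<tau>_mem_open[OF True], rule Gam_\<tau>[OF y(2)])
    have "(cmod a)\<^sup>2 = (\<gamma> t)\<^sup>2" using y(3) by (simp add: G_def t_def)
    then have "cmod a = \<gamma> t" using \<gamma>_pos[OF t(1)] by (simp add: power2_eq_iff_nonneg less_imp_le)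
    then have "a = \<gamma> t * cis (Arg a)" using rcis_cmod_Arg[of a] by (simp add: rcis_def)
    then have "quot_proj (bpt t (Arg a) 0) = y"
      using quot_proj_bundle_pt[OF np t(1), of "Arg a" 0] by (simp add: bundle_pt_bpt[OF t(1)] y(1) t(2))
    then show ?thesis unfolding quot_bundle_def using bpt_mem[OF t(1)] regular_subset by blast
  next
    case False
    then have z: "z = -1 \<or> z = 1" using y(2) by force
    then have "a = 0" using y(3) G_ends by auto
    moreover obtain t where t: "t \<in> {0, l}" "Gam \<gamma> t = z" using z Gam_ends[OF np] by auto
    ultimately have "y = quot_proj ((0, Gam \<gamma> t), (d\<gamma> t * cis 0, 0))"
      by (simp add: quot_proj_eq y(1) complex_eq_iff)
    then show ?thesis unfolding quot_bundle_def using pole_mem[OF t(1), of 0] by blast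
  qed
qed

lemma quot_magnetic_field_eq:
  assumes "(a, z) \<in> quot_bundle l \<gamma>"
  shows "quot_magnetic_field m l \<gamma> (a, z) = (Complex (m * g z - Im a) (Re a), m * Re a)"
  unfolding quot_magnetic_field_def
proof (rule the_equality)
  show "\<forall>q\<in>unit_bundle l \<gamma>. quot_proj q = (a, z) \<longrightarrow>
      (Complex (m * g z - Im a) (Re a), m * Re a) = frechet_derivative quot_proj (at q) (magnetic_field m l \<gamma> q)"
    using quot_field_at by metis
  fix w assume w: "\<forall>q\<in>unit_bundle l \<gamma>. quot_proj q = (a, z) \<longrightarrow>
      w = frechet_derivative quot_proj (at q) (magnetic_field m l \<gamma> q)"
  obtain q where "q \<in> unit_bundle l \<gamma>" "quot_proj q = (a, z)"
    using assms unfolding quot_bundle_def by force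
  with w quot_field_at show "w = (Complex (m * g z - Im a) (Re a), m * Re a)" by metis
qed

lemma first_integral_invariant:
  assumes J: "is_interval J" "open J" and c: "integral_curve (unit_bundle l \<gamma>) (magnetic_field m l \<gamma>) J c"
    and "s \<in> J" "s' \<in> J"
  shows "first_integral m (quot_proj (c s)) = first_integral m (quot_proj (c s'))"
proof -
  have "((\<lambda>s. first_integral m (quot_proj (c s))) has_derivative (\<lambda>_. 0)) (at s within J)" if s: "s \<in> J" for s
  proof -
    have cs: "c s \<in> unit_bundle l \<gamma>" and d: "(c has_derivative (\<lambda>h. h *\<^sub>R magnetic_field m l \<gamma> (c s))) (at s within J)"
      using c s unfolding integral_curve_def has_vector_derivative_def by auto
    obtain a z where y: "quot_proj (c s) = (a, z)" by (metis surj_pair)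
    have qd: "(quot_proj has_derivative frechet_derivative quot_proj (at (c s))) (at (c s) within c ` J)"
      using quot_proj_has_derivative frechet_derivative_at[OF quot_proj_has_derivative] by metis
    have lin: "linear (frechet_derivative quot_proj (at (c s)))"
      using qd by (rule has_derivative_linear)
    have "((\<lambda>s. quot_proj (c s)) has_derivative
        (\<lambda>h. frechet_derivative quot_proj (at (c s)) (h *\<^sub>R magnetic_field m l \<gamma> (c s)))) (at s within J)"
      by (rule has_derivative_in_compose[OF d qd])
    then have "((\<lambda>s. quot_proj (c s)) has_derivative
        (\<lambda>h. h *\<^sub>R (Complex (m * g z - Im a) (Re a), m * Re a))) (at s within J)"
      unfolding linear_cmul[OF lin] quot_field_at[OF cs y] .
    then have "((\<lambda>s. m * Im (fst (quot_proj (c s))) - snd (quot_proj (c s))) has_derivative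
        (\<lambda>h. m * Im (fst (h *\<^sub>R (Complex (m * g z - Im a) (Re a), m * Re a))) -
          snd (h *\<^sub>R (Complex (m * g z - Im a) (Re a), m * Re a)))) (at s within J)"
      by (intro has_derivative_diff has_derivative_mult_right bounded_linear.has_derivative[OF bounded_linear_Im]
          has_derivative_fst has_derivative_snd)
    then show ?thesis by (simp add: first_integral_def split_beta algebra_simps)
  qed
  then show ?thesis
    using has_derivative_zero_constant[of J "\<lambda>s. first_integral m (quot_proj (c s))"] J(1) assms(4,5)
    by (metis is_interval_convex)
qed

end

section \<open>The level sets of the first integral in polar coordinates\<close>

text \<open>Together with the vacuous case of a point outside a closed piece, this differentiates
  functions glued from closed pieces, such as \<open>Ge\<close> below.\<close>

lemma has_real_derivative_union:
  assumes "(f has_real_derivative d) (at x within A)" "(f has_real_derivative d) (at x within B)"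
  shows "(f has_real_derivative d) (at x within A \<union> B)"
  unfolding has_field_derivative_iff
  unfolding at_within_union using assms[unfolded has_field_derivative_iff] by (rule filterlim_sup)

lemma has_real_derivative_notin_closed:
  "closed A \<Longrightarrow> x \<notin> A \<Longrightarrow> (f has_real_derivative d) (at x within A)"
proof -
  assume "closed A" "x \<notin> A"
  then have "at x within A = bot" unfolding trivial_limit_within by (meson closed_limpt)
  then show ?thesis by (simp add: has_field_derivative_iff)
qed

locale magnetic = profile +
  fixes m :: real
  assumes m_pos: "0 < m"
    and K_pos: "\<And>t. t \<in> {0..l} \<Longrightarrow> 0 < magnetic_curvature m l \<gamma> t"
begin

lemma m2_pos: "0 < m\<^sup>2" using m_pos by simp

lemma slope_bound:
  assumes t: "t \<in> {0<..<l}"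
  shows "m\<^sup>2 * profile_deriv l \<gamma> 2 t < \<gamma> t"
proof -
  have "0 < m\<^sup>2 * (- profile_deriv l \<gamma> 2 t / \<gamma> t) + 1"
    using K_pos[of t] t by (simp add: magnetic_curvature_def curvature_def Let_def del: profile_deriv.simps)
  then show ?thesis using \<gamma>_pos[OF t] by (simp add: field_simps del: profile_deriv.simps)
qed

text \<open>The affine continuation of \<open>G\<close> beyond the poles; it is needed to have an open domain for the
  implicit function theorem at level sets passing through a pole.\<close>

definition cl :: "real \<Rightarrow> real" where "cl z = max (-1) (min 1 z)"
definition ge :: "real \<Rightarrow> real" where "ge z = g (cl z)"
definition Ge :: "real \<Rightarrow> real" where
  "Ge z = (if z < -1 then 2 * (z + 1) else if 1 < z then - 2 * (z - 1) else G z)"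

lemma ge_eq: "z \<in> {-1..1} \<Longrightarrow> ge z = g z" and Ge_eq: "z \<in> {-1..1} \<Longrightarrow> Ge z = G z"
  by (auto simp: ge_def cl_def Ge_def)

lemma cont_ge: "continuous_on S ge"
proof -
  have "continuous_on UNIV cl" unfolding cl_def by (intro continuous_intros)
  then have "continuous_on UNIV ge"
    unfolding ge_def by (rule continuous_on_compose2[OF smooth1_continuous[OF smooth1_g]]) (auto simp: cl_def)
  then show ?thesis by (rule continuous_on_subset) simp
qed

lemma Ge_deriv: "(Ge has_real_derivative 2 * ge z) (at z)"
proof -
  have 1: "(Ge has_real_derivative 2 * ge z) (at z within {..-1})"
  proof (cases "z \<in> {..-1}")
    case True
    have "((\<lambda>z. 2 * (z + 1)) has_real_derivative 2) (at z within {..-1})"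
      by (auto intro!: derivative_eq_intros)
    then have "(Ge has_real_derivative 2) (at z within {..-1})"
      by (rule has_real_derivative_transform_on[OF True, rotated]) (auto simp: Ge_def G_ends)
    moreover have "cl z = -1" using True by (simp add: cl_def)
    ultimately show ?thesis by (simp add: ge_def g_ends)
  qed (rule has_real_derivative_notin_closed; simp)
  have 2: "(Ge has_real_derivative 2 * ge z) (at z within {1..})"
  proof (cases "z \<in> {1..}")
    case True
    have "((\<lambda>z. - 2 * (z - 1)) has_real_derivative - 2) (at z within {1..})"
      by (auto intro!: derivative_eq_intros)
    then have "(Ge has_real_derivative - 2) (at z within {1..})"
      by (rule has_real_derivative_transform_on[OF True, rotated]) (auto simp: Ge_def G_ends)
    moreover have "cl z = 1" using True by (simp add: cl_def)
    ultimately show ?thesis by (simp add: ge_def g_ends)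
  qed (rule has_real_derivative_notin_closed; simp)
  have 3: "(Ge has_real_derivative 2 * ge z) (at z within {-1..1})"
  proof (cases "z \<in> {-1..1}")
    case True
    show ?thesis unfolding ge_eq[OF True]
      by (rule has_real_derivative_transform_on[OF True Ge_eq G_deriv[OF True]])
  qed (rule has_real_derivative_notin_closed; simp)
  have "{..-1} \<union> {-1..1} \<union> {1..} = (UNIV :: real set)" by auto
  with has_real_derivative_union[OF has_real_derivative_union[OF 1 3] 2] show ?thesis by simp
qed

definition H :: "real \<Rightarrow> real \<Rightarrow> real" where "H c z = Ge z - (z + c)\<^sup>2 / m\<^sup>2"
definition dH :: "real \<Rightarrow> real \<Rightarrow> real" where "dH c z = 2 * ge z - 2 * (z + c) / m\<^sup>2"

lemma H_deriv: "(H c has_real_derivative dH c z) (at z)"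
proof -
  have "((\<lambda>z. (z + c)\<^sup>2 / m\<^sup>2) has_real_derivative 2 * (z + c) / m\<^sup>2) (at z)"
    by (rule DERIV_cdivide) (auto intro!: derivative_eq_intros)
  from DERIV_diff[OF Ge_deriv this] show ?thesis unfolding H_def dH_def .
qed

lemma cl_mono: "z \<le> z' \<Longrightarrow> cl z \<le> cl z'" and cl_diff: "z \<le> z' \<Longrightarrow> cl z' - cl z \<le> z' - z"
  and cl_mem: "cl z \<in> {-1..1}"
  unfolding cl_def max_def min_def by (simp_all split: if_splits)

text \<open>This is where \<open>K\<^sub>m > 0\<close> enters: since \<open>g' = - K\<close>, the function \<open>m\<^sup>2 H\<close> has second derivative
  \<open>- 2 K\<^sub>m\<close> on \<open>(-1, 1)\<close>.\<close>

lemma dH_decreasing: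
  assumes "z < z'"
  shows "dH c z' < dH c z"
proof -
  have aux: "g y - y / m\<^sup>2 < g x - x / m\<^sup>2" if "x \<in> {-1..1}" "y \<in> {-1..1}" "x < y" for x y
  proof (rule DERIV_neg_imp_decreasing_open[OF that(3)])
    fix u assume "x < u" "u < y"
    with that(1,2) have u: "u \<in> {-1<..<1}" by simp
    have "((\<lambda>u. g u - u / m\<^sup>2) has_real_derivative profile_deriv l \<gamma> 2 (\<tau> u) / \<gamma> (\<tau> u) - 1 / m\<^sup>2) (at u)"
      by (intro DERIV_diff g_deriv_open[OF u] DERIV_cdivide DERIV_ident)
    moreover have "profile_deriv l \<gamma> 2 (\<tau> u) / \<gamma> (\<tau> u) - 1 / m\<^sup>2 < 0"
    proof -
      have "profile_deriv l \<gamma> 2 (\<tau> u) < \<gamma> (\<tau> u) / m\<^sup>2"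
        using slope_bound[OF \<tau>_mem_open[OF u]] unfolding pos_less_divide_eq[OF m2_pos] by (simp only: mult.commute)
      then have "profile_deriv l \<gamma> 2 (\<tau> u) / \<gamma> (\<tau> u) < 1 / m\<^sup>2"
        unfolding pos_divide_less_eq[OF \<gamma>_pos[OF \<tau>_mem_open[OF u]]] by (simp del: profile_deriv.simps)
      then show ?thesis by linarith
    qed
    ultimately show "\<exists>d. ((\<lambda>u. g u - u / m\<^sup>2) has_real_derivative d) (at u) \<and> d < 0"
      by (intro exI conjI)
  next
    have m2: "\<forall>u\<in>{x..y}. m\<^sup>2 \<noteq> 0" using m2_pos by simp
    have "{x..y} \<subseteq> {-1..1}" using that(1,2) by simp
    from continuous_on_subset[OF smooth1_continuous[OF smooth1_g] this]
    show "continuous_on {x..y} (\<lambda>u. g u - u / m\<^sup>2)"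
      by (intro continuous_on_diff continuous_on_divide continuous_on_id continuous_on_const m2)
  qed
  \<comment> \<open>Where \<open>ge\<close> takes the same value at both points, the linear term
    alone decreases. Otherwise the estimate is applied to the clamped points; the linear term can
    only lose by clamping because \<open>cl\<close> does not increase distances.\<close>
  have "ge z' - z' / m\<^sup>2 < ge z - z / m\<^sup>2"
  proof (cases "cl z = cl z'")
    case True
    then have "ge z = ge z'" by (simp add: ge_def)
    with divide_strict_right_mono[OF assms m2_pos] show ?thesis by linarith
  next
    case False
    then have lt: "cl z < cl z'" using cl_mono[of z z'] assms by simp
    have "g (cl z') - cl z' / m\<^sup>2 < g (cl z) - cl z / m\<^sup>2"
      by (rule aux[OF cl_mem cl_mem lt])
    moreover have "(cl z' - cl z) / m\<^sup>2 \<le> (z' - z) / m\<^sup>2"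
      by (rule divide_right_mono[OF cl_diff]) (use assms in auto)
    ultimately show ?thesis unfolding ge_def diff_divide_distrib by linarith
  qed
  moreover have eq: "2 * (u + c) / m\<^sup>2 = 2 * (u / m\<^sup>2) + 2 * (c / m\<^sup>2)" for u
    by (simp add: add_divide_distrib distrib_left)
  ultimately show ?thesis unfolding dH_def eq by linarith
qed

text \<open>Polar coordinates around \<open>(zs, 0)\<close> in the \<open>(z, x)\<close>-plane, in which the level set is \<open>x\<^sup>2 = H c z\<close>.\<close>

definition Psi :: "real \<Rightarrow> real \<Rightarrow> real \<Rightarrow> real \<Rightarrow> real" where
  "Psi zs r \<beta> c = H c (zs + r * cos \<beta>) - (r * sin \<beta>)\<^sup>2"

text \<open>\<open>Psi_r\<close>, \<open>Psi_b\<close> and \<open>Psi_c\<close> are the partial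
  derivatives of \<open>Psi\<close> in r, \<beta> and c, used for implicit differentiation of the
  radius.\<close>

definition Psi_r :: "real \<Rightarrow> real \<Rightarrow> real \<Rightarrow> real \<Rightarrow> real" where
  "Psi_r zs r \<beta> c = dH c (zs + r * cos \<beta>) * cos \<beta> - 2 * r * (sin \<beta>)\<^sup>2"

definition Psi_b :: "real \<Rightarrow> real \<Rightarrow> real \<Rightarrow> real \<Rightarrow> real" where
  "Psi_b zs r \<beta> c = - (dH c (zs + r * cos \<beta>) * (r * sin \<beta>)) - 2 * r\<^sup>2 * sin \<beta> * cos \<beta>"

definition Psi_c :: "real \<Rightarrow> real \<Rightarrow> real \<Rightarrow> real \<Rightarrow> real" where
  "Psi_c zs r \<beta> c = - 2 * (zs + r * cos \<beta> + c) / m\<^sup>2"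

lemma Psi_deriv_r: "((\<lambda>r. Psi zs r \<beta> c) has_real_derivative Psi_r zs r \<beta> c) (at r)"
proof -
  have "((\<lambda>r. H c (zs + r * cos \<beta>)) has_real_derivative dH c (zs + r * cos \<beta>) * cos \<beta>) (at r)"
    by (rule DERIV_chain2[OF H_deriv]) (auto intro!: derivative_eq_intros)
  moreover have "((\<lambda>r. (r * sin \<beta>)\<^sup>2) has_real_derivative 2 * r * (sin \<beta>)\<^sup>2) (at r)"
    by (auto intro!: derivative_eq_intros simp: power2_eq_square)
  ultimately show ?thesis unfolding Psi_def Psi_r_def by (rule DERIV_diff)
qed

text \<open>Concavity along every ray from the centre: strict concavity of \<open>H c\<close>
  provides it unless the ray is orthogonal to the z-axis, where the term -(r sin \<beta>)^2
  does.\<close>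

lemma Psi_r_decreasing:
  assumes "r < r'"
  shows "Psi_r zs r' \<beta> c < Psi_r zs r \<beta> c"
proof (cases "cos \<beta> = 0")
  case True
  then have "(sin \<beta>)\<^sup>2 = 1" using sin_cos_squared_add[of \<beta>] by simp
  then show ?thesis using assms True by (simp add: Psi_r_def)
next
  case False
  have s: "2 * r * (sin \<beta>)\<^sup>2 \<le> 2 * r' * (sin \<beta>)\<^sup>2"
    by (rule mult_right_mono) (use assms in auto)
  have "dH c (zs + r' * cos \<beta>) * cos \<beta> < dH c (zs + r * cos \<beta>) * cos \<beta>"
  proof (cases "0 < cos \<beta>")
    case True
    then show ?thesis using dH_decreasing[of "zs + r * cos \<beta>" "zs + r' * cos \<beta>" c] assms by simp
  next
    case False
    then have "cos \<beta> < 0" using \<open>cos \<beta> \<noteq> 0\<close> by simp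
    then show ?thesis using dH_decreasing[of "zs + r' * cos \<beta>" "zs + r * cos \<beta>" c] assms by simp
  qed
  with s show ?thesis unfolding Psi_r_def by simp
qed

lemma Psi_zero: "Psi zs 0 \<beta> c = H c zs"
  by (simp add: Psi_def)

lemma H_ends_le: "H c (-1) \<le> 0" "H c 1 \<le> 0"
  by (simp_all add: H_def Ge_def G_ends)

text \<open>A function positive at 0 and zero at r has negative slope somewhere between by the mean
  value theorem, and by concavity the slope at r is smaller still.\<close>

lemma Psi_r_neg:
  assumes "0 < H c zs" "0 < r" "Psi zs r \<beta> c = 0"
  shows "Psi_r zs r \<beta> c < 0"
proof -
  obtain u where u: "0 < u" "u < r" "Psi zs r \<beta> c - Psi zs 0 \<beta> c = (r - 0) * Psi_r zs u \<beta> c"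
    using MVT2[OF assms(2) Psi_deriv_r] by blast
  then have "r * Psi_r zs u \<beta> c < 0" using assms by (simp add: Psi_zero)
  then have "Psi_r zs u \<beta> c < 0" using assms(2) by (simp add: mult_less_0_iff)
  with Psi_r_decreasing[OF u(2), of zs \<beta> c] show ?thesis by simp
qed

text \<open>Once its slope is negative a concave function keeps decreasing, so no value is taken
  twice in that region. This yields both the uniqueness of the radius and the injectivity used for
  the inverse function theorem.\<close>

lemma Psi_inj:
  assumes "Psi_r zs r \<beta> c < 0" "Psi_r zs r' \<beta> c < 0" "Psi zs r \<beta> c = Psi zs r' \<beta> c"
  shows "r = r'"
proof -
  have "\<not> r < r'" if "Psi_r zs r \<beta> c < 0" "Psi zs r \<beta> c = Psi zs r' \<beta> c" for r r'
  proof
    assume "r < r'"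
    from MVT2[OF this Psi_deriv_r] obtain u where
      "r < u" "Psi zs r' \<beta> c - Psi zs r \<beta> c = (r' - r) * Psi_r zs u \<beta> c" by blast
    with that \<open>r < r'\<close> Psi_r_decreasing[of r u zs \<beta> c] show False by auto
  qed
  from this[of r r'] this[of r' r] assms show ?thesis by fastforce
qed

text \<open>Along a ray not orthogonal to the axis, \<open>Psi\<close> is nonpositive once the
  height of a pole is reached, as G vanishes there; the root found on the way stays in [-1, 1]. An
  orthogonal ray keeps its height and the root is explicit.\<close>

lemma Psi_root_ex:
  assumes zs: "zs \<in> {-1<..<1}" and pos: "0 < H c zs"
  shows "\<exists>r. 0 < r \<and> Psi zs r \<beta> c = 0 \<and> zs + r * cos \<beta> \<in> {-1..1}"
proof (cases "cos \<beta> = 0")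
  case True
  then have s: "(sin \<beta>)\<^sup>2 = 1" using sin_cos_squared_add[of \<beta>] by simp
  have "Psi zs (sqrt (H c zs)) \<beta> c = 0"
    using pos by (simp add: Psi_def True power_mult_distrib s)
  then show ?thesis using pos zs True by (intro exI[of _ "sqrt (H c zs)"]) auto
next
  case False
  define e :: real where "e = (if 0 < cos \<beta> then 1 else -1)"
  define r1 where "r1 = (e - zs) / cos \<beta>"
  have r1: "0 < r1" "zs + r1 * cos \<beta> = e"
    using False zs by (auto simp: r1_def e_def zero_less_divide_iff)
  have "Psi zs r1 \<beta> c \<le> 0"
  proof -
    have "H c e \<le> 0" using H_ends_le[of c] by (simp add: e_def)
    then show ?thesis unfolding Psi_def r1(2) by (simp add: order_trans[of _ 0])
  qed
  moreover have "continuous_on {0..r1} (\<lambda>r. Psi zs r \<beta> c)"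
    by (rule DERIV_continuous_on[OF has_field_derivative_at_within[OF Psi_deriv_r]])
  ultimately obtain r where r: "0 \<le> r" "r \<le> r1" "Psi zs r \<beta> c = 0"
    using IVT2'[of "\<lambda>r. Psi zs r \<beta> c" r1 0 0] pos r1(1) by (auto simp: Psi_zero)
  have "r \<noteq> 0" using r(3) pos by (auto simp: Psi_zero)
  moreover have "zs + r * cos \<beta> \<in> {-1..1}"
  proof (cases "0 < cos \<beta>")
    case True
    then have "r * cos \<beta> \<le> r1 * cos \<beta>" "0 \<le> r * cos \<beta>"
      using r by (simp_all add: mult_right_mono del: mult_le_cancel_right mult_le_cancel_right_pos)
    moreover have "e = 1" using True by (simp add: e_def)
    ultimately show ?thesis using r1(2) zs unfolding atLeastAtMost_iff greaterThanLessThan_iff by linarith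
  next
    case F: False
    then have "r1 * cos \<beta> \<le> r * cos \<beta>" "r * cos \<beta> \<le> 0"
      using r False by (auto intro: mult_right_mono_neg mult_nonneg_nonpos)
    moreover have "e = -1" using F by (simp add: e_def)
    ultimately show ?thesis using r1(2) zs unfolding atLeastAtMost_iff greaterThanLessThan_iff by linarith
  qed
  ultimately show ?thesis using r by (intro exI[of _ r]) auto
qed

definition rad :: "real \<Rightarrow> real \<Rightarrow> real \<Rightarrow> real" where
  "rad zs \<beta> c = (THE r. 0 < r \<and> Psi zs r \<beta> c = 0)"

definition lev :: "real \<Rightarrow> real \<times> real \<Rightarrow> space3" where
  "lev zs = (\<lambda>(\<beta>, c). (Complex (rad zs \<beta> c * sin \<beta>) ((zs + rad zs \<beta> c * cos \<beta> + c) / m),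
     zs + rad zs \<beta> c * cos \<beta>))"

text \<open>The energies whose oval strictly encloses the centre (\<open>zs\<close>, 0); for these
  the oval is a graph over the angle.\<close>

definition levels :: "real \<Rightarrow> real set" where "levels zs = {c. 0 < H c zs}"

lemma open_levels: "open (levels zs)"
  unfolding levels_def H_def by (intro open_Collect_less continuous_intros) (use m_pos in auto)

end

section \<open>The radius of an oval as a smooth function of angle and energy\<close>

locale polar_chart = magnetic +
  fixes zs :: real
  assumes zs: "zs \<in> {-1<..<1}"
begin

lemma rad_unique:
  assumes "c \<in> levels zs" "0 < r" "Psi zs r \<beta> c = 0"
  shows "rad zs \<beta> c = r"
  unfolding rad_def
proof (rule the_equality)
  have pos: "0 < H c zs" using assms(1) by (simp add: levels_def)
  show "0 < r \<and> Psi zs r \<beta> c = 0" using assms by simp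
  fix r' assume "0 < r' \<and> Psi zs r' \<beta> c = 0"
  then show "r' = r"
    using Psi_inj[of zs r' \<beta> c r] Psi_r_neg[OF pos] assms(2,3) by simp
qed

lemma rad:
  assumes "c \<in> levels zs"
  shows "0 < rad zs \<beta> c" "Psi zs (rad zs \<beta> c) \<beta> c = 0" "zs + rad zs \<beta> c * cos \<beta> \<in> {-1..1}"
    "Psi_r zs (rad zs \<beta> c) \<beta> c < 0"
proof -
  have pos: "0 < H c zs" using assms by (simp add: levels_def)
  obtain r where r: "0 < r" "Psi zs r \<beta> c = 0" "zs + r * cos \<beta> \<in> {-1..1}"
    using Psi_root_ex[OF zs pos] by blast
  have "rad zs \<beta> c = r" by (rule rad_unique[OF assms r(1,2)])
  with r Psi_r_neg[OF pos r(1,2)] show "0 < rad zs \<beta> c" "Psi zs (rad zs \<beta> c) \<beta> c = 0"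
    "zs + rad zs \<beta> c * cos \<beta> \<in> {-1..1}" "Psi_r zs (rad zs \<beta> c) \<beta> c < 0" by simp_all
qed

lemma rad_periodic: "cis \<beta> = cis \<beta>' \<Longrightarrow> rad zs \<beta> c = rad zs \<beta>' c"
  unfolding rad_def Psi_def by (simp add: complex_eq_iff)

text \<open>The implicit function theorem, deduced from the inverse function theorem for f =
  (\<open>Psi\<close>, \<beta>, c). On the open set where \<open>Psi_r\<close> is negative f is
  injective, so one inverse on the whole image has the radius as its first component over (0,
  \<beta>, c). Only the C^1 property of the continued G enters.\<close>

lemma rad_has_derivative:
  assumes c: "c \<in> levels zs"
  shows "((\<lambda>x. rad zs (fst x) (snd x)) has_derivative
    (\<lambda>v. - (Psi_b zs (rad zs \<beta> c) \<beta> c * fst v + Psi_c zs (rad zs \<beta> c) \<beta> c * snd v) / Psi_r zs (rad zs \<beta> c) \<beta> c))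
    (at (\<beta>, c))"
proof -
  define f where "f = (\<lambda>x :: real \<times> real \<times> real. (Psi zs (fst x) (fst (snd x)) (snd (snd x)), snd x))"
  define S where "S = {x :: real \<times> real \<times> real. Psi_r zs (fst x) (fst (snd x)) (snd (snd x)) < 0}"
  define inv where "inv = inv_into S f"
  let ?r = "rad zs \<beta> c"
  let ?R = "Psi_r zs ?r \<beta> c" and ?B = "Psi_b zs ?r \<beta> c" and ?C = "Psi_c zs ?r \<beta> c"
  have cge: "continuous_on T (\<lambda>x. ge (h x))" if "continuous_on T h" for T and h :: "real \<times> real \<times> real \<Rightarrow> real"
    by (rule continuous_on_compose2[OF cont_ge[of UNIV] that]) simp
  have openS: "open S"
    unfolding S_def Psi_r_def dH_def by (intro open_Collect_less continuous_intros cge) (use m_pos in auto)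
  have Psi_der: "((\<lambda>x. Psi zs (fst x) (fst (snd x)) (snd (snd x))) has_derivative
      (\<lambda>v. Psi_r zs r b e * fst v + Psi_b zs r b e * fst (snd v) + Psi_c zs r b e * snd (snd v))) (at (r, b, e))"
    for r b e
  proof -
    have h: "((\<lambda>x :: real \<times> real \<times> real. zs + fst x * cos (fst (snd x))) has_derivative
        (\<lambda>v. fst v * cos b - r * sin b * fst (snd v))) (at (r, b, e))"
      by (auto intro!: derivative_eq_intros simp: algebra_simps)
    have sq: "((\<lambda>u. u\<^sup>2 / m\<^sup>2) has_real_derivative 2 * u / m\<^sup>2) (at u)"
      "((\<lambda>u. u\<^sup>2) has_real_derivative 2 * u) (at u)" for u :: real
      by (rule DERIV_cdivide; auto intro!: derivative_eq_intros) (auto intro!: derivative_eq_intros)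
    have k1: "((\<lambda>x :: real \<times> real \<times> real. zs + fst x * cos (fst (snd x)) + snd (snd x)) has_derivative
        (\<lambda>v. fst v * cos b - r * sin b * fst (snd v) + snd (snd v))) (at (r, b, e))"
      by (intro has_derivative_add h has_derivative_snd has_derivative_ident)
    have k2: "((\<lambda>x :: real \<times> real \<times> real. fst x * sin (fst (snd x))) has_derivative
        (\<lambda>v. fst v * sin b + r * cos b * fst (snd v))) (at (r, b, e))"
      by (auto intro!: derivative_eq_intros simp: algebra_simps)
    have k: "((\<lambda>x :: real \<times> real \<times> real. (zs + fst x * cos (fst (snd x)) + snd (snd x))\<^sup>2 / m\<^sup>2 + (fst x * sin (fst (snd x)))\<^sup>2)
        has_derivative (\<lambda>v. (fst v * cos b - r * sin b * fst (snd v) + snd (snd v)) * (2 * (zs + r * cos b + e) / m\<^sup>2) +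
          (fst v * sin b + r * cos b * fst (snd v)) * (2 * (r * sin b)))) (at (r, b, e))"
      using has_derivative_add[OF DERIV_compose_FDERIV[OF sq(1) k1] DERIV_compose_FDERIV[OF sq(2) k2]] by simp
    have G: "((\<lambda>x :: real \<times> real \<times> real. Ge (zs + fst x * cos (fst (snd x)))) has_derivative
        (\<lambda>v. (fst v * cos b - r * sin b * fst (snd v)) * (2 * ge (zs + r * cos b)))) (at (r, b, e))"
      using DERIV_compose_FDERIV[OF Ge_deriv h] by simp
    have main: "((\<lambda>x. Ge (zs + fst x * cos (fst (snd x))) - ((zs + fst x * cos (fst (snd x)) + snd (snd x))\<^sup>2 / m\<^sup>2 + (fst x * sin (fst (snd x)))\<^sup>2))
        has_derivative (\<lambda>v. (fst v * cos b - r * sin b * fst (snd v)) * (2 * ge (zs + r * cos b)) -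
          ((fst v * cos b - r * sin b * fst (snd v) + snd (snd v)) * (2 * (zs + r * cos b + e) / m\<^sup>2) +
          (fst v * sin b + r * cos b * fst (snd v)) * (2 * (r * sin b))))) (at (r, b, e))"
      by (rule has_derivative_diff[OF G k])
    have ptw: "(fst v * cos b - r * sin b * fst (snd v)) * (2 * ge (zs + r * cos b)) -
          ((fst v * cos b - r * sin b * fst (snd v) + snd (snd v)) * (2 * (zs + r * cos b + e) / m\<^sup>2) +
          (fst v * sin b + r * cos b * fst (snd v)) * (2 * (r * sin b))) =
        Psi_r zs r b e * fst v + Psi_b zs r b e * fst (snd v) + Psi_c zs r b e * snd (snd v)" for v
    proof -
      define K where "K = (zs + r * cos b + e) / m\<^sup>2"
      have "2 * (zs + r * cos b + e) / m\<^sup>2 = 2 * K" "- 2 * (zs + r * cos b + e) / m\<^sup>2 = - 2 * K"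
        by (simp_all add: K_def)
      then show ?thesis
        unfolding Psi_r_def Psi_b_def Psi_c_def dH_def by (simp add: algebra_simps power2_eq_square)
    qed
    have eq: "(\<lambda>x :: real \<times> real \<times> real. Psi zs (fst x) (fst (snd x)) (snd (snd x))) =
      (\<lambda>x. Ge (zs + fst x * cos (fst (snd x))) - ((zs + fst x * cos (fst (snd x)) + snd (snd x))\<^sup>2 / m\<^sup>2 + (fst x * sin (fst (snd x)))\<^sup>2))"
      unfolding Psi_def H_def by (simp only: diff_diff_eq)
    show ?thesis unfolding eq by (rule has_derivative_eq_rhs[OF main]) (simp only: ptw)
  qed
  have f_der: "(f has_derivative (\<lambda>v. (Psi_r zs r b e * fst v + Psi_b zs r b e * fst (snd v) + Psi_c zs r b e * snd (snd v), snd v)))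
      (at (r, b, e))" for r b e
    unfolding f_def by (intro has_derivative_Pair Psi_der has_derivative_snd has_derivative_ident)
  have f_cont: "continuous_on S f"
  proof (intro continuous_at_imp_continuous_on ballI)
    fix x :: "real \<times> real \<times> real"
    obtain r b e where "x = (r, b, e)" by (rule prod_cases3)
    then show "isCont f x" using has_derivative_continuous[OF f_der[of r b e]] by simp
  qed
  have injf: "inj_on f S"
  proof (rule inj_onI)
    fix x y assume xy: "x \<in> S" "y \<in> S" "f x = f y"
    have "fst x = fst y" if snd: "snd y = snd x"
    proof (rule Psi_inj)
      show "Psi_r zs (fst x) (fst (snd x)) (snd (snd x)) < 0" using xy(1) by (simp add: S_def)
      show "Psi_r zs (fst y) (fst (snd x)) (snd (snd x)) < 0" using xy(2) unfolding S_def mem_Collect_eq snd .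
      show "Psi zs (fst x) (fst (snd x)) (snd (snd x)) = Psi zs (fst y) (fst (snd x)) (snd (snd x))"
        using xy(3) unfolding f_def prod.inject snd by (rule conjunct1)
    qed
    moreover have "snd y = snd x" using xy(3) by (simp add: f_def)
    ultimately show "x = y" by (simp add: prod_eq_iff)
  qed
  have mem: "(rad zs b e, b, e) \<in> S" "f (rad zs b e, b, e) = (0, b, e)" if "e \<in> levels zs" for b e
    using rad[OF that] by (simp_all add: S_def f_def)
  have inv: "inv (0, b, e) = (rad zs b e, b, e)" if "e \<in> levels zs" for b e
    using inv_into_f_f[OF injf mem(1)[OF that]] mem(2)[OF that] by (simp add: inv_def)
  have R: "?R \<noteq> 0" using rad(4)[OF c, of \<beta>] by simp
  have "(inv has_derivative (\<lambda>w. ((fst w - (?B * fst (snd w) + ?C * snd (snd w))) / ?R, snd w))) (at (f (?r, \<beta>, c)))"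
  proof (rule has_derivative_inverse_strong[OF openS mem(1)[OF c] f_cont _ f_der])
    show "inv (f x) = x" if "x \<in> S" for x
      unfolding inv_def by (rule inv_into_f_f[OF injf that])
    show "(\<lambda>v. (?R * fst v + ?B * fst (snd v) + ?C * snd (snd v), snd v)) \<circ>
        (\<lambda>w. ((fst w - (?B * fst (snd w) + ?C * snd (snd w))) / ?R, snd w)) = id"
      using R by (auto simp: fun_eq_iff)
  qed
  then have d1: "(inv has_derivative (\<lambda>w. ((fst w - (?B * fst (snd w) + ?C * snd (snd w))) / ?R, snd w))) (at (0, \<beta>, c))"
    by (simp add: mem(2)[OF c])
  have d2: "((\<lambda>x. (0, x)) has_derivative (\<lambda>v. (0, v))) (at (\<beta>, c))"
    by (auto intro!: derivative_eq_intros)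
  have "((\<lambda>x. inv (0, x)) has_derivative (\<lambda>v. ((0 - (?B * fst v + ?C * snd v)) / ?R, v))) (at (\<beta>, c))"
    using has_derivative_compose[OF d2 d1] by simp
  from has_derivative_fst[OF this]
  have "((\<lambda>x. fst (inv (0, x))) has_derivative (\<lambda>v. - (?B * fst v + ?C * snd v) / ?R)) (at (\<beta>, c))"
    by (simp add: algebra_simps)
  then show ?thesis
  proof (rule has_derivative_transform_within_open[OF _ open_Times[OF open_UNIV open_levels[of zs]]])
    show "(\<beta>, c) \<in> UNIV \<times> levels zs" using c by simp
    fix x :: "real \<times> real" assume "x \<in> UNIV \<times> levels zs"
    then show "fst (inv (0, x)) = rad zs (fst x) (snd x)" using inv[of "snd x" "fst x"] by (simp add: mem_Times_iff)
  qed
qed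

text \<open>Bootstrap: the derivative of the radius is a quotient of expressions in the radius,
  sine, cosine and \<open>ge\<close> along the oval. As the oval stays over [-1, 1],
  \<open>ge\<close> may be replaced there by the smooth g, so each order of differentiability yields
  the next.\<close>

lemma Ck_on_rad: "Ck_on k ((UNIV :: real set) \<times> levels zs) (\<lambda>x. rad zs (fst x) (snd x))"
proof (induction k)
  have U: "open ((UNIV :: real set) \<times> levels zs)" by (intro open_Times open_UNIV open_levels)
  {
    case 0
    have "continuous_on ((UNIV :: real set) \<times> levels zs) (\<lambda>x. rad zs (fst x) (snd x))"
      by (rule continuous_at_imp_continuous_on) (use rad_has_derivative has_derivative_continuous in force)
    then show ?case by simp
  next
    case (Suc k)
    let ?r = "\<lambda>x :: real \<times> real. rad zs (fst x) (snd x)"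
    have f: "Ck_on k ((UNIV :: real set) \<times> levels zs) fst" "Ck_on k ((UNIV :: real set) \<times> levels zs) snd"
      by (intro Ck_on_linear U bounded_linear_fst bounded_linear_snd)+
    have m2: "m\<^sup>2 \<noteq> 0" using m2_pos by simp
    have z: "Ck_on k ((UNIV :: real set) \<times> levels zs) (\<lambda>x. zs + ?r x * cos (fst x))"
      by (intro Ck_on_intros U Suc f)
    obtain F where F: "F 0 = g" "deriv_tower {-1..1} F" by (rule smooth1E[OF smooth1_g])
    have "Ck_on k ((UNIV :: real set) \<times> levels zs) (\<lambda>x. F 0 (zs + ?r x * cos (fst x)))"
      by (rule Ck_on_deriv_tower[OF U F(2) z]) (use rad(3) in auto)
    then have ge: "Ck_on k ((UNIV :: real set) \<times> levels zs) (\<lambda>x. ge (zs + ?r x * cos (fst x)))"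
      by (rule Ck_on_cong[OF U, rotated]) (use rad(3) ge_eq F(1) in auto)
    show ?case
    proof (rule Ck_on_SucI[OF U])
      fix x assume "x \<in> (UNIV :: real set) \<times> levels zs"
      then show "((\<lambda>x. rad zs (fst x) (snd x)) has_derivative
        (\<lambda>v. - (Psi_b zs (?r x) (fst x) (snd x) * fst v + Psi_c zs (?r x) (fst x) (snd x) * snd v) /
          Psi_r zs (?r x) (fst x) (snd x))) (at x)"
        using rad_has_derivative[of "snd x" "fst x"] by auto
    next
      fix v :: "real \<times> real"
      have nz: "Psi_r zs (?r x) (fst x) (snd x) \<noteq> 0" if "x \<in> (UNIV :: real set) \<times> levels zs" for x
        using rad(4)[of "snd x" "fst x"] that by auto
      have dH: "Ck_on k ((UNIV :: real set) \<times> levels zs) (\<lambda>x. dH (snd x) (zs + ?r x * cos (fst x)))"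
        unfolding dH_def by (intro Ck_on_intros U ge z f m2)
      have "Ck_on k ((UNIV :: real set) \<times> levels zs) (\<lambda>x. Psi_r zs (?r x) (fst x) (snd x))"
        "Ck_on k ((UNIV :: real set) \<times> levels zs) (\<lambda>x. Psi_b zs (?r x) (fst x) (snd x))"
        "Ck_on k ((UNIV :: real set) \<times> levels zs) (\<lambda>x. Psi_c zs (?r x) (fst x) (snd x))"
        unfolding Psi_r_def Psi_b_def Psi_c_def power2_eq_square
        by (intro Ck_on_intros U dH z f Suc; use m_pos in simp)+
      then show "Ck_on k ((UNIV :: real set) \<times> levels zs) (\<lambda>x. - (Psi_b zs (?r x) (fst x) (snd x) * fst v + Psi_c zs (?r x) (fst x) (snd x) * snd v) /
          Psi_r zs (?r x) (fst x) (snd x))"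
        by (intro Ck_on_intros U nz)
    qed
  }
qed

end

section \<open>Closed orbits\<close>

text \<open>A nonvanishing multiple of the velocity of a closed curve is integrated by inverting the
  travel time \<open>\<integral> d\<beta> / \<rho>\<close>.\<close>

lemma closed_orbit_reparametrize:
  fixes c c' :: "real \<Rightarrow> 'e::real_normed_vector" and \<rho> :: "real \<Rightarrow> real"
  assumes d: "\<And>b. (c has_vector_derivative c' b) (at b)"
    and \<rho>: "continuous_on UNIV \<rho>" "\<And>b. 0 < \<rho> b" "\<And>b. \<rho> (b + 2 * pi) = \<rho> b"
    and M: "\<And>b. c b \<in> M" and X: "\<And>b. X (c b) = \<rho> b *\<^sub>R c' b"
    and per: "\<And>b. c (b + 2 * pi) = c b"
    and inj: "\<And>b b'. c b = c b' \<Longrightarrow> \<exists>n::int. b' = b + 2 * pi * n"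
  shows "closed_orbit M X (range c)"
proof -
  \<comment> \<open>The oriented integral is negative for negative b, so the travel time is strictly
    increasing on the whole line.\<close>
  define S where "S = (\<lambda>b::real. LBINT y=ereal 0..ereal b. 1 / \<rho> y)"
  have c\<rho>: "continuous_on A (\<lambda>y. 1 / \<rho> y)" for A
  proof (intro continuous_on_divide continuous_on_const continuous_on_subset[OF \<rho>(1)] ballI)
    show "\<rho> y \<noteq> 0" for y using \<rho>(2)[of y] by simp
  qed simp
  have dS: "(S has_real_derivative 1 / \<rho> b) (at b)" for b
  proof -
    define k where "k = \<bar>b\<bar> + 1"
    have k: "- k \<le> 0" "0 \<le> k" "- k \<le> b" "b \<le> k" "- k < b" "b < k" by (auto simp: k_def abs_if)
    have "((\<lambda>u. LBINT y=ereal 0..ereal u. 1 / \<rho> y) has_vector_derivative 1 / \<rho> b) (at b within {-k..k})"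
      by (rule interval_integral_FTC2[OF k(1,2) c\<rho> k(3,4)])
    then show ?thesis
      unfolding S_def has_real_derivative_iff_has_vector_derivative
      using at_within_Icc_at[OF k(5,6)] by simp
  qed
  have S0: "S 0 = 0" unfolding S_def by (rule interval_integral_endpoints_same)
  have mono: "S a < S b" if "a < b" for a b
  proof (rule DERIV_pos_imp_increasing[OF that])
    show "\<exists>y. (S has_real_derivative y) (at x) \<and> 0 < y" for x
      using dS[of x] \<rho>(2)[of x] by (intro exI[of _ "1 / \<rho> x"]) simp
  qed
  \<comment> \<open>Travel time of one turn; periodicity of \<rho> makes every further turn take
    equally long.\<close>
  define T where "T = S (2 * pi)"
  have T: "0 < T" using mono[of 0 "2 * pi"] by (simp add: T_def S0)
  have S1: "S (b + 2 * pi) = S b + T" for b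
  proof -
    have "((\<lambda>b. S (b + 2 * pi) - S b) has_real_derivative 0) (at x)" for x
    proof -
      have "((\<lambda>b. S (b + 2 * pi)) has_real_derivative 1 / \<rho> x * 1) (at x)"
        by (rule DERIV_chain2[of S]) (use dS[of "x + 2 * pi"] \<rho>(3)[of x] in \<open>auto intro!: derivative_eq_intros\<close>)
      from DERIV_diff[OF this dS[of x]] show ?thesis by simp
    qed
    from DERIV_isconst_all[OF allI[OF this], of b 0] show ?thesis by (simp add: S0 T_def)
  qed
  have Sn: "S (b + 2 * pi * real n) = S b + n * T" for b n
  proof (induction n)
    case (Suc n)
    have eq: "b + 2 * pi * real (Suc n) = (b + 2 * pi * real n) + 2 * pi" by (simp add: algebra_simps)
    have "S (b + 2 * pi * real (Suc n)) = S (b + 2 * pi * real n) + T"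
      unfolding eq by (rule S1)
    also have "\<dots> = S b + n * T + T" by (simp only: Suc)
    finally show ?case by (simp add: distrib_right)
  qed simp
  have Sz: "S (b + 2 * pi * of_int n) = S b + n * T" for b n
  proof (cases "0 \<le> n")
    case True
    then show ?thesis using Sn[of b "nat n"] by simp
  next
    case False
    then show ?thesis using Sn[of "b + 2 * pi * of_int n" "nat (- n)"] by simp
  qed
  have "\<exists>b. S b = s" for s
  proof -
    obtain n :: nat where n: "\<bar>s\<bar> < n * T" using reals_Archimedean3[OF T] by blast
    have "S (2 * pi * real n) = n * T" "S (- (2 * pi * real n)) = - (n * T)"
      using Sn[of 0 n] Sn[of "- (2 * pi * real n)" n] S0 by auto
    moreover have "continuous_on {- (2 * pi * real n)..2 * pi * real n} S"
      by (rule DERIV_continuous_on[OF has_field_derivative_at_within[OF dS]])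
    ultimately show ?thesis
      using IVT'[of S "- (2 * pi * real n)" s "2 * pi * real n"] n by (auto simp: abs_less_iff)
  qed
  then obtain B where B: "\<And>s. S (B s) = s" by metis
  have injS: "S a = S b \<Longrightarrow> a = b" for a b
    using mono[of a b] mono[of b a] by (cases a b rule: linorder_cases) auto
  have BS: "B (S b) = b" for b by (rule injS) (rule B)
  have dB: "(B has_real_derivative \<rho> (B s)) (at s)" for s
  proof -
    have "isCont S z" for z using dS by (rule DERIV_isCont)
    then have "isCont B (S (B s))"
      using isCont_inverse_function[of 1 "B s" B S] BS by simp
    then have cont: "isCont B s" by (simp add: B)
    have nz: "1 / \<rho> (B s) \<noteq> 0" using \<rho>(2)[of "B s"] by simp
    have "(B has_real_derivative inverse (1 / \<rho> (B s))) (at s)"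
      by (rule DERIV_inverse_function[of S "1 / \<rho> (B s)" B s, OF dS nz _ _ B cont, of "s - 1" "s + 1"]) simp_all
    then show ?thesis by (simp add: inverse_eq_divide)
  qed
  have BT: "B (s + T) = B s + 2 * pi" for s by (rule injS) (simp add: S1 B)
  have curve: "((\<lambda>s. c (B s)) has_vector_derivative X (c (B s))) (at s)" for s
  proof -
    have "(B has_vector_derivative \<rho> (B s)) (at s)"
      using dB by (simp add: has_real_derivative_iff_has_vector_derivative)
    from vector_diff_chain_at[OF this d] show ?thesis unfolding X by (simp add: o_def)
  qed
  have "inj_on (\<lambda>s. c (B s)) {0..<T}"
  proof (rule inj_onI)
    fix s s' assume s: "s \<in> {0..<T}" "s' \<in> {0..<T}" "c (B s) = c (B s')"
    obtain n :: int where "B s' = B s + 2 * pi * n" using inj[OF s(3)] by blast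
    then have eq: "s' = s + n * T" using Sz[of "B s" n] B by metis
    \<comment> \<open>Two times in [0, T) at the same point differ by n T; being less than T apart
      they coincide, so T is the minimal period.\<close>
    have "\<bar>of_int n * T\<bar> < T" using s(1,2) eq by auto
    then have "\<bar>real_of_int n\<bar> < 1" using T by (simp add: abs_mult)
    then have "n = 0" by linarith
    with eq show "s = s'" by simp
  qed
  moreover have "range c = range (\<lambda>s. c (B s))"
  proof
    show "range c \<subseteq> range (\<lambda>s. c (B s))"
    proof (rule image_subsetI)
      fix b show "c b \<in> range (\<lambda>s. c (B s))" by (rule range_eqI[of _ _ "S b"]) (simp add: BS)
    qed
  qed blast
  ultimately show ?thesis
    unfolding closed_orbit_def integral_curve_def
    using T M curve by (intro exI[of _ "\<lambda>s. c (B s)"] exI[of _ T]) (simp add: BT per)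
qed

lemma cis_eq_iff_int: "cis b = cis b' \<longleftrightarrow> (\<exists>n::int. b' = b + 2 * pi * n)"
proof
  assume "cis b = cis b'"
  then have "sin b' = sin b \<and> cos b' = cos b" by (simp add: complex_eq_iff)
  then obtain n :: int where "b' = b + 2 * pi * n"
    unfolding sin_cos_eq_iff by (auto simp: mult_ac)
  then show "\<exists>n::int. b' = b + 2 * pi * n" by blast
next
  assume "\<exists>n::int. b' = b + 2 * pi * n"
  then obtain n :: int where "b' = b + 2 * pi * n" by blast
  moreover have "cis (2 * pi * n) = 1" by (rule cis_multiple_2pi) simp
  ultimately show "cis b = cis b'" by (simp add: cis_mult[symmetric])
qed

section \<open>Ovals as closed orbits on the quotient\<close>

context polar_chart
begin

lemma lev_mem:
  assumes c: "c \<in> levels zs"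
  shows "lev zs (\<beta>, c) \<in> quot_bundle l \<gamma>" "first_integral m (lev zs (\<beta>, c)) = c"
proof -
  let ?r = "rad zs \<beta> c"
  have "Ge (zs + ?r * cos \<beta>) - (zs + ?r * cos \<beta> + c)\<^sup>2 / m\<^sup>2 - (?r * sin \<beta>)\<^sup>2 = 0"
    using rad(2)[OF c, of \<beta>] by (simp add: Psi_def H_def)
  moreover have "Ge (zs + ?r * cos \<beta>) = G (zs + ?r * cos \<beta>)" by (rule Ge_eq[OF rad(3)[OF c]])
  ultimately have "(?r * sin \<beta>)\<^sup>2 + ((zs + ?r * cos \<beta> + c) / m)\<^sup>2 = G (zs + ?r * cos \<beta>)"
    unfolding power_divide by linarith
  then show "lev zs (\<beta>, c) \<in> quot_bundle l \<gamma>"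
    using rad(3)[OF c, of \<beta>] unfolding quot_bundle_eq lev_def by (simp add: cmod_power2)
  show "first_integral m (lev zs (\<beta>, c)) = c"
    using m_pos by (simp add: first_integral_def lev_def)
qed

text \<open>The polar coordinates of a point of level c about the centre solve \<open>Psi\<close> =
  0, and the positive solution is unique.\<close>

lemma lev_inverse:
  assumes y: "(a, z) \<in> quot_bundle l \<gamma>" "first_integral m (a, z) = c" and c: "c \<in> levels zs"
    and r: "0 < r" "Complex (z - zs) (Re a) = of_real r * cis \<beta>"
  shows "lev zs (\<beta>, c) = (a, z)"
proof -
  have e: "zs + r * cos \<beta> = z" "r * sin \<beta> = Re a" using r(2) by (simp_all add: complex_eq_iff)
  have z: "z \<in> {-1..1}" "(Re a)\<^sup>2 + (Im a)\<^sup>2 = G z" using y(1) by (simp_all add: quot_bundle_eq cmod_power2)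
  have Im: "Im a = (z + c) / m" using y(2) m_pos by (simp add: first_integral_def field_simps)
  have "Psi zs r \<beta> c = 0"
    unfolding Psi_def e H_def Ge_eq[OF z(1)] power_divide[symmetric] Im[symmetric] using z(2) by linarith
  then have "rad zs \<beta> c = r" by (rule rad_unique[OF c r(1)])
  then show ?thesis unfolding lev_def prod.case by (simp add: e Im[symmetric])
qed

text \<open>At the centre the equation of the level set would read \<open>H c zs = 0\<close>,
  against c in \<open>levels zs\<close>. So the angle is defined at every point of the oval.\<close>

lemma off_center:
  assumes "(a, z) \<in> quot_bundle l \<gamma>" "first_integral m (a, z) \<in> levels zs"
  shows "Complex (z - zs) (Re a) \<noteq> 0"
proof
  assume "Complex (z - zs) (Re a) = 0"
  then have 0: "z = zs" "Re a = 0" by (simp_all add: complex_eq_iff)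
  define c where "c = first_integral m (a, z)"
  have z: "z \<in> {-1..1}" "(Re a)\<^sup>2 + (Im a)\<^sup>2 = G z" using assms(1) by (simp_all add: quot_bundle_eq cmod_power2)
  have Im: "Im a = (z + c) / m" using m_pos by (simp add: c_def first_integral_def field_simps)
  have "H c zs = 0"
    using z(2) unfolding H_def 0(1)[symmetric] Ge_eq[OF z(1)] power_divide[symmetric] Im[symmetric] 0(2) by simp
  then show False using assms(2) by (simp add: levels_def c_def)
qed

lemma lev_polar:
  "Complex (snd (lev zs (\<beta>, c)) - zs) (Re (fst (lev zs (\<beta>, c)))) = of_real (rad zs \<beta> c) * cis \<beta>"
  by (simp add: lev_def complex_eq_iff)

lemma lev_eqD:
  assumes "c \<in> levels zs" "c' \<in> levels zs" "lev zs (\<beta>, c) = lev zs (\<beta>', c')"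
  shows "c = c'" "cis \<beta> = cis \<beta>'"
proof -
  show c: "c = c'" using lev_mem(2)[OF assms(1), of \<beta>] lev_mem(2)[OF assms(2), of \<beta>'] assms(3) by simp
  have eq: "of_real (rad zs \<beta> c) * cis \<beta> = of_real (rad zs \<beta>' c') * cis \<beta>'"
    using lev_polar[of \<beta> c] lev_polar[of \<beta>' c'] assms(3) by simp
  have "norm (of_real (rad zs \<beta> c) * cis \<beta>) = norm (of_real (rad zs \<beta>' c') * cis \<beta>')"
    by (simp only: eq)
  then have "rad zs \<beta> c = rad zs \<beta>' c'"
    using rad(1)[OF assms(1), of \<beta>] rad(1)[OF assms(2), of \<beta>'] by (simp add: norm_mult)
  with eq rad(1)[OF assms(1), of \<beta>] show "cis \<beta> = cis \<beta>'" by simp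
qed

lemma lev_periodic: "cis \<beta> = cis \<beta>' \<Longrightarrow> lev zs (\<beta>, c) = lev zs (\<beta>', c)"
  using rad_periodic[of \<beta> \<beta>' c] by (simp add: lev_def complex_eq_iff)

definition rad' :: "real \<Rightarrow> real \<Rightarrow> real \<times> real \<Rightarrow> real" where
  "rad' \<beta> c v = - (Psi_b zs (rad zs \<beta> c) \<beta> c * fst v + Psi_c zs (rad zs \<beta> c) \<beta> c * snd v) / Psi_r zs (rad zs \<beta> c) \<beta> c"

definition lev' :: "real \<Rightarrow> real \<Rightarrow> real \<times> real \<Rightarrow> space3" where
  "lev' \<beta> c v = (Complex (rad' \<beta> c v * sin \<beta> + rad zs \<beta> c * cos \<beta> * fst v)
      ((rad' \<beta> c v * cos \<beta> - rad zs \<beta> c * sin \<beta> * fst v + snd v) / m),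
    rad' \<beta> c v * cos \<beta> - rad zs \<beta> c * sin \<beta> * fst v)"

lemma lev_has_derivative:
  assumes c: "c \<in> levels zs"
  shows "(lev zs has_derivative lev' \<beta> c) (at (\<beta>, c))"
proof -
  note R = rad_has_derivative[OF c, of \<beta>, folded rad'_def]
  have x: "((\<lambda>x. rad zs (fst x) (snd x) * sin (fst x)) has_derivative
      (\<lambda>v. rad' \<beta> c v * sin \<beta> + rad zs \<beta> c * cos \<beta> * fst v)) (at (\<beta>, c))"
    by (rule has_derivative_eq_rhs, (rule derivative_intros R)+) (simp add: fun_eq_iff)
  have z: "((\<lambda>x. rad zs (fst x) (snd x) * cos (fst x)) has_derivative
      (\<lambda>v. rad' \<beta> c v * cos \<beta> - rad zs \<beta> c * sin \<beta> * fst v)) (at (\<beta>, c))"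
    by (rule has_derivative_eq_rhs, (rule derivative_intros R)+) (simp add: fun_eq_iff)
  have z2: "((\<lambda>x. zs + rad zs (fst x) (snd x) * cos (fst x)) has_derivative
      (\<lambda>v. rad' \<beta> c v * cos \<beta> - rad zs \<beta> c * sin \<beta> * fst v)) (at (\<beta>, c))"
    using has_derivative_add[OF has_derivative_const z] by simp
  have y: "((\<lambda>x. (zs + rad zs (fst x) (snd x) * cos (fst x) + snd x) / m) has_derivative
      (\<lambda>v. (rad' \<beta> c v * cos \<beta> - rad zs \<beta> c * sin \<beta> * fst v + snd v) / m)) (at (\<beta>, c))"
    unfolding divide_inverse
    by (rule has_derivative_mult_left[OF has_derivative_add[OF z2 has_derivative_snd[OF has_derivative_ident]]])
  have main: "((\<lambda>x. (of_real (rad zs (fst x) (snd x) * sin (fst x)) +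
        \<i> * of_real ((zs + rad zs (fst x) (snd x) * cos (fst x) + snd x) / m), zs + rad zs (fst x) (snd x) * cos (fst x)))
      has_derivative (\<lambda>v. (of_real (rad' \<beta> c v * sin \<beta> + rad zs \<beta> c * cos \<beta> * fst v) +
        \<i> * of_real ((rad' \<beta> c v * cos \<beta> - rad zs \<beta> c * sin \<beta> * fst v + snd v) / m),
        rad' \<beta> c v * cos \<beta> - rad zs \<beta> c * sin \<beta> * fst v))) (at (\<beta>, c))"
    by (intro has_derivative_Pair has_derivative_add has_derivative_mult_right
        bounded_linear.has_derivative[OF bounded_linear_of_real] x y z2)
  have eq: "lev zs = (\<lambda>x. (of_real (rad zs (fst x) (snd x) * sin (fst x)) +
        \<i> * of_real ((zs + rad zs (fst x) (snd x) * cos (fst x) + snd x) / m), zs + rad zs (fst x) (snd x) * cos (fst x)))"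
    by (rule ext) (simp add: Complex_eq lev_def split_beta)
  have eq': "lev' \<beta> c = (\<lambda>v. (of_real (rad' \<beta> c v * sin \<beta> + rad zs \<beta> c * cos \<beta> * fst v) +
        \<i> * of_real ((rad' \<beta> c v * cos \<beta> - rad zs \<beta> c * sin \<beta> * fst v + snd v) / m),
        rad' \<beta> c v * cos \<beta> - rad zs \<beta> c * sin \<beta> * fst v))"
    by (rule ext) (simp add: Complex_eq lev'_def)
  show ?thesis unfolding eq eq' by (rule main)
qed

text \<open>The first integral isolates the c-component of v. What remains is a tangent vector of
  the (z, x)-plane, whose angular part is read off by pairing with the direction orthogonal to the
  ray.\<close>

lemma lev'_zero:
  assumes c: "c \<in> levels zs" and 0: "lev' \<beta> c v = 0"
  shows "v = 0"
proof -
  define r where "r = rad' \<beta> c v"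
  have e: "r * sin \<beta> + rad zs \<beta> c * cos \<beta> * fst v = 0" "r * cos \<beta> - rad zs \<beta> c * sin \<beta> * fst v = 0"
    "r * cos \<beta> - rad zs \<beta> c * sin \<beta> * fst v + snd v = 0"
    using 0 m_pos unfolding lev'_def r_def[symmetric] zero_prod_def prod.inject complex_eq_iff by simp_all
  have "snd v = 0" using e(3) unfolding e(2) by simp
  moreover have "rad zs \<beta> c * fst v * (cos \<beta> * cos \<beta> + sin \<beta> * sin \<beta>) =
      cos \<beta> * (r * sin \<beta> + rad zs \<beta> c * cos \<beta> * fst v) - sin \<beta> * (r * cos \<beta> - rad zs \<beta> c * sin \<beta> * fst v)"
    by (simp add: algebra_simps del: sin_cos_squared_add3)
  then have "rad zs \<beta> c * fst v = 0" unfolding e(1,2) sin_cos_squared_add3 by simp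
  then have "fst v = 0" using rad(1)[OF c, of \<beta>] by simp
  ultimately show ?thesis by (simp add: prod_eq_iff)
qed

text \<open>In the (z, x)-plane of level c the field is m/2 times the gradient of H c z - x^2 turned
  by a right angle. Its angular velocity about the centre is therefore m/2 times the radial
  derivative \<open>Psi_r\<close> divided by the radius.\<close>

definition speed :: "real \<Rightarrow> real \<Rightarrow> real" where
  "speed c \<beta> = m / 2 * Psi_r zs (rad zs \<beta> c) \<beta> c / rad zs \<beta> c"

lemma speed_neg: "c \<in> levels zs \<Longrightarrow> speed c \<beta> < 0"
  unfolding speed_def using rad(1,4)[of c \<beta>] m_pos
  by (intro divide_neg_pos mult_pos_neg) auto

lemma quot_field_lev:
  assumes c: "c \<in> levels zs"
  shows "quot_magnetic_field m l \<gamma> (lev zs (\<beta>, c)) = speed c \<beta> *\<^sub>R lev' \<beta> c (1, 0)"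
proof -
  define r C S D P B where "r = rad zs \<beta> c" "C = cos \<beta>" "S = sin \<beta>" "D = dH c (zs + r * C)"
    "P = Psi_r zs r \<beta> c" "B = Psi_b zs r \<beta> c"
  note defs = this
  have r: "r \<noteq> 0" "P \<noteq> 0" using rad(1,4)[OF c, of \<beta>] by (simp_all add: defs)
  have PB: "P = D * C - 2 * r * S * S" "B = - (D * (r * S)) - 2 * r * r * S * C"
    by (simp_all add: defs Psi_r_def Psi_b_def power2_eq_square)
  have CS: "C * C + S * S = 1" unfolding defs by (rule sin_cos_squared_add3)
  have r': "rad' \<beta> c (1, 0) = - B / P" by (simp add: rad'_def defs)
  have sp: "speed c \<beta> = m / 2 * P / r" by (simp add: speed_def defs)
  have mem: "(Complex (r * S) ((zs + r * C + c) / m), zs + r * C) \<in> quot_bundle l \<gamma>"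
    using lev_mem(1)[OF c, of \<beta>] by (simp add: lev_def defs)
  have z: "zs + r * C \<in> {-1..1}" using rad(3)[OF c, of \<beta>] by (simp add: defs)
  have 1: "m * g (zs + r * C) - (zs + r * C + c) / m = m / 2 * D"
  proof -
    have "m / 2 * (2 * x - 2 * y / m\<^sup>2) = m * x - y / m" for x y
      using m_pos by (simp add: field_simps power2_eq_square)
    from this[of "g (zs + r * C)" "zs + r * C + c"] show ?thesis
      unfolding defs(4) dH_def ge_eq[OF z] by (rule sym)
  qed
  \<comment> \<open>The slope of the radius in \<beta>, by implicit differentiation. Multiplication
    by \<open>P\<close> removes the quotient, after which both components reduce to cos^2 + sin^2 =
    1.\<close>
  define q where "q = - B / P"
  have q: "P * q = - B" using r(2) by (simp add: q_def)
  have "P * (q * S + r * C) = (P * q) * S + P * (r * C)" by (simp add: distrib_left)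
  also have "\<dots> = r * D * (C * C + S * S)" unfolding q unfolding PB by (simp add: algebra_simps)
  finally have "P * (q * S + r * C) = r * D" unfolding CS by simp
  moreover have "m / 2 * P / r * (q * S + r * C) = m / 2 * (P * (q * S + r * C)) / r" by simp
  ultimately have 2: "m / 2 * P / r * (q * S + r * C) = m / 2 * D" using r(1) by simp
  have "P * (q * C - r * S) = (P * q) * C - P * (r * S)" by (simp add: right_diff_distrib)
  also have "\<dots> = 2 * r * r * S * (C * C + S * S)" unfolding q unfolding PB by (simp add: algebra_simps)
  finally have "P * (q * C - r * S) = 2 * r * r * S" unfolding CS by simp
  moreover have "m / 2 * P / r * (q * C - r * S) = m / 2 * (P * (q * C - r * S)) / r" by simp
  ultimately have 3: "m / 2 * P / r * (q * C - r * S) = m * (r * S)" using r(1) by simp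
  have "m / 2 * P / r * ((q * C - r * S) / m) = (m / 2 * P / r * (q * C - r * S)) / m"
    by (rule times_divide_eq_right)
  then have 4: "m / 2 * P / r * ((q * C - r * S) / m) = r * S" unfolding 3 using m_pos by simp
  have lev: "lev zs (\<beta>, c) = (Complex (r * S) ((zs + r * C + c) / m), zs + r * C)"
    by (simp add: lev_def defs)
  have lev': "lev' \<beta> c (1, 0) = (Complex (q * S + r * C) ((q * C - r * S) / m), q * C - r * S)"
    unfolding lev'_def r' q_def[symmetric] by (simp add: defs(1-3))
  have "speed c \<beta> *\<^sub>R lev' \<beta> c (1, 0) = (Complex (m / 2 * D) (r * S), m * (r * S))"
    unfolding lev' sp scaleR_Pair complex_scaleR complex.sel real_scaleR_def 2 3 4 ..
  then show ?thesis
    unfolding lev quot_magnetic_field_eq[OF mem] complex.sel 1 by simp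
qed

lemma lev_deriv_beta:
  assumes c: "c \<in> levels zs"
  shows "((\<lambda>\<beta>. lev zs (\<beta>, c)) has_vector_derivative lev' \<beta> c (1, 0)) (at \<beta>)"
proof -
  have "((\<lambda>\<beta>. (\<beta>, c)) has_derivative (\<lambda>h. (h, 0))) (at \<beta>)"
    by (intro has_derivative_Pair has_derivative_ident has_derivative_const)
  from has_derivative_compose[OF this lev_has_derivative[OF c]]
  have "((\<lambda>\<beta>. lev zs (\<beta>, c)) has_derivative (\<lambda>h. lev' \<beta> c (h, 0))) (at \<beta>)" .
  moreover have "(\<lambda>h. lev' \<beta> c (h, 0)) = (\<lambda>h. h *\<^sub>R lev' \<beta> c (1, 0))"
  proof
    show "lev' \<beta> c (h, 0) = h *\<^sub>R lev' \<beta> c (1, 0)" for h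
      using linear_cmul[OF has_derivative_linear[OF lev_has_derivative[OF c, of \<beta>]], of h "(1, 0)"] by simp
  qed
  ultimately show ?thesis unfolding has_vector_derivative_def by metis
qed

lemma continuous_speed:
  assumes c: "c \<in> levels zs"
  shows "continuous_on UNIV (speed c)"
proof -
  have "continuous_on ((UNIV :: real set) \<times> levels zs) (\<lambda>x. rad zs (fst x) (snd x))"
    using Ck_on_rad[of 0] by simp
  then have "continuous_on UNIV (\<lambda>\<beta>. (\<lambda>x. rad zs (fst x) (snd x)) (\<beta>, c))"
  proof (rule continuous_on_compose2)
    show "continuous_on UNIV (\<lambda>\<beta> :: real. (\<beta>, c))" by (intro continuous_intros)
  qed (use c in auto)
  then have r: "continuous_on UNIV (\<lambda>\<beta>. rad zs \<beta> c)" by simp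
  have ge: "continuous_on UNIV (\<lambda>\<beta>. ge (zs + rad zs \<beta> c * cos \<beta>))"
    by (rule continuous_on_compose2[OF cont_ge[of UNIV]]) (intro continuous_intros r, simp)
  have "\<forall>\<beta>\<in>UNIV. rad zs \<beta> c \<noteq> 0"
  proof
    show "rad zs \<beta> c \<noteq> 0" for \<beta> using rad(1)[OF c, of \<beta>] by simp
  qed
  moreover have "continuous_on UNIV (\<lambda>\<beta>. m / 2 * ((2 * ge (zs + rad zs \<beta> c * cos \<beta>) -
      2 * (zs + rad zs \<beta> c * cos \<beta> + c) * inverse (m\<^sup>2)) * cos \<beta> - 2 * rad zs \<beta> c * (sin \<beta>)\<^sup>2))"
    by (intro continuous_on_mult continuous_on_diff continuous_on_add continuous_on_power continuous_on_const
        continuous_on_sin continuous_on_cos continuous_on_id r ge)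
  ultimately show ?thesis
    unfolding speed_def Psi_r_def dH_def divide_inverse[of _ "m\<^sup>2"]
    by (intro continuous_on_divide r)
qed

text \<open>The angular velocity \<open>speed\<close> is negative, so the oval is traversed with
  -\<beta> as parameter to obtain the positive factor required by
  \<open>closed_orbit_reparametrize\<close>.\<close>

lemma closed_orbit_level:
  assumes c: "c \<in> levels zs"
  shows "closed_orbit (quot_bundle l \<gamma>) (quot_magnetic_field m l \<gamma>) (range (\<lambda>\<beta>. lev zs (\<beta>, c)))"
proof -
  have cis: "cis (- (b + 2 * pi)) = cis (- b)" for b
    unfolding cis_eq_iff_int by (rule exI[of _ 1]) simp
  have "closed_orbit (quot_bundle l \<gamma>) (quot_magnetic_field m l \<gamma>) (range (\<lambda>b. lev zs (- b, c)))"
  proof (rule closed_orbit_reparametrize)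
    fix b :: real
    have "(uminus has_vector_derivative - 1) (at b)"
      unfolding has_real_derivative_iff_has_vector_derivative[symmetric] by (auto intro!: derivative_eq_intros)
    from vector_diff_chain_at[OF this lev_deriv_beta[OF c]]
    show "((\<lambda>b. lev zs (- b, c)) has_vector_derivative - lev' (- b) c (1, 0)) (at b)"
      by (simp add: o_def)
    show "0 < - speed c (- b)" using speed_neg[OF c] by simp
    show "- speed c (- (b + 2 * pi)) = - speed c (- b)"
    proof -
      have "rad zs (- (b + 2 * pi)) c = rad zs (- b) c" by (rule rad_periodic[OF cis])
      moreover have "cos (- (b + 2 * pi)) = cos (- b)" "sin (- (b + 2 * pi)) = sin (- b)"
        using cis[of b] unfolding complex_eq_iff cis.sel by blast+
      ultimately show ?thesis unfolding speed_def Psi_r_def by (simp only:)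
    qed
    show "lev zs (- b, c) \<in> quot_bundle l \<gamma>" by (rule lev_mem(1)[OF c])
    show "quot_magnetic_field m l \<gamma> (lev zs (- b, c)) = (- speed c (- b)) *\<^sub>R (- lev' (- b) c (1, 0))"
      by (simp add: quot_field_lev[OF c])
    show "lev zs (- (b + 2 * pi), c) = lev zs (- b, c)" by (rule lev_periodic[OF cis])
  next
    show "continuous_on UNIV (\<lambda>b. - speed c (- b))"
      by (intro continuous_intros continuous_on_compose2[OF continuous_speed[OF c]]) auto
    fix b b' assume "lev zs (- b, c) = lev zs (- b', c)"
    from lev_eqD(2)[OF c c this] obtain n :: int where "- b' = - b + 2 * pi * n"
      unfolding cis_eq_iff_int by blast
    then show "\<exists>n::int. b' = b + 2 * pi * n" by (intro exI[of _ "- n"]) simp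
  qed
  moreover have "range (\<lambda>b. lev zs (- b, c)) = range (\<lambda>b. lev zs (b, c))"
  proof
    show "range (\<lambda>b. lev zs (b, c)) \<subseteq> range (\<lambda>b. lev zs (- b, c))"
    proof (rule image_subsetI)
      fix b show "lev zs (b, c) \<in> range (\<lambda>b. lev zs (- b, c))" by (rule range_eqI[of _ _ "- b"]) simp
    qed
  qed blast
  ultimately show ?thesis by simp
qed

lemma level_set_eq:
  assumes c: "c \<in> levels zs"
  shows "{y \<in> quot_bundle l \<gamma>. first_integral m y = c} = range (\<lambda>\<beta>. lev zs (\<beta>, c))"
proof
  show "range (\<lambda>\<beta>. lev zs (\<beta>, c)) \<subseteq> {y \<in> quot_bundle l \<gamma>. first_integral m y = c}"
    using lev_mem[OF c] by blast
  show "{y \<in> quot_bundle l \<gamma>. first_integral m y = c} \<subseteq> range (\<lambda>\<beta>. lev zs (\<beta>, c))"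
  proof
    fix y assume "y \<in> {y \<in> quot_bundle l \<gamma>. first_integral m y = c}"
    then obtain a z where y: "y = (a, z)" "(a, z) \<in> quot_bundle l \<gamma>" "first_integral m (a, z) = c"
      by (metis (mono_tags, lifting) mem_Collect_eq surj_pair)
    let ?w = "Complex (z - zs) (Re a)"
    have w: "?w \<noteq> 0" by (rule off_center[OF y(2)]) (simp add: y(3) c)
    have "lev zs (Arg ?w, c) = (a, z)"
      by (rule lev_inverse[OF y(2,3) c, of "cmod ?w"]) (use w rcis_cmod_Arg[of ?w] in \<open>simp_all add: rcis_def\<close>)
    then show "y \<in> range (\<lambda>\<beta>. lev zs (\<beta>, c))" unfolding y(1) by (metis rangeI)
  qed
qed

text \<open>Stated by components because the section \<open>sec\<close> uses the real part, the
  imaginary part and the height separately.\<close>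

lemma Ck_on_lev_components:
  fixes D :: "(real \<times> real) set" defines "D \<equiv> UNIV \<times> levels zs"
  shows "Ck_on k D (\<lambda>x. Re (fst (lev zs x)))" "Ck_on k D (\<lambda>x. Im (fst (lev zs x)))"
    "Ck_on k D (\<lambda>x. snd (lev zs x))"
proof -
  have U: "open D" unfolding D_def by (intro open_Times open_UNIV open_levels)
  have f: "Ck_on k D fst" "Ck_on k D snd"
    by (intro Ck_on_linear U bounded_linear_fst bounded_linear_snd)+
  have R: "Ck_on k D (\<lambda>x. rad zs (fst x) (snd x))" unfolding D_def by (rule Ck_on_rad)
  have m: "m \<noteq> 0" using m_pos by simp
  show "Ck_on k D (\<lambda>x. Re (fst (lev zs x)))"
    unfolding lev_def split_beta by (simp, intro Ck_on_intros U f R)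
  show "Ck_on k D (\<lambda>x. Im (fst (lev zs x)))"
    unfolding lev_def split_beta by (simp, intro Ck_on_intros U f R m)
  show "Ck_on k D (\<lambda>x. snd (lev zs x))"
    unfolding lev_def split_beta by (simp, intro Ck_on_intros U f R)
qed

lemma Ck_on_lev: "Ck_on k (UNIV \<times> levels zs) (lev zs)"
proof -
  have U: "open ((UNIV :: real set) \<times> levels zs)" by (intro open_Times open_UNIV open_levels)
  have "Ck_on k (UNIV \<times> levels zs) (\<lambda>x. (Complex (Re (fst (lev zs x))) (Im (fst (lev zs x))), snd (lev zs x)))"
    by (intro Ck_on_Pair Ck_on_Complex Ck_on_lev_components U)
  then show ?thesis by simp
qed

end

section \<open>Critical points and latitudes\<close>

lemma first_integral_eq: "first_integral m y = m * Im (fst y) - snd y"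
  by (simp add: first_integral_def split_beta)

lemma bounded_linear_first_integral: "bounded_linear (first_integral m)"
proof -
  have "bounded_linear (\<lambda>y :: space3. m * Im (fst y) - snd y)"
    by (intro bounded_linear_sub bounded_linear_const_mult bounded_linear_compose[OF bounded_linear_Im]
        bounded_linear_fst bounded_linear_snd)
  then show ?thesis by (simp add: first_integral_eq[abs_def])
qed

lemma cis_sign_pi_half: "\<sigma> \<in> {-1, 1} \<Longrightarrow> cis (\<sigma> * pi / 2) = \<i> * of_real \<sigma>"
  by (auto simp: complex_eq_iff)

lemma cos_sin_sign_pi_half:
  "\<sigma> \<in> {-1, 1} \<Longrightarrow> cos (\<sigma> * pi / 2) = 0" "\<sigma> \<in> {-1, 1} \<Longrightarrow> sin (\<sigma> * pi / 2) = \<sigma>"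
  by auto

context profile
begin

lemma integral_pm_deriv:
  assumes "t \<in> {0..l}"
  shows "(integral_pm \<sigma> m \<gamma> has_real_derivative \<sigma> * m * d\<gamma> t - \<gamma> t) (at t within {0..l})"
  unfolding integral_pm_def[abs_def]
  by (intro DERIV_diff DERIV_cmult \<gamma>_deriv Gam_deriv[OF np] assms)

lemma Crit_pm_iff: "t \<in> Crit_pm \<sigma> m l \<gamma> \<longleftrightarrow> t \<in> {0..l} \<and> \<sigma> * m * d\<gamma> t = \<gamma> t"
proof -
  have eq: "(f has_derivative (\<lambda>_. 0)) F \<longleftrightarrow> (f has_real_derivative 0) F" for f F
    by (simp add: has_field_derivative_def lambda_zero)
  have "(integral_pm \<sigma> m \<gamma> has_real_derivative 0) (at t within {0..l}) \<longleftrightarrow> \<sigma> * m * d\<gamma> t = \<gamma> t"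
    if t: "t \<in> {0..l}"
  proof
    assume "(integral_pm \<sigma> m \<gamma> has_real_derivative 0) (at t within {0..l})"
    from has_real_derivative_unique_Icc[OF integral_pm_deriv[OF t] this l_pos t]
    show "\<sigma> * m * d\<gamma> t = \<gamma> t" by simp
  next
    assume "\<sigma> * m * d\<gamma> t = \<gamma> t"
    then show "(integral_pm \<sigma> m \<gamma> has_real_derivative 0) (at t within {0..l})"
      using integral_pm_deriv[OF t, of \<sigma> m] by simp
  qed
  then show ?thesis unfolding Crit_pm_def critical_points_def mem_Collect_eq eq by blast
qed

text \<open>At an endpoint \<gamma> vanishes whereas m \<gamma>' is m or -m. So critical points
  avoid the poles and the coordinates (t, \<phi>) are legitimate there.\<close>

lemma Crit_pm_interior:
  assumes "0 < m" "\<sigma> \<in> {-1, 1}" "t \<in> Crit_pm \<sigma> m l \<gamma>"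
  shows "t \<in> {0<..<l}"
proof -
  have "t \<in> {0..l}" and eq: "\<sigma> * m * d\<gamma> t = \<gamma> t" using assms(3) by (simp_all add: Crit_pm_iff)
  moreover have "t \<noteq> 0" using eq assms(1,2) by (auto simp: d\<gamma>_ends \<gamma>_ends)
  moreover have "t \<noteq> l" using eq assms(1,2) by (auto simp: d\<gamma>_ends \<gamma>_ends)
  ultimately show ?thesis by simp
qed

lemma quot_pt_eq: "t \<in> {0<..<l} \<Longrightarrow> quot_pt l \<gamma> (t, \<phi>) = (\<gamma> t * cis \<phi>, Gam \<gamma> t)"
  by (simp add: quot_pt_def quot_proj_bundle_pt[OF np])

lemma polar_mem: "t \<in> {0..l} \<Longrightarrow> (\<gamma> t * cis \<phi>, Gam \<gamma> t) \<in> quot_bundle l \<gamma>"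
  unfolding quot_bundle_eq using Gam_mem[of t] G_Gam[of t] by (simp add: norm_mult)

lemma quot_bundleE:
  assumes "y \<in> quot_bundle l \<gamma>"
  obtains t \<phi> where "t \<in> {0..l}" "y = (\<gamma> t * cis \<phi>, Gam \<gamma> t)"
proof -
  obtain a z where y: "y = (a, z)" "z \<in> {-1..1}" "(cmod a)\<^sup>2 = G z" using assms unfolding quot_bundle_eq by blast
  have "cmod a = \<gamma> (\<tau> z)"
    using y(3) \<gamma>_nonneg[OF \<tau>_mem[OF y(2)]] by (simp add: G_def power2_eq_iff_nonneg)
  then have "a = \<gamma> (\<tau> z) * cis (Arg a)" using rcis_cmod_Arg[of a] by (simp add: rcis_def)
  then show thesis using that[OF \<tau>_mem[OF y(2)], of "Arg a"] y(1) Gam_\<tau>[OF y(2)] by simp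
qed

text \<open>At a critical point every curve in the quotient annihilates the differential of the first
  integral.\<close>

lemma Crit_curve:
  assumes y: "y \<in> Crit m l \<gamma>" and f: "(f has_vector_derivative v) (at s within S)"
    and fS: "\<And>s. s \<in> S \<Longrightarrow> f s \<in> quot_bundle l \<gamma>" and s: "f s = y" "at s within S \<noteq> bot"
  shows "first_integral m v = 0"
proof -
  have "(first_integral m has_derivative (\<lambda>_. 0)) (at (f s) within quot_bundle l \<gamma>)"
    using y unfolding Crit_def critical_points_def s(1) by simp
  then have "(first_integral m has_derivative (\<lambda>_. 0)) (at (f s) within f ` S)"
    by (rule has_derivative_subset) (use fS in blast)
  from has_derivative_in_compose[OF f[unfolded has_vector_derivative_def] this]
  have 1: "((\<lambda>s. first_integral m (f s)) has_vector_derivative 0) (at s within S)"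
    by (simp add: has_vector_derivative_def)
  have 2: "((\<lambda>s. first_integral m (f s)) has_vector_derivative first_integral m v) (at s within S)"
    by (rule bounded_linear.has_vector_derivative[OF bounded_linear_first_integral f])
  show ?thesis by (rule vector_derivative_unique_within[OF s(2) 2 1])
qed

text \<open>Two test curves suffice. The parallel through y forces cos \<phi> = 0, hence sin \<phi>
  is a sign; the meridian through y yields the critical point equation for that sign.\<close>

lemma Crit_subset:
  assumes m: "0 < m" and y: "y \<in> Crit m l \<gamma>"
  shows "\<exists>\<sigma>\<in>{-1, 1}. \<exists>t\<in>Crit_pm \<sigma> m l \<gamma>. y = quot_pt l \<gamma> (t, \<sigma> * pi / 2)"
proof -
  have "y \<in> quot_bundle l \<gamma>" using y by (simp add: Crit_def critical_points_def)
  then obtain t \<phi> where t: "t \<in> {0..l}" and yt: "y = (\<gamma> t * cis \<phi>, Gam \<gamma> t)" by (rule quot_bundleE)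
  have nb: "at t within {0..l} \<noteq> bot" using t l_pos by (simp add: trivial_limit_within islimpt_Icc)
  have meridian: "m * d\<gamma> t * sin \<phi>' = \<gamma> t" if "y = (\<gamma> t * cis \<phi>', Gam \<gamma> t)" for \<phi>'
  proof -
    have "((\<lambda>t. (of_real (\<gamma> t) * cis \<phi>', Gam \<gamma> t)) has_vector_derivative (of_real (d\<gamma> t) * cis \<phi>', \<gamma> t))
        (at t within {0..l})"
      by (intro has_vector_derivative_Pair has_vector_derivative_mult_left has_vector_derivative_of_real
          \<gamma>_deriv[OF t]) (use Gam_deriv[OF np t] in \<open>simp add: has_real_derivative_iff_has_vector_derivative\<close>)
    from Crit_curve[OF y this _ _ nb] have "first_integral m (of_real (d\<gamma> t) * cis \<phi>', \<gamma> t) = 0"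
      using polar_mem that by simp
    then show ?thesis by (simp add: first_integral_eq)
  qed
  have tI: "t \<in> {0<..<l}"
  proof (rule ccontr)
    assume "t \<notin> {0<..<l}"
    then have e: "t = 0 \<or> t = l" using t by auto
    then have "\<gamma> t = 0" using \<gamma>_ends by auto
    \<comment> \<open>At a pole every angle represents the same point, so \<phi> = pi/2 is
      admissible; the meridian equation then contradicts m > 0.\<close>
    then have "y = (\<gamma> t * cis (pi / 2), Gam \<gamma> t)" by (simp add: yt)
    from meridian[OF this] e m show False by (auto simp: d\<gamma>_ends \<gamma>_ends)
  qed
  have "((\<lambda>\<phi>. (of_real (\<gamma> t) * cis \<phi>, Gam \<gamma> t)) has_vector_derivative (of_real (\<gamma> t) * (\<i> * cis \<phi>), 0)) (at \<phi> within UNIV)"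
    by (intro has_vector_derivative_Pair has_vector_derivative_mult_right cis_has_vector_derivative
        has_vector_derivative_const)
  from Crit_curve[OF y this] have "first_integral m (of_real (\<gamma> t) * (\<i> * cis \<phi>), 0) = 0"
    using polar_mem[OF t] yt by simp
  then have c0: "cos \<phi> = 0" using m \<gamma>_pos[OF tI] by (simp add: first_integral_eq)
  then have "(sin \<phi>)\<^sup>2 = 1" using sin_cos_squared_add[of \<phi>] by simp
  then have \<sigma>: "sin \<phi> \<in> {-1, 1}" by (auto simp: power2_eq_1_iff)
  have "t \<in> Crit_pm (sin \<phi>) m l \<gamma>"
    using meridian[OF yt] t by (simp add: Crit_pm_iff mult_ac)
  moreover have "cis \<phi> = cis (sin \<phi> * pi / 2)"
    unfolding cis_sign_pi_half[OF \<sigma>] by (simp add: complex_eq_iff c0)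
  then have "y = quot_pt l \<gamma> (t, sin \<phi> * pi / 2)" unfolding quot_pt_eq[OF tI] yt by simp
  ultimately show ?thesis using \<sigma> by blast
qed

text \<open>On the quotient the first integral agrees with its sum with any multiple of
  \<open>|a|\<^sup>2 - G z\<close>; for the multiplier below the differential of the sum vanishes.\<close>

lemma Crit_superset:
  assumes m: "0 < m" and \<sigma>: "\<sigma> \<in> {-1, 1}" and t: "t \<in> Crit_pm \<sigma> m l \<gamma>"
  shows "quot_pt l \<gamma> (t, \<sigma> * pi / 2) \<in> Crit m l \<gamma>"
proof -
  have tI: "t \<in> {0<..<l}" by (rule Crit_pm_interior[OF m \<sigma> t])
  then have tm: "t \<in> {0..l}" by simp
  define y where "y = (\<i> * of_real (\<sigma> * \<gamma> t), Gam \<gamma> t)"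
  have qy: "quot_pt l \<gamma> (t, \<sigma> * pi / 2) = y"
    unfolding quot_pt_eq[OF tI] cis_sign_pi_half[OF \<sigma>] y_def by simp
  have yN: "y \<in> quot_bundle l \<gamma>"
    using polar_mem[OF tm, of "\<sigma> * pi / 2"] unfolding quot_pt_eq[OF tI, symmetric] qy .
  have z: "Gam \<gamma> t \<in> {-1<..<1}" by (rule Gam_mem_open[OF tI])
  have ss: "\<sigma> * \<sigma> = 1" using \<sigma> by auto
  have pos: "0 < \<gamma> t" by (rule \<gamma>_pos[OF tI])
  have eq: "m * d\<gamma> t = \<sigma> * \<gamma> t"
  proof -
    have "\<sigma> * (\<sigma> * m * d\<gamma> t) = \<sigma> * \<gamma> t" using t by (simp add: Crit_pm_iff)
    moreover have "\<sigma> * (\<sigma> * m * d\<gamma> t) = (\<sigma> * \<sigma>) * (m * d\<gamma> t)" by simp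
    ultimately show ?thesis unfolding ss by simp
  qed
  \<comment> \<open>The Lagrange multiplier, fixed by the coefficient of \<open>Im (fst v)\<close>;
    by the critical point equation \<open>eq\<close> it also cancels the coefficient of
    \<open>snd v\<close>.\<close>
  define k where "k = m / (2 * (\<sigma> * \<gamma> t))"
  have k1: "k * (2 * (\<sigma> * \<gamma> t)) = m" using pos \<sigma> by (auto simp: k_def)
  have k2: "k * (2 * d\<gamma> t) = 1"
  proof -
    have "k * (2 * d\<gamma> t) = (m * d\<gamma> t) / (\<sigma> * \<gamma> t)" by (simp add: k_def)
    then show ?thesis unfolding eq using pos \<sigma> by auto
  qed
  have "(G has_real_derivative 2 * d\<gamma> t) (at (Gam \<gamma> t))"
    using G_deriv[of "Gam \<gamma> t"] at_within_Icc_at[of "-1" "Gam \<gamma> t" 1] z g_Gam[OF tm] by simp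
  then have "(G has_real_derivative 2 * d\<gamma> t) (at (snd y))" by (simp add: y_def)
  from DERIV_compose_FDERIV[OF this has_derivative_snd[OF has_derivative_ident]]
  have dG: "((\<lambda>y. G (snd y)) has_derivative (\<lambda>v. snd v * (2 * d\<gamma> t))) (at y within quot_bundle l \<gamma>)" .
  have dIm: "((\<lambda>y. Im (fst y)) has_derivative (\<lambda>v. Im (fst v))) (at y within quot_bundle l \<gamma>)"
    and dRe: "((\<lambda>y. Re (fst y)) has_derivative (\<lambda>v. Re (fst v))) (at y within quot_bundle l \<gamma>)"
    by (intro bounded_linear.has_derivative[OF bounded_linear_Im] bounded_linear.has_derivative[OF bounded_linear_Re]
        has_derivative_fst has_derivative_ident)+
  have "((\<lambda>y. (m * Im (fst y) - snd y) - k * ((Re (fst y) * Re (fst y) + Im (fst y) * Im (fst y)) - G (snd y)))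
      has_derivative (\<lambda>v. (m * Im (fst v) - snd v) - k * ((Re (fst y) * Re (fst v) + Re (fst v) * Re (fst y) +
        (Im (fst y) * Im (fst v) + Im (fst v) * Im (fst y))) - snd v * (2 * d\<gamma> t)))) (at y within quot_bundle l \<gamma>)"
    by (intro has_derivative_diff has_derivative_mult_right has_derivative_add has_derivative_mult dG dIm dRe
        has_derivative_snd has_derivative_ident)
  moreover have "(m * Im (fst v) - snd v) - k * ((Re (fst y) * Re (fst v) + Re (fst v) * Re (fst y) +
        (Im (fst y) * Im (fst v) + Im (fst v) * Im (fst y))) - snd v * (2 * d\<gamma> t)) = 0" for v :: space3
  proof -
    have y12: "Re (fst y) = 0" "Im (fst y) = \<sigma> * \<gamma> t" by (simp_all add: y_def)
    have "(m * Im (fst v) - snd v) - k * ((Re (fst y) * Re (fst v) + Re (fst v) * Re (fst y) +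
        (Im (fst y) * Im (fst v) + Im (fst v) * Im (fst y))) - snd v * (2 * d\<gamma> t)) =
      (m - k * (2 * (\<sigma> * \<gamma> t))) * Im (fst v) - (1 - k * (2 * d\<gamma> t)) * snd v"
      unfolding y12 by (simp add: algebra_simps)
    then show ?thesis unfolding k1 k2 by simp
  qed
  ultimately have d: "((\<lambda>y. (m * Im (fst y) - snd y) - k * ((Re (fst y) * Re (fst y) + Im (fst y) * Im (fst y)) - G (snd y)))
      has_derivative (\<lambda>_. 0)) (at y within quot_bundle l \<gamma>)" by simp
  have "(first_integral m has_derivative (\<lambda>_. 0)) (at y within quot_bundle l \<gamma>)"
  proof (rule has_derivative_transform[OF yN _ d])
    fix x assume "x \<in> quot_bundle l \<gamma>"
    then have "Re (fst x) * Re (fst x) + Im (fst x) * Im (fst x) = G (snd x)"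
      by (auto simp: quot_bundle_eq cmod_power2 power2_eq_square[symmetric])
    then show "first_integral m x = (m * Im (fst x) - snd x) - k * ((Re (fst x) * Re (fst x) + Im (fst x) * Im (fst x)) - G (snd x))"
      by (simp add: first_integral_eq)
  qed
  then show ?thesis unfolding qy Crit_def critical_points_def using yN by simp
qed

lemma Crit_eq:
  assumes m: "0 < m"
  shows "Crit m l \<gamma> = quot_pt l \<gamma> ` (Crit_pm (-1) m l \<gamma> \<times> {- pi / 2} \<union> Crit_pm 1 m l \<gamma> \<times> {pi / 2})"
proof
  show "Crit m l \<gamma> \<subseteq> quot_pt l \<gamma> ` (Crit_pm (-1) m l \<gamma> \<times> {- pi / 2} \<union> Crit_pm 1 m l \<gamma> \<times> {pi / 2})"
  proof
    fix y assume "y \<in> Crit m l \<gamma>"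
    from Crit_subset[OF m this] obtain \<sigma> t where "\<sigma> \<in> {-1, 1}" "t \<in> Crit_pm \<sigma> m l \<gamma>"
      "y = quot_pt l \<gamma> (t, \<sigma> * pi / 2)" by blast
    then show "y \<in> quot_pt l \<gamma> ` (Crit_pm (-1) m l \<gamma> \<times> {- pi / 2} \<union> Crit_pm 1 m l \<gamma> \<times> {pi / 2})" by auto
  qed
  show "quot_pt l \<gamma> ` (Crit_pm (-1) m l \<gamma> \<times> {- pi / 2} \<union> Crit_pm 1 m l \<gamma> \<times> {pi / 2}) \<subseteq> Crit m l \<gamma>"
    using Crit_superset[OF m, of "-1"] Crit_superset[OF m, of 1] by auto
qed

section \<open>Orbits over latitudes\<close>

lemma bundle_circle_eq: "t \<in> {0<..<l} \<Longrightarrow> bundle_circle l \<gamma> t \<phi> = range (bpt t \<phi>)"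
  unfolding bundle_circle_def by (auto simp: bundle_pt_bpt)

text \<open>At \<phi> = \<sigma> pi/2 the critical point equation cancels the \<phi>-component of
  the field, leaving \<sigma> m/\<gamma> times the rotation. The parametrization \<theta> = \<sigma>
  b makes the factor positive.\<close>

lemma closed_orbit_circle:
  assumes m: "0 < m" and \<sigma>: "\<sigma> \<in> {-1, 1}" and t: "t \<in> Crit_pm \<sigma> m l \<gamma>"
  shows "closed_orbit (unit_bundle l \<gamma>) (magnetic_field m l \<gamma>) (bundle_circle l \<gamma> t (\<sigma> * pi / 2))"
proof -
  have tI: "t \<in> {0<..<l}" by (rule Crit_pm_interior[OF m \<sigma> t])
  have pos: "0 < \<gamma> t" by (rule \<gamma>_pos[OF tI])
  have eq: "\<sigma> * m * d\<gamma> t = \<gamma> t" using t by (simp add: Crit_pm_iff)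
  have ss: "\<sigma> * \<sigma> = 1" using \<sigma> by auto
  obtain k :: int where k: "\<sigma> = of_int k" using \<sigma> by (metis empty_iff insert_iff of_int_1 of_int_minus)
  define D where "D = d\<gamma> t"
  have \<gamma>D: "\<gamma> t = \<sigma> * m * D" by (simp add: D_def eq)
  let ?\<phi> = "\<sigma> * pi / 2"
  note cs = cos_sin_sign_pi_half[OF \<sigma>]
  have "closed_orbit (unit_bundle l \<gamma>) (magnetic_field m l \<gamma>) (range (\<lambda>b. bpt t ?\<phi> (\<sigma> * b)))"
  proof (rule closed_orbit_reparametrize[where \<rho> = "\<lambda>_. m / \<gamma> t"])
    fix b :: real
    have "((\<lambda>b. \<sigma> * b) has_vector_derivative \<sigma>) (at b)"
      unfolding has_real_derivative_iff_has_vector_derivative[symmetric] by (auto intro!: derivative_eq_intros)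
    from vector_diff_chain_at[OF this bpt_deriv_theta]
    show "((\<lambda>b. bpt t ?\<phi> (\<sigma> * b)) has_vector_derivative
        \<sigma> *\<^sub>R ((\<gamma> t * (\<i> * cis (\<sigma> * b)), 0), (Complex (cos ?\<phi> * d\<gamma> t) (sin ?\<phi>) * (\<i> * cis (\<sigma> * b)), 0))) (at b)"
      by (simp add: o_def)
    show "0 < m / \<gamma> t" using m pos by simp
    show "bpt t ?\<phi> (\<sigma> * b) \<in> unit_bundle l \<gamma>" using bpt_mem[OF tI] regular_subset by blast
    have "cis (\<sigma> * (b + 2 * pi)) = cis (\<sigma> * b)"
      unfolding cis_eq_iff_int by (rule exI[of _ "- k"]) (simp add: k algebra_simps)
    then show "bpt t ?\<phi> (\<sigma> * (b + 2 * pi)) = bpt t ?\<phi> (\<sigma> * b)" by (simp add: bpt_def)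
    have D2: "m * D * D = \<sigma> * D * \<gamma> t"
    proof -
      have "\<sigma> * D * \<gamma> t = (\<sigma> * \<sigma>) * (m * D * D)" unfolding \<gamma>D by simp
      then show ?thesis unfolding ss mult_1 by (rule sym)
    qed
    have 1: "m * (0 - (1 - D\<^sup>2) / \<gamma> t * 1) - \<sigma> * D = - (m / \<gamma> t)"
    proof -
      have "m * (0 - (1 - D\<^sup>2) / \<gamma> t * 1) - \<sigma> * D = - (m / \<gamma> t) + ((m * D * D) / \<gamma> t - \<sigma> * D)"
        by (simp add: power2_eq_square diff_divide_distrib algebra_simps)
      then show ?thesis unfolding D2 using pos by simp
    qed
    have 2: "m * D - \<sigma> * \<gamma> t = 0"
    proof -
      have "\<sigma> * \<gamma> t = (\<sigma> * \<sigma>) * (m * D)" unfolding \<gamma>D by simp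
      then show ?thesis unfolding ss by simp
    qed
    have s2: "(sin ?\<phi>)\<^sup>2 = 1" "(cos ?\<phi>)\<^sup>2 = 0" using ss unfolding cs power2_eq_square by simp_all
    have e: "magnetic_field m l \<gamma> (bpt t ?\<phi> (\<sigma> * b)) =
        ((m * (Complex 0 \<sigma> * cis (\<sigma> * b)), 0), (Complex (- (m / \<gamma> t)) 0 * cis (\<sigma> * b), 0))"
      unfolding magnetic_field_bpt[OF tI] s2 unfolding cs D_def[symmetric] using 1 2 by simp
    have "m / \<gamma> t * \<sigma> * \<gamma> t = m * \<sigma>" "(m / \<gamma> t * \<sigma>) * \<sigma> = m / \<gamma> t"
      using pos ss by (simp_all add: mult.assoc)
    then show "magnetic_field m l \<gamma> (bpt t ?\<phi> (\<sigma> * b)) = (m / \<gamma> t) *\<^sub>R \<sigma> *\<^sub>R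
        ((\<gamma> t * (\<i> * cis (\<sigma> * b)), 0), (Complex (cos ?\<phi> * d\<gamma> t) (sin ?\<phi>) * (\<i> * cis (\<sigma> * b)), 0))"
      unfolding e cs using pos ss by (auto simp: complex_eq_iff)
  next
    fix b b' assume "bpt t ?\<phi> (\<sigma> * b) = bpt t ?\<phi> (\<sigma> * b')"
    from bpt_eqD(2)[OF tI tI this] obtain n :: int where n: "\<sigma> * b = \<sigma> * b' + 2 * pi * n"
      unfolding cis_eq_iff_int by blast
    have "b' = b + 2 * pi * of_int (- (k * n))" using n \<sigma> k by auto
    then show "\<exists>n::int. b' = b + 2 * pi * n" by blast
  qed (auto intro: continuous_on_const)
  moreover have "range (\<lambda>b. bpt t ?\<phi> (\<sigma> * b)) = range (bpt t ?\<phi>)"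
  proof
    show "range (bpt t ?\<phi>) \<subseteq> range (\<lambda>b. bpt t ?\<phi> (\<sigma> * b))"
    proof (rule image_subsetI)
      fix b show "bpt t ?\<phi> b \<in> range (\<lambda>b. bpt t ?\<phi> (\<sigma> * b))"
        by (rule range_eqI[of _ _ "\<sigma> * b"]) (simp add: mult.assoc[symmetric] ss)
    qed
  qed blast
  ultimately show ?thesis unfolding bundle_circle_eq[OF tI] by simp
qed

text \<open>The height is constant along the orbit. Its derivative, m times the height component of
  the vector, gives cos \<phi> = 0; the derivative of that component gives \<gamma> sin \<phi> = m
  \<gamma>', which is the critical point equation.\<close>

lemma latitude_orbit:
  assumes m: "0 < m" and L: "closed_orbit (unit_bundle l \<gamma>) (magnetic_field m l \<gamma>) L"
    and t: "t \<in> {0<..<l}" and lat: "fst ` L = latitude \<gamma> t"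
  shows "\<exists>\<sigma>\<in>{-1, 1}. t \<in> Crit_pm \<sigma> m l \<gamma> \<and> L = bundle_circle l \<gamma> t (\<sigma> * pi / 2)"
proof -
  have tm: "t \<in> {0..l}" and pos: "0 < \<gamma> t" using t \<gamma>_pos[OF t] by auto
  obtain c where c: "integral_curve (unit_bundle l \<gamma>) (magnetic_field m l \<gamma>) UNIV c" "L = range c"
    using L unfolding closed_orbit_def by blast
  have mem: "c s \<in> unit_bundle l \<gamma>" and der: "(c has_vector_derivative magnetic_field m l \<gamma> (c s)) (at s)" for s
    using c(1) unfolding integral_curve_def by auto
  have h: "snd (fst (c s)) = Gam \<gamma> t" for s
  proof -
    have "fst (c s) \<in> latitude \<gamma> t" using lat c(2) by blast
    then show ?thesis by (auto simp: latitude_def surf_pt_def)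
  qed
  have form: "\<exists>a. magnetic_field m l \<gamma> (c s) = (m *\<^sub>R snd (c s), (a, m * d\<gamma> t - Im (cnj (fst (fst (c s))) * fst (snd (c s)))))" for s
    using magnetic_field_form[OF mem[of s], of m] h[of s] g_Gam[OF tm] by metis
  have w: "snd (snd (c s)) = 0" for s
  proof -
    have "((\<lambda>s. snd (fst (c s))) has_vector_derivative snd (fst (magnetic_field m l \<gamma> (c s)))) (at s)"
      by (intro bounded_linear.has_vector_derivative[OF bounded_linear_snd] bounded_linear.has_vector_derivative[OF bounded_linear_fst] der)
    then have "((\<lambda>s. Gam \<gamma> t) has_vector_derivative snd (fst (magnetic_field m l \<gamma> (c s)))) (at s)" unfolding h .
    then have "snd (fst (magnetic_field m l \<gamma> (c s))) = 0"
      by (rule vector_derivative_unique_at) (rule has_vector_derivative_const)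
    then show ?thesis using form[of s] m by auto
  qed
  have Im: "Im (cnj (fst (fst (c s))) * fst (snd (c s))) = m * d\<gamma> t" for s
  proof -
    have "((\<lambda>s. snd (snd (c s))) has_vector_derivative snd (snd (magnetic_field m l \<gamma> (c s)))) (at s)"
      by (intro bounded_linear.has_vector_derivative[OF bounded_linear_snd] der)
    then have "((\<lambda>s. 0) has_vector_derivative snd (snd (magnetic_field m l \<gamma> (c s)))) (at s)" unfolding w .
    then have "snd (snd (magnetic_field m l \<gamma> (c s))) = 0"
      by (rule vector_derivative_unique_at) (rule has_vector_derivative_const)
    then show ?thesis using form[of s] by auto
  qed
  have pt: "\<exists>\<phi> \<theta>. c s = bpt t \<phi> \<theta> \<and> cos \<phi> = 0 \<and> \<gamma> t * sin \<phi> = m * d\<gamma> t" for s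
    using mem[of s]
  proof (cases rule: unit_bundle_cases)
    case (reg t' \<phi> \<theta>)
    have t': "t' = t" using h[of s] Gam_eq_iff[OF np, of t' t] reg(1,2) tm by (simp add: bpt_height)
    have "cos \<phi> = 0" using w[of s] pos unfolding reg(2) t' by (simp add: bpt_def)
    moreover have "\<gamma> t * sin \<phi> = m * d\<gamma> t"
      using Im[of s] unfolding reg(2) t' unfolding bpt_def fst_conv snd_conv bpt_Im .
    ultimately show ?thesis using reg(2) t' by blast
  next
    case (pole t' \<theta>)
    have "t' = t" using h[of s] Gam_eq_iff[OF np, of t' t] pole(1,2) tm l_pos by auto
    then show ?thesis using pole(1) t by auto
  qed
  \<comment> \<open>The value of sin \<phi> prescribed by the second derivative of the height, the
    same at all points of the orbit.\<close>
  define \<sigma> where "\<sigma> = m * d\<gamma> t / \<gamma> t"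
  have sin: "sin \<phi> = \<sigma>" if "\<gamma> t * sin \<phi> = m * d\<gamma> t" for \<phi>
    unfolding \<sigma>_def that[symmetric] using pos by simp
  have \<sigma>: "\<sigma> \<in> {-1, 1}"
  proof -
    obtain \<phi> where "cos \<phi> = 0" "\<gamma> t * sin \<phi> = m * d\<gamma> t" using pt[of 0] by blast
    then have "sin \<phi> = \<sigma>" "(sin \<phi>)\<^sup>2 = 1" using sin sin_cos_squared_add[of \<phi>] by simp_all
    then show ?thesis by (auto simp: power2_eq_1_iff)
  qed
  note cs = cos_sin_sign_pi_half[OF \<sigma>]
  have pt': "\<exists>\<theta>. c s = bpt t (\<sigma> * pi / 2) \<theta>" for s
  proof -
    obtain \<phi> \<theta> where *: "c s = bpt t \<phi> \<theta>" "cos \<phi> = 0" "\<gamma> t * sin \<phi> = m * d\<gamma> t" using pt[of s] by blast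
    have "c s = bpt t (\<sigma> * pi / 2) \<theta>" unfolding *(1) bpt_def cs *(2) sin[OF *(3)] ..
    then show ?thesis by blast
  qed
  have "\<sigma> * m * d\<gamma> t = \<gamma> t"
  proof -
    have "m * d\<gamma> t = \<sigma> * \<gamma> t" using pos by (simp add: \<sigma>_def)
    then have "\<sigma> * m * d\<gamma> t = (\<sigma> * \<sigma>) * \<gamma> t" by (simp add: mult.assoc)
    then show ?thesis using \<sigma> by auto
  qed
  then have "t \<in> Crit_pm \<sigma> m l \<gamma>" using tm by (simp add: Crit_pm_iff)
  moreover have "L = bundle_circle l \<gamma> t (\<sigma> * pi / 2)"
    unfolding bundle_circle_eq[OF t] c(2)
  proof
    show "range c \<subseteq> range (bpt t (\<sigma> * pi / 2))" using pt' by blast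
    \<comment> \<open>The projection covers the whole latitude by hypothesis, and a point of the
      circle is determined by its foot point.\<close>
    show "range (bpt t (\<sigma> * pi / 2)) \<subseteq> range c"
    proof (rule image_subsetI)
      fix \<theta>
      have "surf_pt \<gamma> t \<theta> \<in> fst ` L" unfolding lat latitude_def by blast
      then obtain s where s: "fst (c s) = surf_pt \<gamma> t \<theta>" unfolding c(2) by force
      obtain \<theta>' where \<theta>': "c s = bpt t (\<sigma> * pi / 2) \<theta>'" using pt'[of s] by blast
      have "cis \<theta>' = cis \<theta>" using s pos unfolding \<theta>' by (simp add: bpt_def surf_pt_def)
      then have "c s = bpt t (\<sigma> * pi / 2) \<theta>" unfolding \<theta>' by (simp add: bpt_def)
      then show "bpt t (\<sigma> * pi / 2) \<theta> \<in> range c" by (metis rangeI)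
    qed
  qed
  ultimately show ?thesis using \<sigma> by blast
qed

lemma fst_bundle_circle: "fst ` bundle_circle l \<gamma> t \<phi> = latitude \<gamma> t"
proof -
  have "bundle_circle l \<gamma> t \<phi> = range (\<lambda>\<theta>. bundle_pt l \<gamma> t \<phi> \<theta>)" "latitude \<gamma> t = range (surf_pt \<gamma> t)"
    unfolding bundle_circle_def latitude_def by blast+
  then show ?thesis by (simp add: image_image bundle_pt_def)
qed

end

section \<open>Uniqueness of critical points under positive magnetic curvature\<close>

context magnetic
begin

text \<open>The function f is the derivative of \<sigma> times the boundary integral. The
  integrating factor exp(\<sigma> t/m) turns its derivative into a positive multiple of m \<gamma>''
  - \<gamma>/m, which is negative because the magnetic curvature is positive. So f runs from m to -m
  with a single sign change. The factor \<sigma> in the conclusion treats the maximum for + and the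
  minimum for - together.\<close>

lemma Crit_pm_unique:
  assumes \<sigma>: "\<sigma> \<in> {-1, 1}"
  obtains s where "s \<in> {0<..<l}" "Crit_pm \<sigma> m l \<gamma> = {s}"
    "\<And>t. t \<in> {0..l} - {s} \<Longrightarrow> \<sigma> * integral_pm \<sigma> m \<gamma> t < \<sigma> * integral_pm \<sigma> m \<gamma> s"
proof -
  have ss: "\<sigma> * \<sigma> = 1" using \<sigma> by auto
  define f where "f = (\<lambda>t. m * d\<gamma> t - \<sigma> * \<gamma> t)"
  define F where "F = (\<lambda>t. exp (\<sigma> / m * t) * f t)"
  have contf: "continuous_on {0..l} f"
    unfolding f_def by (intro continuous_on_diff continuous_on_mult continuous_on_const cont_\<gamma> cont_d\<gamma>)
  have contF: "continuous_on {0..l} F"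
    unfolding F_def by (intro continuous_on_mult continuous_on_exp continuous_on_const continuous_on_id contf)
  have dF: "(F has_real_derivative exp (\<sigma> / m * t) * (m * profile_deriv l \<gamma> 2 t - \<gamma> t / m)) (at t)"
    if t: "t \<in> {0<..<l}" for t
  proof -
    have 1: "(f has_real_derivative m * profile_deriv l \<gamma> 2 t - \<sigma> * d\<gamma> t) (at t)"
      unfolding f_def by (intro DERIV_diff DERIV_cmult \<gamma>_deriv_at d\<gamma>_deriv_at t)
    have 2: "((\<lambda>t. exp (\<sigma> / m * t)) has_real_derivative exp (\<sigma> / m * t) * (\<sigma> / m)) (at t)"
      using DERIV_chain2[OF DERIV_exp DERIV_cmult[OF DERIV_ident, of "\<sigma> / m"]] by simp
    have 3: "\<sigma> / m * f t = \<sigma> * d\<gamma> t - \<gamma> t / m"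
    proof -
      have "\<sigma> / m * f t = \<sigma> * d\<gamma> t - (\<sigma> * \<sigma>) * \<gamma> t / m"
        using less_imp_neq[OF m_pos] by (simp add: f_def right_diff_distrib)
      then show ?thesis unfolding ss mult_1 .
    qed
    have "exp (\<sigma> / m * t) * (\<sigma> / m) * f t + (m * profile_deriv l \<gamma> 2 t - \<sigma> * d\<gamma> t) * exp (\<sigma> / m * t) =
        exp (\<sigma> / m * t) * (\<sigma> / m * f t + (m * profile_deriv l \<gamma> 2 t - \<sigma> * d\<gamma> t))"
      by (simp add: distrib_left mult_ac del: profile_deriv.simps)
    then have eq: "exp (\<sigma> / m * t) * (\<sigma> / m) * f t + (m * profile_deriv l \<gamma> 2 t - \<sigma> * d\<gamma> t) * exp (\<sigma> / m * t) =
        exp (\<sigma> / m * t) * (m * profile_deriv l \<gamma> 2 t - \<gamma> t / m)"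
      unfolding 3 by (simp del: profile_deriv.simps)
    show ?thesis unfolding F_def using DERIV_mult[OF 2 1] unfolding eq .
  qed
  have neg: "m * profile_deriv l \<gamma> 2 t - \<gamma> t / m < 0" if t: "t \<in> {0<..<l}" for t
  proof -
    have "m * profile_deriv l \<gamma> 2 t * m < \<gamma> t"
      using slope_bound[OF t] by (simp add: power2_eq_square mult_ac del: profile_deriv.simps)
    then show ?thesis using m_pos by (simp add: pos_less_divide_eq del: profile_deriv.simps)
  qed
  have dec: "F t' < F t" if "t \<in> {0..l}" "t' \<in> {0..l}" "t < t'" for t t'
  proof (rule DERIV_neg_imp_decreasing_open[OF that(3)])
    fix u assume "t < u" "u < t'"
    with that have u: "u \<in> {0<..<l}" by simp
    have "exp (\<sigma> / m * u) * (m * profile_deriv l \<gamma> 2 u - \<gamma> u / m) < 0"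
      by (rule mult_pos_neg[OF exp_gt_zero neg[OF u]])
    with dF[OF u] show "\<exists>y. (F has_real_derivative y) (at u) \<and> y < 0" by (intro exI conjI)
  next
    show "continuous_on {t..t'} F" by (rule continuous_on_subset[OF contF]) (use that in auto)
  qed
  have f_ends: "f 0 = m" "f l = - m" by (simp_all add: f_def d\<gamma>_ends \<gamma>_ends)
  obtain s where s: "0 \<le> s" "s \<le> l" "f s = 0"
    using IVT2'[of f l 0 0] contf m_pos l_pos f_ends by auto
  have sI: "s \<in> {0<..<l}"
    using s f_ends m_pos by (cases "s = 0 \<or> s = l") auto
  have Fs: "F s = 0" by (simp add: F_def s(3))
  have sgn: "0 < f t \<longleftrightarrow> t < s" "f t < 0 \<longleftrightarrow> s < t" if t: "t \<in> {0..l}" for t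
  proof -
    have "t < s \<Longrightarrow> 0 < F t" "s < t \<Longrightarrow> F t < 0" "t = s \<Longrightarrow> F t = 0"
      using dec[of t s] dec[of s t] t s Fs by auto
    then have "t < s \<Longrightarrow> 0 < f t" "s < t \<Longrightarrow> f t < 0" "t = s \<Longrightarrow> f t = 0"
      using s(3) by (auto simp: F_def zero_less_mult_iff mult_less_0_iff)
    then show "0 < f t \<longleftrightarrow> t < s" "f t < 0 \<longleftrightarrow> s < t" by (cases t s rule: linorder_cases; simp)+
  qed
  have f0: "f t = 0 \<longleftrightarrow> t = s" if "t \<in> {0..l}" for t
    using sgn[OF that] s(3) by (cases t s rule: linorder_cases) auto
  have crit: "\<sigma> * m * d\<gamma> t = \<gamma> t \<longleftrightarrow> f t = 0" for t
    using \<sigma> by (auto simp: f_def)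
  have "Crit_pm \<sigma> m l \<gamma> = {s}"
  proof (rule set_eqI)
    show "t \<in> Crit_pm \<sigma> m l \<gamma> \<longleftrightarrow> t \<in> {s}" for t
      unfolding Crit_pm_iff crit using f0 s by auto
  qed
  moreover have "\<sigma> * integral_pm \<sigma> m \<gamma> t < \<sigma> * integral_pm \<sigma> m \<gamma> s" if t: "t \<in> {0..l} - {s}" for t
  proof -
    let ?I = "\<lambda>t. \<sigma> * integral_pm \<sigma> m \<gamma> t"
    have dI: "(?I has_real_derivative f t) (at t)" if u: "t \<in> {0<..<l}" for t
    proof -
      have "(integral_pm \<sigma> m \<gamma> has_real_derivative \<sigma> * m * d\<gamma> t - \<gamma> t) (at t)"
        using integral_pm_deriv[of t \<sigma> m] at_within_Icc_at[of 0 t l] u by simp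
      from DERIV_cmult[OF this, of \<sigma>]
      have "(?I has_real_derivative \<sigma> * (\<sigma> * m * d\<gamma> t - \<gamma> t)) (at t)" .
      moreover have "\<sigma> * (\<sigma> * m * d\<gamma> t - \<gamma> t) = (\<sigma> * \<sigma>) * (m * d\<gamma> t) - \<sigma> * \<gamma> t"
        by (simp add: right_diff_distrib)
      ultimately show ?thesis unfolding ss by (simp add: f_def)
    qed
    have cI: "continuous_on {0..l} ?I"
      using integral_pm_deriv by (intro continuous_on_mult continuous_on_const) (meson DERIV_continuous continuous_on_eq_continuous_within)
    show ?thesis
    proof (cases "t < s")
      case True
      show ?thesis
      proof (rule DERIV_pos_imp_increasing_open[OF True])
        fix u assume "t < u" "u < s"
        then have u: "u \<in> {0<..<l}" using s t by auto
        then show "\<exists>y. (?I has_real_derivative y) (at u) \<and> 0 < y"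
          using dI[OF u] sgn(1)[of u] \<open>u < s\<close> by (intro exI[of _ "f u"]) auto
      next
        show "continuous_on {t..s} ?I" by (rule continuous_on_subset[OF cI]) (use s t in auto)
      qed
    next
      case False
      then have gt: "s < t" using t by auto
      show ?thesis
      proof (rule DERIV_neg_imp_decreasing_open[OF gt])
        fix u assume "s < u" "u < t"
        then have u: "u \<in> {0<..<l}" using s t by auto
        then show "\<exists>y. (?I has_real_derivative y) (at u) \<and> y < 0"
          using dI[OF u] sgn(2)[of u] \<open>s < u\<close> by (intro exI[of _ "f u"]) auto
      next
        show "continuous_on {s..t} ?I" by (rule continuous_on_subset[OF cI]) (use s t in auto)
      qed
    qed
  qed
  ultimately show thesis using sI that by blast
qed

end

section \<open>Foliations by level sets\<close>

text \<open>A chart whose transverse coordinate is the value of I meets each level set in the single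
  plaque over that value, or in none; the countable set of the definition has at most one
  element.\<close>

lemma foliation_level_sets:
  fixes M W :: "'e::euclidean_space set" and I :: "'e \<Rightarrow> real"
  assumes W: "W = {x \<in> M. I x \<in> C}"
    and conn: "\<And>c. c \<in> C \<Longrightarrow> connected {x \<in> M. I x = c} \<and> {x \<in> M. I x = c} \<noteq> {}"
    and chart: "\<And>x. x \<in> W \<Longrightarrow> \<exists>(A::'a::euclidean_space set) (B::real set) \<psi> U. x \<in> U \<and>
      openin (top_of_set W) U \<and> connected A \<and> regular_param (A \<times> B) \<psi> U \<and> (\<forall>a\<in>A. \<forall>b\<in>B. I (\<psi> (a, b)) = b)"
  shows "foliation TYPE('a) TYPE(real) W ((\<lambda>c. {x \<in> M. I x = c}) ` C)"
  unfolding foliation_def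
proof (intro conjI ballI)
  show "\<Union> ((\<lambda>c. {x \<in> M. I x = c}) ` C) = W" using W by blast
  show "disjoint ((\<lambda>c. {x \<in> M. I x = c}) ` C)" by (rule disjointI) auto
  fix L assume "L \<in> (\<lambda>c. {x \<in> M. I x = c}) ` C"
  then obtain c where "c \<in> C" "L = {x \<in> M. I x = c}" by blast
  with conn show "L \<noteq> {}" "connected L" by blast+
next
  fix x assume "x \<in> W"
  from chart[OF this] obtain A :: "'a set" and B :: "real set" and \<psi> U where *: "x \<in> U"
    "openin (top_of_set W) U" "connected A" "regular_param (A \<times> B) \<psi> U" "\<forall>a\<in>A. \<forall>b\<in>B. I (\<psi> (a, b)) = b" by blast
  have U: "U = \<psi> ` (A \<times> B)"
    using *(4) unfolding regular_param_def homeomorphism_def by blast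
  have UM: "U \<subseteq> M" using openin_imp_subset[OF *(2)] W by blast
  have "\<exists>T. countable T \<and> T \<subseteq> B \<and> L \<inter> U = \<psi> ` (A \<times> T)" if LC: "L \<in> (\<lambda>c. {x \<in> M. I x = c}) ` C" for L
  proof -
    obtain c where L: "L = {x \<in> M. I x = c}" using LC by blast
    have "L \<inter> U = \<psi> ` (A \<times> ({c} \<inter> B))"
      using UM *(5) unfolding L U by force
    then show ?thesis by (intro exI[of _ "{c} \<inter> B"]) auto
  qed
  then show "\<exists>(A::'a set) (B::real set) \<psi> U. x \<in> U \<and> openin (top_of_set W) U \<and> connected A \<and>
      regular_param (A \<times> B) \<psi> U \<and> (\<forall>L\<in>(\<lambda>c. {x \<in> M. I x = c}) ` C. \<exists>T. countable T \<and> T \<subseteq> B \<and> L \<inter> U = \<psi> ` (A \<times> T))"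
    by - (rule exI[of _ A], rule exI[of _ B], rule exI[of _ \<psi>], rule exI[of _ U], intro conjI ballI *(1-4))
qed

lemma Arg_of_real_cis: "0 < r \<Longrightarrow> - pi < x \<Longrightarrow> x < pi \<Longrightarrow> Arg (of_real r * cis x) = x"
  by (rule Arg_unique[of r]) (simp_all add: cis_conv_exp)

lemma of_real_cis_notin_nonpos:
  assumes "0 < r" "- pi < x" "x < pi"
  shows "of_real r * cis x \<notin> \<real>\<^sub>\<le>\<^sub>0"
proof
  assume "of_real r * cis x \<in> \<real>\<^sub>\<le>\<^sub>0"
  then have s: "sin x = 0" "cos x \<le> 0"
    using assms(1) by (simp_all add: complex_nonpos_Reals_iff mult_le_0_iff)
  have "\<not> 0 < x" using sin_gt_zero[of x] assms(3) s(1) by auto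
  moreover have "\<not> x < 0"
  proof
    assume "x < 0"
    then have "0 < sin (- x)" by (intro sin_gt_zero) (use assms(2) in simp_all)
    then show False using s(1) by simp
  qed
  ultimately have "x = 0" by simp
  then show False using s(2) by simp
qed

lemma of_real_cis_Arg: "w \<noteq> 0 \<Longrightarrow> of_real (cmod w) * cis (Arg w) = w"
  using rcis_cmod_Arg[of w] by (simp add: rcis_def)

lemma Arg_bounds_open: "w \<notin> \<real>\<^sub>\<le>\<^sub>0 \<Longrightarrow> - pi < Arg w \<and> Arg w < pi"
  using Arg_bounded[of w] Arg_eq_pi_iff[of w] by (auto simp: less_le complex_nonpos_Reals_iff complex_is_Real_iff)

lemma inj_frechet_derivative:
  assumes "(f has_derivative f') (at x)" "\<And>v. f' v = 0 \<Longrightarrow> v = 0"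
  shows "inj (frechet_derivative f (at x))"
  unfolding frechet_derivative_at[OF assms(1), symmetric]
    linear_injective_0[OF has_derivative_linear[OF assms(1)]] using assms(2) by blast

lemma Ck_on_subset:
  assumes "open U" "open V" "U \<subseteq> V" "Ck_on k V f"
  shows "Ck_on k U f"
proof -
  have "0 + x \<in> V" if "x \<in> U" for x using assms(3) that by auto
  from Ck_on_affine_comp[OF assms(1,2) bounded_linear_ident this assms(4)] show ?thesis by simp
qed

section \<open>Foliated charts on the quotient\<close>

context polar_chart
begin

text \<open>The direction from the centre to the point, turned back by \<beta>0. The cut of
  \<open>Arg\<close> then lies opposite to \<beta>0, and the chart covers each oval except for one
  point.\<close>

definition lev_dir :: "real \<Rightarrow> space3 \<Rightarrow> complex" where
  "lev_dir \<beta>0 y = cis (- \<beta>0) * Complex (snd y - zs) (Re (fst y))"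

definition lev_nbhd :: "real \<Rightarrow> space3 set" where
  "lev_nbhd \<beta>0 = {y \<in> quot_bundle l \<gamma>. first_integral m y \<in> levels zs \<and> lev_dir \<beta>0 y \<notin> \<real>\<^sub>\<le>\<^sub>0}"

definition lev_coord :: "real \<Rightarrow> space3 \<Rightarrow> real \<times> real" where
  "lev_coord \<beta>0 y = (\<beta>0 + Arg (lev_dir \<beta>0 y), first_integral m y)"

lemma continuous_lev_dir: "continuous_on S (lev_dir \<beta>0)"
  unfolding lev_dir_def Complex_eq by (intro continuous_intros)

lemma continuous_first_integral: "continuous_on S (first_integral m)"
  by (rule linear_continuous_on[OF bounded_linear_first_integral])

lemma lev_dir_lev: "lev_dir \<beta>0 (lev zs (\<beta>, c)) = of_real (rad zs \<beta> c) * cis (\<beta> - \<beta>0)"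
proof -
  have "lev_dir \<beta>0 (lev zs (\<beta>, c)) = of_real (rad zs \<beta> c) * (cis (- \<beta>0) * cis \<beta>)"
    unfolding lev_dir_def lev_polar by simp
  then show ?thesis by (simp add: cis_mult)
qed

lemma openin_lev_nbhd: "openin (top_of_set (quot_bundle l \<gamma>)) (lev_nbhd \<beta>0)"
proof -
  have "continuous_on (quot_bundle l \<gamma>) (\<lambda>y. (first_integral m y, lev_dir \<beta>0 y))"
    by (intro continuous_on_Pair continuous_lev_dir continuous_first_integral)
  moreover have "open (levels zs \<times> (- \<real>\<^sub>\<le>\<^sub>0 :: complex set))"
    by (intro open_Times open_levels open_Compl closed_nonpos_Reals_complex)
  ultimately have "openin (top_of_set (quot_bundle l \<gamma>))
      (quot_bundle l \<gamma> \<inter> (\<lambda>y. (first_integral m y, lev_dir \<beta>0 y)) -` (levels zs \<times> (- \<real>\<^sub>\<le>\<^sub>0)))"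
    by (rule continuous_openin_preimage_gen)
  moreover have "quot_bundle l \<gamma> \<inter> (\<lambda>y. (first_integral m y, lev_dir \<beta>0 y)) -` (levels zs \<times> (- \<real>\<^sub>\<le>\<^sub>0)) = lev_nbhd \<beta>0"
    by (auto simp: lev_nbhd_def)
  ultimately show ?thesis by simp
qed

lemma continuous_lev_coord: "continuous_on (lev_nbhd \<beta>0) (lev_coord \<beta>0)"
proof -
  have "continuous_on (lev_nbhd \<beta>0) (\<lambda>y. Arg (lev_dir \<beta>0 y))"
    by (rule continuous_on_compose2[OF continuous_on_Arg continuous_lev_dir]) (auto simp: lev_nbhd_def)
  then show ?thesis
    unfolding lev_coord_def by (intro continuous_on_Pair continuous_on_add continuous_on_const continuous_first_integral)
qed

lemma lev_in_nbhd:
  assumes "\<beta> \<in> {\<beta>0 - pi<..<\<beta>0 + pi}" "c \<in> levels zs"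
  shows "lev zs (\<beta>, c) \<in> lev_nbhd \<beta>0" "lev_coord \<beta>0 (lev zs (\<beta>, c)) = (\<beta>, c)"
proof -
  have r: "0 < rad zs \<beta> c" "- pi < \<beta> - \<beta>0" "\<beta> - \<beta>0 < pi" using rad(1)[OF assms(2)] assms(1) by auto
  show "lev zs (\<beta>, c) \<in> lev_nbhd \<beta>0"
    unfolding lev_nbhd_def mem_Collect_eq lev_dir_lev using lev_mem[OF assms(2)] assms(2) of_real_cis_notin_nonpos[OF r] by simp
  show "lev_coord \<beta>0 (lev zs (\<beta>, c)) = (\<beta>, c)"
    unfolding lev_coord_def lev_dir_lev Arg_of_real_cis[OF r] by (simp add: lev_mem(2)[OF assms(2)])
qed

lemma lev_of_coord:
  assumes y: "y \<in> lev_nbhd \<beta>0"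
  shows "lev zs (lev_coord \<beta>0 y) = y" "lev_coord \<beta>0 y \<in> {\<beta>0 - pi<..<\<beta>0 + pi} \<times> levels zs"
proof -
  obtain a z where az: "y = (a, z)" by (metis surj_pair)
  have N: "(a, z) \<in> quot_bundle l \<gamma>" "first_integral m (a, z) \<in> levels zs" "lev_dir \<beta>0 y \<notin> \<real>\<^sub>\<le>\<^sub>0"
    using y by (simp_all add: lev_nbhd_def az)
  have nz: "lev_dir \<beta>0 y \<noteq> 0" using N(3) by auto
  have "of_real (cmod (lev_dir \<beta>0 y)) * cis (\<beta>0 + Arg (lev_dir \<beta>0 y)) = cis \<beta>0 * lev_dir \<beta>0 y"
    using of_real_cis_Arg[OF nz] by (simp add: cis_mult[symmetric] mult.left_commute)
  also have "\<dots> = Complex (z - zs) (Re a)"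
    by (simp add: lev_dir_def az mult.assoc[symmetric] cis_mult)
  finally have "lev zs (\<beta>0 + Arg (lev_dir \<beta>0 y), first_integral m (a, z)) = (a, z)"
    by (intro lev_inverse[OF N(1) refl N(2), of "cmod (lev_dir \<beta>0 y)"]) (use nz in simp_all)
  then show "lev zs (lev_coord \<beta>0 y) = y" by (simp add: lev_coord_def az)
  show "lev_coord \<beta>0 y \<in> {\<beta>0 - pi<..<\<beta>0 + pi} \<times> levels zs"
    using Arg_bounds_open[OF N(3)] N(2) by (simp add: lev_coord_def az)
qed

lemma regular_param_lev: "regular_param ({\<beta>0 - pi<..<\<beta>0 + pi} \<times> levels zs) (lev zs) (lev_nbhd \<beta>0)"
proof -
  let ?D = "{\<beta>0 - pi<..<\<beta>0 + pi} \<times> levels zs"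
  have D: "open ?D" by (intro open_Times open_levels) simp
  have U: "open ((UNIV :: real set) \<times> levels zs)" by (intro open_Times open_UNIV open_levels)
  have Ck: "Ck_on k ?D (lev zs)" for k
    by (rule Ck_on_subset[OF D U _ Ck_on_lev]) auto
  have s1: "smooth_map_on ?D (lev zs)" unfolding smooth_map_on_def using D Ck by blast
  have s2: "inj (frechet_derivative (lev zs) (at x))" if x: "x \<in> ?D" for x
  proof -
    obtain b c where bc: "x = (b, c)" "c \<in> levels zs" using x by blast
    show ?thesis unfolding bc(1) by (rule inj_frechet_derivative[OF lev_has_derivative[OF bc(2)] lev'_zero[OF bc(2)]])
  qed
  have s3: "homeomorphism ?D (lev_nbhd \<beta>0) (lev zs) (lev_coord \<beta>0)"
  proof (rule homeomorphismI)
    show "continuous_on ?D (lev zs)" using Ck[of 0] by simp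
    show "continuous_on (lev_nbhd \<beta>0) (lev_coord \<beta>0)" by (rule continuous_lev_coord)
    show "lev zs ` ?D \<subseteq> lev_nbhd \<beta>0"
    proof (rule image_subsetI)
      fix x assume "x \<in> ?D"
      then obtain b c where bc: "x = (b, c)" "b \<in> {\<beta>0 - pi<..<\<beta>0 + pi}" "c \<in> levels zs" by blast
      show "lev zs x \<in> lev_nbhd \<beta>0" unfolding bc(1) by (rule lev_in_nbhd(1)[OF bc(2,3)])
    qed
    show "lev_coord \<beta>0 ` lev_nbhd \<beta>0 \<subseteq> ?D" by (rule image_subsetI, rule lev_of_coord(2))
    fix x assume "x \<in> ?D"
    then obtain b c where bc: "x = (b, c)" "b \<in> {\<beta>0 - pi<..<\<beta>0 + pi}" "c \<in> levels zs" by blast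
    show "lev_coord \<beta>0 (lev zs x) = x" unfolding bc(1) by (rule lev_in_nbhd(2)[OF bc(2,3)])
  next
    show "lev zs (lev_coord \<beta>0 y) = y" if "y \<in> lev_nbhd \<beta>0" for y by (rule lev_of_coord(1)[OF that])
  qed
  show ?thesis
    unfolding regular_param_def by (rule conjI[OF s1], rule conjI, rule ballI, erule s2, rule exI[of _ "lev_coord \<beta>0"], rule s3)
qed

end

section \<open>Sections of the unit tangent bundle over the quotient\<close>

context profile
begin

text \<open>\<open>\<kappa>\<close> is the quotient (1 + p g)/G with its removable singularity at
  the pole of height p filled in.\<close>

definition is_cap :: "real \<Rightarrow> (real \<Rightarrow> real) \<Rightarrow> bool" where
  "is_cap p \<kappa> \<longleftrightarrow> smooth1 ({-1..1} - {- p}) \<kappa> \<and> (\<forall>z\<in>{-1..1} - {- p}. 1 + p * g z = \<kappa> z * G z)"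

definition cap :: "real \<Rightarrow> real \<Rightarrow> real" where "cap p = (SOME \<kappa>. is_cap p \<kappa>)"

lemma is_cap_cap:
  assumes "p \<in> {-1, 1}"
  shows "is_cap p (cap p)"
proof -
  obtain \<kappa> where "is_cap p \<kappa>" using ex_cap[OF assms] unfolding is_cap_def by blast
  then show ?thesis unfolding cap_def by (rule someI[of "is_cap p"])
qed

lemma cap_smooth1: "p \<in> {-1, 1} \<Longrightarrow> smooth1 ({-1..1} - {- p}) (cap p)"
  and cap_eq: "p \<in> {-1, 1} \<Longrightarrow> z \<in> {-1..1} - {- p} \<Longrightarrow> 1 + p * g z = cap p z * G z"
  using is_cap_cap[of p] unfolding is_cap_def by (simp_all only: simp_thms Ball_def)

text \<open>The section \<open>\<theta> = p \<phi>\<close>, which extends smoothly over the pole of height \<open>p\<close>.\<close>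

definition sec :: "real \<Rightarrow> space3 \<Rightarrow> space3 \<times> space3" where
  "sec p y = (let P = Complex (Re (fst y)) (p * Im (fst y)) in
     ((P, snd y), (of_real (p * (cap p (snd y) * Re (fst y))) * P - of_real p, Re (fst y))))"

lemma quot_proj_sec:
  assumes "p \<in> {-1, 1}"
  shows "quot_proj (sec p y) = y"
proof -
  define k where "k = p * (cap p (snd y) * Re (fst y))"
  define P where "P = Complex (Re (fst y)) (p * Im (fst y))"
  have s: "sec p y = ((P, snd y), (of_real k * P - of_real p, Re (fst y)))"
    by (simp add: sec_def Let_def k_def P_def)
  have "p = - 1 \<or> p = 1" using assms by blast
  then have pp: "p * p = 1" by (elim disjE) simp_all
  have "Im (cnj P * (of_real k * P - of_real p)) = p * Im P"
    by (simp add: algebra_simps)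
  also have "\<dots> = (p * p) * Im (fst y)" by (simp add: P_def)
  finally have "Im (cnj P * (of_real k * P - of_real p)) = Im (fst y)" unfolding pp by simp
  then show ?thesis unfolding s quot_proj_eq fst_conv snd_conv by (simp only: complex_surj prod.collapse)
qed

text \<open>Over (t, \<phi>) the section is \<open>bpt t \<phi> (p * \<phi>)\<close>, with P =
  \<gamma> cis (p \<phi>). The complex component of the vector equals (p + \<gamma>') cos \<phi> cis
  (p \<phi>) - p, and p + \<gamma>' = p (1 + p \<gamma>') is p \<gamma>^2 times \<open>cap\<close>;
  the two factors \<gamma> are absorbed by the coordinates of the quotient.\<close>

lemma sec_mem:
  assumes p: "p \<in> {-1, 1}" and y: "y \<in> quot_bundle l \<gamma>" "snd y \<noteq> - p"
  shows "sec p y \<in> unit_bundle l \<gamma>"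
proof -
  obtain t \<phi> where t: "t \<in> {0..l}" and yt: "y = (\<gamma> t * cis \<phi>, Gam \<gamma> t)" by (rule quot_bundleE[OF y(1)])
  have k: "cap p (Gam \<gamma> t) * (\<gamma> t)\<^sup>2 = 1 + p * d\<gamma> t"
    using cap_eq[OF p, of "Gam \<gamma> t"] y(2) Gam_mem[OF t] by (simp add: yt G_Gam[OF t] g_Gam[OF t])
  have pp: "p * p = 1" using p by auto
  show ?thesis
  proof (cases "t \<in> {0<..<l}")
    case True
    define c s where "c = cos \<phi>" "s = sin \<phi>"
    have cs: "c * c + s * s = 1" unfolding c_s_def by (rule sin_cos_squared_add3)
    have pc: "cis (p * \<phi>) = Complex c (p * s)" using p by (auto simp: c_s_def complex_eq_iff)
    have "sec p y = bpt t \<phi> (p * \<phi>)"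
    proof -
      have P: "Complex (\<gamma> t * c) (p * (\<gamma> t * s)) = of_real (\<gamma> t) * Complex c (p * s)" by (simp add: complex_eq_iff)
      have "p * (cap p (Gam \<gamma> t) * (\<gamma> t * c)) * \<gamma> t = p * (cap p (Gam \<gamma> t) * (\<gamma> t)\<^sup>2) * c"
        by (simp add: power2_eq_square)
      also have "\<dots> = (p + (p * p) * d\<gamma> t) * c" unfolding k by (simp add: algebra_simps)
      finally have q: "p * (cap p (Gam \<gamma> t) * (\<gamma> t * c)) * \<gamma> t = (p + d\<gamma> t) * c" unfolding pp by simp
      have "of_real (p * (cap p (Gam \<gamma> t) * (\<gamma> t * c))) * (of_real (\<gamma> t) * Complex c (p * s)) =
          of_real ((p + d\<gamma> t) * c) * Complex c (p * s)"
        unfolding q[symmetric] by simp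
      moreover have "of_real ((p + d\<gamma> t) * c) * Complex c (p * s) - of_real p = Complex (c * d\<gamma> t) s * Complex c (p * s)"
      proof (rule complex_eqI)
        have "(p + d\<gamma> t) * c * c - p = c * d\<gamma> t * c - p * (1 - c * c)" by (simp add: algebra_simps)
        also have "1 - c * c = s * s" using cs by simp
        finally show "Re (of_real ((p + d\<gamma> t) * c) * Complex c (p * s) - of_real p) = Re (Complex (c * d\<gamma> t) s * Complex c (p * s))"
          by (simp add: mult_ac)
        have "(p + d\<gamma> t) * c * (p * s) = (p * p) * (c * s) + c * d\<gamma> t * (p * s)" by (simp add: algebra_simps)
        then show "Im (of_real ((p + d\<gamma> t) * c) * Complex c (p * s) - of_real p) = Im (Complex (c * d\<gamma> t) s * Complex c (p * s))"
          unfolding pp by (simp add: mult_ac)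
      qed
      ultimately have Q: "of_real (p * (cap p (Gam \<gamma> t) * (\<gamma> t * c))) * (of_real (\<gamma> t) * Complex c (p * s)) - of_real p =
          Complex (c * d\<gamma> t) s * Complex c (p * s)" by (rule ssubst)
      have "sec p y = ((Complex (\<gamma> t * c) (p * (\<gamma> t * s)), Gam \<gamma> t),
          (of_real (p * (cap p (Gam \<gamma> t) * (\<gamma> t * c))) * Complex (\<gamma> t * c) (p * (\<gamma> t * s)) - of_real p, \<gamma> t * c))"
        by (simp add: sec_def Let_def yt c_s_def)
      then show ?thesis unfolding P Q bpt_def pc c_s_def[symmetric] by (simp only: mult.commute)
    qed
    then show ?thesis using bpt_mem[OF True] regular_subset by auto
  next
    case False
    then have e: "t = 0 \<or> t = l" using t by auto
    then have 0: "\<gamma> t = 0" using \<gamma>_ends by auto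
    have "d\<gamma> t = - p" using e y(2) p Gam_ends[OF np] d\<gamma>_ends by (auto simp: yt)
    then have "sec p y = ((0, Gam \<gamma> t), (d\<gamma> t * cis 0, 0))"
      by (simp add: sec_def Let_def yt 0 complex_eq_iff)
    then show ?thesis using pole_mem[of t 0] e by auto
  qed
qed

lemma rotate_bundle_eq:
  "rotate_bundle \<alpha> q = ((cis \<alpha> * fst (fst q), snd (fst q)), (cis \<alpha> * fst (snd q), snd (snd q)))"
  by (simp add: rotate_bundle_def split_beta)

lemma rotate_mem: "q \<in> unit_bundle l \<gamma> \<Longrightarrow> rotate_bundle \<alpha> q \<in> unit_bundle l \<gamma>"
proof -
  assume q: "q \<in> unit_bundle l \<gamma>"
  then show ?thesis
  proof (cases rule: unit_bundle_cases)
    case (reg t \<phi> \<theta>)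
    have "rotate_bundle \<alpha> q = bpt t \<phi> (\<theta> + \<alpha>)"
      unfolding reg(2) using rotate_bundle_pt[OF np reg(1)] bundle_pt_bpt[OF reg(1)] by simp
    then show ?thesis using bpt_mem[OF reg(1)] regular_subset by auto
  next
    case (pole t \<theta>)
    have "rotate_bundle \<alpha> q = ((0, Gam \<gamma> t), (d\<gamma> t * cis (\<theta> + \<alpha>), 0))"
      unfolding pole(2) rotate_bundle_eq by (simp add: cis_mult[symmetric] mult_ac)
    then show ?thesis using pole_mem[OF pole(1)] by simp
  qed
qed

text \<open>The rotations act freely because the two complex components never vanish simultaneously.\<close>

definition weight :: "space3 \<times> space3 \<Rightarrow> real" where
  "weight q = (cmod (fst (fst q)))\<^sup>2 + (cmod (fst (snd q)))\<^sup>2"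

lemma weight_pos: "q \<in> unit_bundle l \<gamma> \<Longrightarrow> 0 < weight q"
proof -
  assume "q \<in> unit_bundle l \<gamma>"
  then have "fst (fst q) \<noteq> 0 \<or> fst (snd q) \<noteq> 0"
  proof (cases rule: unit_bundle_cases)
    case (reg t \<phi> \<theta>)
    then show ?thesis using \<gamma>_pos[OF reg(1)] by (simp add: bpt_def)
  next
    case (pole t \<theta>)
    then show ?thesis using d\<gamma>_ends by auto
  qed
  then show ?thesis unfolding weight_def by (auto intro: add_pos_nonneg add_nonneg_pos)
qed

text \<open>Hermitian product of the complex components of q with those of the section over the same
  point, divided by the squared norm of the latter: if q is the section rotated by \<alpha>, this
  equals cis \<alpha>.\<close>

definition ang :: "real \<Rightarrow> space3 \<times> space3 \<Rightarrow> complex" where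
  "ang p q = (let s = sec p (quot_proj q) in
     (fst (fst q) * cnj (fst (fst s)) + fst (snd q) * cnj (fst (snd s))) / of_real (weight s))"

lemma ang_rotate:
  assumes p: "p \<in> {-1, 1}" and y: "y \<in> quot_bundle l \<gamma>" "snd y \<noteq> - p"
  shows "ang p (rotate_bundle \<alpha> (sec p y)) = cis \<alpha>"
proof -
  let ?s = "sec p y"
  have "fst (fst ?s) * cnj (fst (fst ?s)) + fst (snd ?s) * cnj (fst (snd ?s)) = of_real (weight ?s)"
    by (simp add: weight_def complex_norm_square del: of_real_power)
  then have "cis \<alpha> * fst (fst ?s) * cnj (fst (fst ?s)) + cis \<alpha> * fst (snd ?s) * cnj (fst (snd ?s)) = cis \<alpha> * of_real (weight ?s)"
    unfolding mult.assoc distrib_left[symmetric] by simp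
  then show ?thesis
    unfolding ang_def Let_def quot_proj_rotate quot_proj_sec[OF p] using weight_pos[OF sec_mem[OF assms]]
    by (simp add: rotate_bundle_eq)
qed

lemma rotate_sec_ex:
  assumes p: "p \<in> {-1, 1}" and q: "q \<in> unit_bundle l \<gamma>" "snd (quot_proj q) \<noteq> - p"
  shows "\<exists>\<alpha>. q = rotate_bundle \<alpha> (sec p (quot_proj q))"
proof -
  have "quot_proj q \<in> quot_bundle l \<gamma>" unfolding quot_bundle_def using q(1) by blast
  then have "sec p (quot_proj q) \<in> unit_bundle l \<gamma>" by (rule sec_mem[OF p _ q(2)])
  then show ?thesis using quot_proj_eq_iff[OF np _ q(1)] quot_proj_sec[OF p] by blast
qed

lemma continuous_ang:
  assumes p: "p \<in> {-1, 1}"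
  shows "continuous_on {q \<in> unit_bundle l \<gamma>. snd (quot_proj q) \<noteq> - p} (ang p)"
proof -
  define V where "V = {q \<in> unit_bundle l \<gamma>. snd (quot_proj q) \<noteq> - p}"
  have N: "quot_proj q \<in> quot_bundle l \<gamma>" if "q \<in> V" for q
    unfolding quot_bundle_def using that by (simp add: V_def)
  have z: "snd (quot_proj q) \<in> {-1..1} - {- p}" if "q \<in> V" for q
  proof -
    have "snd (quot_proj q) \<in> {-1..1}" using N[OF that] unfolding quot_bundle_eq by (auto simp: split_beta)
    then show ?thesis using that by (simp add: V_def)
  qed
  have c1: "continuous_on V (\<lambda>q. snd (quot_proj q))" "continuous_on V (\<lambda>q. fst (quot_proj q))"
    by (rule continuous_on_snd[OF continuous_on_quot_proj], rule continuous_on_fst[OF continuous_on_quot_proj])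
  have c2: "continuous_on V (\<lambda>q. cap p (snd (quot_proj q)))"
    by (rule continuous_on_compose2[OF smooth1_continuous[OF cap_smooth1[OF p]] c1(1)], rule image_subsetI, rule z)
  define X Y where "X = (\<lambda>q. Re (fst (quot_proj q)))" and "Y = (\<lambda>q. Im (fst (quot_proj q)))"
  have XY: "continuous_on V X" "continuous_on V Y"
    unfolding X_def Y_def by (rule continuous_on_Re[OF c1(2)], rule continuous_on_Im[OF c1(2)])
  define P where "P = (\<lambda>q. Complex (X q) (p * Y q))"
  define Q where "Q = (\<lambda>q. of_real (p * (cap p (snd (quot_proj q)) * X q)) * P q - complex_of_real p)"
  have P: "continuous_on V P"
    unfolding P_def Complex_eq
    by (intro continuous_on_add continuous_on_mult continuous_on_of_real continuous_on_const XY)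
  have Q: "continuous_on V Q"
    unfolding Q_def by (intro continuous_on_diff continuous_on_mult continuous_on_of_real continuous_on_const XY P c2)
  have sec: "fst (fst (sec p (quot_proj q))) = P q" "fst (snd (sec p (quot_proj q))) = Q q" for q
    by (simp_all add: sec_def Let_def P_def Q_def X_def Y_def)
  have W: "continuous_on V (\<lambda>q. complex_of_real ((cmod (P q))\<^sup>2 + (cmod (Q q))\<^sup>2))"
    by (intro continuous_on_of_real continuous_on_add continuous_on_power continuous_on_norm P Q)
  have nz: "\<forall>q\<in>V. complex_of_real ((cmod (P q))\<^sup>2 + (cmod (Q q))\<^sup>2) \<noteq> 0"
  proof
    fix q assume q: "q \<in> V"
    then have "snd (quot_proj q) \<noteq> - p" by (simp add: V_def)
    from weight_pos[OF sec_mem[OF p N[OF q] this]]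
    show "complex_of_real ((cmod (P q))\<^sup>2 + (cmod (Q q))\<^sup>2) \<noteq> 0"
      unfolding weight_def sec of_real_eq_0_iff by (rule less_imp_neq[THEN not_sym])
  qed
  have "continuous_on V (\<lambda>q. fst (fst q) * cnj (P q) + fst (snd q) * cnj (Q q))"
    by (intro continuous_on_add continuous_on_mult continuous_on_cnj continuous_on_fst continuous_on_snd continuous_on_id P Q)
  from continuous_on_divide[OF this W nz]
  show ?thesis unfolding ang_def Let_def weight_def sec V_def .
qed

end

section \<open>Invariant tori\<close>

context polar_chart
begin

text \<open>The triple consists of the position \<beta> on the oval, the rotation angle and the
  energy; p selects the section.\<close>

definition Theta :: "real \<Rightarrow> (real \<times> real) \<times> real \<Rightarrow> space3 \<times> space3" where
  "Theta p x = rotate_bundle (snd (fst x)) (sec p (lev zs (fst (fst x), snd x)))"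

text \<open>At the pole of height -p the first integral equals p, so an oval of any other energy
  misses the point where the section for p breaks down.\<close>

lemma lev_avoids_pole:
  assumes c: "c \<in> levels zs" "c \<noteq> p" and p: "p \<in> {-1, 1}"
  shows "snd (lev zs (\<beta>, c)) \<noteq> - p"
proof
  assume z: "snd (lev zs (\<beta>, c)) = - p"
  have "(cmod (fst (lev zs (\<beta>, c))))\<^sup>2 = G (- p)"
    using lev_mem(1)[OF c(1), of \<beta>] z unfolding quot_bundle_eq by (auto simp: split_beta)
  moreover have "G (- p) = 0" using p G_ends by auto
  ultimately have "fst (lev zs (\<beta>, c)) = 0" by simp
  then have "first_integral m (lev zs (\<beta>, c)) = p" using z by (simp add: first_integral_eq)
  then show False using lev_mem(2)[OF c(1), of \<beta>] c(2) by simp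
qed

lemma quot_proj_Theta: "p \<in> {-1, 1} \<Longrightarrow> quot_proj (Theta p x) = lev zs (fst (fst x), snd x)"
  unfolding Theta_def quot_proj_rotate by (rule quot_proj_sec)

lemma sec_lev_mem:
  assumes "c \<in> levels zs - {p}" "p \<in> {-1, 1}"
  shows "sec p (lev zs (\<beta>, c)) \<in> unit_bundle l \<gamma>"
  by (rule sec_mem[OF assms(2) lev_mem(1) lev_avoids_pole]) (use assms in auto)

lemma Theta_mem:
  assumes "snd x \<in> levels zs - {p}" "p \<in> {-1, 1}"
  shows "Theta p x \<in> unit_bundle l \<gamma>"
  unfolding Theta_def by (rule rotate_mem[OF sec_lev_mem[OF assms]])

lemma Theta_eq:
  assumes "Theta p x = Theta p y" and p: "p \<in> {-1, 1}" and x: "snd x \<in> levels zs - {p}" "snd y \<in> levels zs - {p}"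
  shows "snd x = snd y" "cis (fst (fst x)) = cis (fst (fst y))" "cis (snd (fst x)) = cis (snd (fst y))"
proof -
  have "lev zs (fst (fst x), snd x) = lev zs (fst (fst y), snd y)"
    unfolding quot_proj_Theta[OF p, symmetric] assms(1) ..
  moreover from this show "snd x = snd y" "cis (fst (fst x)) = cis (fst (fst y))"
    using lev_eqD[of "snd x" "snd y"] x by auto
  ultimately have s: "sec p (lev zs (fst (fst y), snd y)) = sec p (lev zs (fst (fst x), snd x))" by simp
  have "ang p (Theta p z) = cis (snd (fst z))" if "snd z \<in> levels zs - {p}" for z
    unfolding Theta_def by (rule ang_rotate[OF p lev_mem(1) lev_avoids_pole]) (use that p in auto)
  then show "cis (snd (fst x)) = cis (snd (fst y))" using x assms(1) by metis
qed

lemma open_Theta_dom: "open ((UNIV :: (real \<times> real) set) \<times> (levels zs - {p}))"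
  by (intro open_Times open_UNIV open_Diff open_levels closed_singleton)

lemma Ck_on_Theta:
  assumes p: "p \<in> {-1, 1}"
  shows "Ck_on k (UNIV \<times> (levels zs - {p})) (Theta p)"
proof -
  define D where "D = (UNIV :: (real \<times> real) set) \<times> (levels zs - {p})"
  have D: "open D" unfolding D_def by (rule open_Theta_dom)
  have V: "open ((UNIV :: real set) \<times> levels zs)" by (intro open_Times open_UNIV open_levels)
  have L: "bounded_linear (\<lambda>x :: (real \<times> real) \<times> real. (fst (fst x), snd x))"
    by (intro bounded_linear_Pair bounded_linear_fst bounded_linear_snd
        bounded_linear_compose[OF bounded_linear_fst bounded_linear_fst])
  have LD: "0 + (fst (fst x), snd x) \<in> (UNIV :: real set) \<times> levels zs" if "x \<in> D" for x
    using that by (simp add: D_def mem_Times_iff)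
  \<comment> \<open>The summand 0 gives the inner map the shape required by
    \<open>Ck_on_affine_comp\<close>; the map itself forgets the rotation angle.\<close>
  define X Y z where "X = (\<lambda>x :: (real \<times> real) \<times> real. Re (fst (lev zs (0 + (fst (fst x), snd x)))))"
    and "Y = (\<lambda>x :: (real \<times> real) \<times> real. Im (fst (lev zs (0 + (fst (fst x), snd x)))))"
    and "z = (\<lambda>x :: (real \<times> real) \<times> real. snd (lev zs (0 + (fst (fst x), snd x))))"
  have XYz: "Ck_on k D X" "Ck_on k D Y" "Ck_on k D z"
    unfolding X_def Y_def z_def
    by (rule Ck_on_affine_comp[OF D V L LD Ck_on_lev_components(1)], assumption,
        rule Ck_on_affine_comp[OF D V L LD Ck_on_lev_components(2)], assumption,
        rule Ck_on_affine_comp[OF D V L LD Ck_on_lev_components(3)], assumption)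
  obtain F where F: "F 0 = cap p" "deriv_tower ({-1..1} - {- p}) F" by (rule smooth1E[OF cap_smooth1[OF p]])
  have "z x \<in> {-1..1} - {- p}" if "x \<in> D" for x
  proof -
    have c: "snd x \<in> levels zs" "snd x \<noteq> p" using that by (simp_all add: D_def mem_Times_iff)
    have "z x \<in> {-1..1}"
      using lev_mem(1)[OF c(1), of "fst (fst x)"] unfolding quot_bundle_eq z_def by (auto simp: split_beta)
    then show ?thesis using lev_avoids_pole[OF c p, of "fst (fst x)"] by (simp add: z_def)
  qed
  from Ck_on_deriv_tower[OF D F(2) XYz(3) this, of 0] have cap: "Ck_on k D (\<lambda>x. cap p (z x))" by (simp add: F(1))
  have \<alpha>: "Ck_on k D (\<lambda>x. snd (fst x))"
    by (rule Ck_on_linear[OF D bounded_linear_compose[OF bounded_linear_snd bounded_linear_fst]])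
  have P: "Ck_on k D (\<lambda>x. Complex (X x) (p * Y x))"
    by (intro Ck_on_Complex Ck_on_mult Ck_on_const XYz D)
  have "Ck_on k D (\<lambda>x. ((cis (snd (fst x)) * Complex (X x) (p * Y x), z x),
      (cis (snd (fst x)) * (of_real (p * (cap p (z x) * X x)) * Complex (X x) (p * Y x) - of_real p), X x)))"
    by (intro Ck_on_Pair Ck_on_complex_mult Ck_on_diff Ck_on_of_real Ck_on_mult Ck_on_const Ck_on_cis \<alpha> P cap XYz D)
  moreover have "Theta p = (\<lambda>x. ((cis (snd (fst x)) * Complex (X x) (p * Y x), z x),
      (cis (snd (fst x)) * (of_real (p * (cap p (z x) * X x)) * Complex (X x) (p * Y x) - of_real p), X x)))"
    by (rule ext) (simp add: Theta_def rotate_bundle_eq sec_def Let_def X_def Y_def z_def)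
  ultimately show ?thesis by (simp add: D_def)
qed

lemma Theta_has_derivative:
  assumes p: "p \<in> {-1, 1}" and x: "x \<in> UNIV \<times> (levels zs - {p})"
  shows "(Theta p has_derivative frechet_derivative (Theta p) (at x)) (at x)"
  using Ck_on_Theta[OF p, of 1] x open_Theta_dom[of p]
  by (auto simp: differentiable_on_eq_differentiable_at frechet_derivative_works)

text \<open>The projection to the quotient detects the directions \<open>\<beta>\<close> and \<open>c\<close>, and the rotations act
  freely.\<close>

lemma Theta_immersion:
  assumes p: "p \<in> {-1, 1}" and x: "x \<in> UNIV \<times> (levels zs - {p})"
    and T: "(Theta p has_derivative T) (at x)" and 0: "T v = 0"
  shows "v = 0"
proof -
  obtain b a c where xe: "x = ((b, a), c)" by (metis surj_pair)
  have c: "c \<in> levels zs" "c \<in> levels zs - {p}" using x by (simp_all add: xe)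
  have 1: "((\<lambda>x. quot_proj (Theta p x)) has_derivative (\<lambda>v. frechet_derivative quot_proj (at (Theta p x)) (T v))) (at x)"
  proof (rule has_derivative_compose[OF T])
    show "(quot_proj has_derivative frechet_derivative quot_proj (at (Theta p x))) (at (Theta p x))"
      using quot_proj_has_derivative frechet_derivative_at[OF quot_proj_has_derivative] by metis
  qed
  have "((\<lambda>x :: (real \<times> real) \<times> real. (fst (fst x), snd x)) has_derivative (\<lambda>v. (fst (fst v), snd v))) (at x)"
    by (intro has_derivative_Pair has_derivative_fst has_derivative_snd has_derivative_ident)
  moreover have "(lev zs has_derivative lev' b c) (at (fst (fst x), snd x))"
    using lev_has_derivative[OF c(1), of b] by (simp add: xe)
  ultimately have "((\<lambda>x. lev zs (fst (fst x), snd x)) has_derivative (\<lambda>v. lev' b c (fst (fst v), snd v))) (at x)"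
    by (rule has_derivative_compose)
  then have 2: "((\<lambda>x. quot_proj (Theta p x)) has_derivative (\<lambda>v. lev' b c (fst (fst v), snd v))) (at x)"
    unfolding quot_proj_Theta[OF p] .
  have "lev' b c (fst (fst v), snd v) = frechet_derivative quot_proj (at (Theta p x)) (T v)"
    by (rule fun_cong[OF has_derivative_unique[OF 2 1]])
  also have "\<dots> = 0"
    unfolding 0 frechet_derivative_at[OF quot_proj_has_derivative, symmetric] by (simp add: zero_prod_def complex_eq_iff)
  finally have "(fst (fst v), snd v) = (0 :: real \<times> real)" by (rule lev'_zero[OF c(1)])
  \<comment> \<open>Only an infinitesimal rotation by k is left, and it acts on a nonzero pair of
    complex numbers.\<close>
  then obtain k where v: "v = ((0, k), 0)" by (metis fst_conv prod.collapse snd_conv zero_prod_def)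
  define s where "s = sec p (lev zs (b, c))"
  have s: "s \<in> unit_bundle l \<gamma>" unfolding s_def by (rule sec_lev_mem[OF c(2) p])
  have "((\<lambda>t. ((b, t), c)) has_derivative (\<lambda>h. ((0, h), 0))) (at a)"
    by (intro has_derivative_Pair has_derivative_const has_derivative_ident)
  from has_derivative_compose[OF this T[unfolded xe]]
  have d1: "((\<lambda>t. Theta p ((b, t), c)) has_derivative (\<lambda>h. T ((0, h), 0))) (at a)" .
  have cis: "(cis has_vector_derivative \<i> * cis a) (at a)" by (rule cis_has_vector_derivative)
  have "((\<lambda>t. ((cis t * fst (fst s), snd (fst s)), (cis t * fst (snd s), snd (snd s)))) has_vector_derivative
      ((\<i> * cis a * fst (fst s), 0), (\<i> * cis a * fst (snd s), 0))) (at a)"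
    by (intro has_vector_derivative_Pair has_vector_derivative_mult_left has_vector_derivative_const cis)
  then have d2: "((\<lambda>t. Theta p ((b, t), c)) has_vector_derivative
      ((\<i> * cis a * fst (fst s), 0), (\<i> * cis a * fst (snd s), 0))) (at a)"
    by (simp add: Theta_def rotate_bundle_eq s_def)
  have "T ((0, k), 0) = k *\<^sub>R ((\<i> * cis a * fst (fst s), 0), (\<i> * cis a * fst (snd s), 0))"
    by (rule fun_cong[OF has_derivative_unique[OF d1 d2[unfolded has_vector_derivative_def]]])
  then have "k *\<^sub>R (\<i> * cis a * fst (fst s)) = 0" "k *\<^sub>R (\<i> * cis a * fst (snd s)) = 0"
    using 0 unfolding v by (simp_all add: zero_prod_def)
  moreover have "fst (fst s) \<noteq> 0 \<or> fst (snd s) \<noteq> 0"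
    using weight_pos[OF s] by (auto simp: weight_def)
  ultimately have "k = 0" by auto
  then show ?thesis by (simp add: v zero_prod_def)
qed

section \<open>Foliated charts on the unit tangent bundle\<close>

definition Theta_nbhd :: "real \<Rightarrow> real \<Rightarrow> real \<Rightarrow> (space3 \<times> space3) set" where
  "Theta_nbhd p \<beta>0 \<alpha>0 = {q \<in> unit_bundle l \<gamma>. quot_proj q \<in> lev_nbhd \<beta>0 \<and>
     first_integral m (quot_proj q) \<noteq> p \<and> cis (- \<alpha>0) * ang p q \<notin> \<real>\<^sub>\<le>\<^sub>0}"

definition Theta_coord :: "real \<Rightarrow> real \<Rightarrow> real \<Rightarrow> space3 \<times> space3 \<Rightarrow> (real \<times> real) \<times> real" where
  "Theta_coord p \<beta>0 \<alpha>0 q = ((fst (lev_coord \<beta>0 (quot_proj q)), \<alpha>0 + Arg (cis (- \<alpha>0) * ang p q)),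
     snd (lev_coord \<beta>0 (quot_proj q)))"

lemma pole_first_integral:
  assumes "y \<in> quot_bundle l \<gamma>" "snd y = - p" "p \<in> {-1, 1}"
  shows "first_integral m y = p"
proof -
  have "(cmod (fst y))\<^sup>2 = G (- p)" using assms(1,2) unfolding quot_bundle_eq by (auto simp: split_beta)
  moreover have "G (- p) = 0" using assms(3) G_ends by auto
  ultimately show ?thesis using assms(2) by (simp add: first_integral_eq)
qed

text \<open>Deleting the energy p removes every point over the pole of height -p, so
  \<open>ang p\<close> is continuous on what remains.\<close>

lemma openin_Theta_nbhd:
  assumes p: "p \<in> {-1, 1}"
  shows "openin (top_of_set (unit_bundle l \<gamma>)) (Theta_nbhd p \<beta>0 \<alpha>0)"
    and "continuous_on (Theta_nbhd p \<beta>0 \<alpha>0) (Theta_coord p \<beta>0 \<alpha>0)"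
proof -
  define V where "V = {q \<in> unit_bundle l \<gamma>. quot_proj q \<in> lev_nbhd \<beta>0 \<inter> first_integral m -` (- {p})}"
  have N: "quot_proj q \<in> quot_bundle l \<gamma>" if "q \<in> unit_bundle l \<gamma>" for q
    unfolding quot_bundle_def using that by simp
  have "openin (top_of_set (lev_nbhd \<beta>0)) (lev_nbhd \<beta>0 \<inter> first_integral m -` (- {p}))"
    by (rule continuous_openin_preimage_gen[OF continuous_first_integral open_Compl[OF closed_singleton]])
  then have "openin (top_of_set (quot_bundle l \<gamma>)) (lev_nbhd \<beta>0 \<inter> first_integral m -` (- {p}))"
    by (rule openin_trans[OF _ openin_lev_nbhd])
  then have "openin (top_of_set (unit_bundle l \<gamma>))
      (unit_bundle l \<gamma> \<inter> quot_proj -` (lev_nbhd \<beta>0 \<inter> first_integral m -` (- {p})))"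
    by (rule continuous_openin_preimage[OF continuous_on_quot_proj, rotated]) (use N in blast)
  moreover have "unit_bundle l \<gamma> \<inter> quot_proj -` (lev_nbhd \<beta>0 \<inter> first_integral m -` (- {p})) = V"
    unfolding V_def by blast
  ultimately have V: "openin (top_of_set (unit_bundle l \<gamma>)) V" by simp
  have VM: "V \<subseteq> {q \<in> unit_bundle l \<gamma>. snd (quot_proj q) \<noteq> - p}"
  proof
    fix q assume q: "q \<in> V"
    then have qM: "q \<in> unit_bundle l \<gamma>" and ne: "first_integral m (quot_proj q) \<noteq> p" by (simp_all add: V_def)
    have "snd (quot_proj q) \<noteq> - p" using pole_first_integral[OF N[OF qM] _ p] ne by blast
    then show "q \<in> {q \<in> unit_bundle l \<gamma>. snd (quot_proj q) \<noteq> - p}" using qM by simp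
  qed
  have ang: "continuous_on V (\<lambda>q. cis (- \<alpha>0) * ang p q)"
    by (intro continuous_on_mult continuous_on_const continuous_on_subset[OF continuous_ang[OF p] VM])
  have "openin (top_of_set V) (V \<inter> (\<lambda>q. cis (- \<alpha>0) * ang p q) -` (- \<real>\<^sub>\<le>\<^sub>0))"
    by (rule continuous_openin_preimage_gen[OF ang]) (intro open_Compl closed_nonpos_Reals_complex)
  then have "openin (top_of_set (unit_bundle l \<gamma>)) (V \<inter> (\<lambda>q. cis (- \<alpha>0) * ang p q) -` (- \<real>\<^sub>\<le>\<^sub>0))"
    by (rule openin_trans[OF _ V])
  moreover have eq: "V \<inter> (\<lambda>q. cis (- \<alpha>0) * ang p q) -` (- \<real>\<^sub>\<le>\<^sub>0) = Theta_nbhd p \<beta>0 \<alpha>0"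
    unfolding V_def Theta_nbhd_def by auto
  ultimately show "openin (top_of_set (unit_bundle l \<gamma>)) (Theta_nbhd p \<beta>0 \<alpha>0)" by simp
  have sub: "Theta_nbhd p \<beta>0 \<alpha>0 \<subseteq> V" using eq by blast
  have "continuous_on (Theta_nbhd p \<beta>0 \<alpha>0) (\<lambda>q. Arg (cis (- \<alpha>0) * ang p q))"
    by (rule continuous_on_compose2[OF continuous_on_Arg continuous_on_subset[OF ang sub]])
      (auto simp: Theta_nbhd_def)
  moreover have "continuous_on (Theta_nbhd p \<beta>0 \<alpha>0) (\<lambda>q. lev_coord \<beta>0 (quot_proj q))"
    by (rule continuous_on_compose2[OF continuous_lev_coord continuous_on_quot_proj])
      (auto simp: Theta_nbhd_def)
  ultimately show "continuous_on (Theta_nbhd p \<beta>0 \<alpha>0) (Theta_coord p \<beta>0 \<alpha>0)"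
    unfolding Theta_coord_def
    by (intro continuous_on_Pair continuous_on_fst continuous_on_snd continuous_on_add continuous_on_const)
qed

abbreviation Theta_dom :: "real \<Rightarrow> real \<Rightarrow> real \<Rightarrow> ((real \<times> real) \<times> real) set" where
  "Theta_dom p \<beta>0 \<alpha>0 \<equiv> ({\<beta>0 - pi<..<\<beta>0 + pi} \<times> {\<alpha>0 - pi<..<\<alpha>0 + pi}) \<times> (levels zs - {p})"

lemma Theta_in_nbhd:
  assumes p: "p \<in> {-1, 1}" and x: "x \<in> Theta_dom p \<beta>0 \<alpha>0"
  shows "Theta p x \<in> Theta_nbhd p \<beta>0 \<alpha>0" "Theta_coord p \<beta>0 \<alpha>0 (Theta p x) = x"
proof -
  obtain b a c where xe: "x = ((b, a), c)" by (metis surj_pair)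
  have b: "b \<in> {\<beta>0 - pi<..<\<beta>0 + pi}" and a: "- pi < a - \<alpha>0" "a - \<alpha>0 < pi"
    and c: "c \<in> levels zs" "c \<noteq> p" "snd x \<in> levels zs - {p}"
    using x by (auto simp: xe)
  have ang: "cis (- \<alpha>0) * ang p (Theta p x) = of_real 1 * cis (a - \<alpha>0)"
    unfolding xe Theta_def fst_conv snd_conv ang_rotate[OF p lev_mem(1)[OF c(1)] lev_avoids_pole[OF c(1,2) p]]
    by (simp add: cis_mult)
  have lev: "quot_proj (Theta p x) = lev zs (b, c)" unfolding quot_proj_Theta[OF p] by (simp add: xe)
  show "Theta p x \<in> Theta_nbhd p \<beta>0 \<alpha>0"
    unfolding Theta_nbhd_def mem_Collect_eq lev ang lev_mem(2)[OF c(1)]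
    using Theta_mem[OF c(3) p] lev_in_nbhd(1)[OF b c(1)] c(2) of_real_cis_notin_nonpos[OF zero_less_one a] by blast
  show "Theta_coord p \<beta>0 \<alpha>0 (Theta p x) = x"
    unfolding Theta_coord_def lev ang lev_in_nbhd(2)[OF b c(1)] Arg_of_real_cis[OF zero_less_one a] by (simp add: xe)
qed

lemma Theta_of_coord:
  assumes p: "p \<in> {-1, 1}" and q: "q \<in> Theta_nbhd p \<beta>0 \<alpha>0"
  shows "Theta p (Theta_coord p \<beta>0 \<alpha>0 q) = q" "Theta_coord p \<beta>0 \<alpha>0 q \<in> Theta_dom p \<beta>0 \<alpha>0"
proof -
  define y where "y = quot_proj q"
  have qM: "q \<in> unit_bundle l \<gamma>" and y: "y \<in> lev_nbhd \<beta>0" "first_integral m y \<noteq> p"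
    and w: "cis (- \<alpha>0) * ang p q \<notin> \<real>\<^sub>\<le>\<^sub>0"
    using q by (simp_all add: Theta_nbhd_def y_def)
  have yN: "y \<in> quot_bundle l \<gamma>" using y(1) by (simp add: lev_nbhd_def)
  have np: "snd y \<noteq> - p" using pole_first_integral[OF yN _ p] y(2) by blast
  obtain \<alpha> where \<alpha>: "q = rotate_bundle \<alpha> (sec p y)"
    using rotate_sec_ex[OF p qM] np unfolding y_def by blast
  have ang: "ang p q = cis \<alpha>" unfolding \<alpha> by (rule ang_rotate[OF p yN np])
  define \<alpha>' where "\<alpha>' = \<alpha>0 + Arg (cis (- \<alpha>0) * ang p q)"
  have "cis \<alpha>' = cis \<alpha>0 * (cis (- \<alpha>0) * cis \<alpha>)"
    unfolding \<alpha>'_def cis_mult[symmetric] ang using of_real_cis_Arg[of "cis (- \<alpha>0) * cis \<alpha>"] by (simp add: norm_mult)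
  then have \<alpha>': "cis \<alpha>' = cis \<alpha>" by (simp add: cis_mult)
  have rot: "rotate_bundle \<alpha>' (sec p y) = q" unfolding \<alpha> rotate_bundle_eq \<alpha>' ..
  have co: "Theta_coord p \<beta>0 \<alpha>0 q = ((fst (lev_coord \<beta>0 y), \<alpha>'), snd (lev_coord \<beta>0 y))"
    unfolding Theta_coord_def y_def \<alpha>'_def ..
  show "Theta p (Theta_coord p \<beta>0 \<alpha>0 q) = q"
    unfolding co Theta_def fst_conv snd_conv prod.collapse lev_of_coord(1)[OF y(1)] by (rule rot)
  have "snd (lev_coord \<beta>0 y) = first_integral m y" by (simp add: lev_coord_def)
  then show "Theta_coord p \<beta>0 \<alpha>0 q \<in> Theta_dom p \<beta>0 \<alpha>0"
    using lev_of_coord(2)[OF y(1)] y(2) Arg_bounds_open[OF w]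
    unfolding co \<alpha>'_def mem_Times_iff fst_conv snd_conv greaterThanLessThan_iff by simp
qed

lemma regular_param_Theta:
  assumes p: "p \<in> {-1, 1}"
  shows "regular_param (Theta_dom p \<beta>0 \<alpha>0) (Theta p) (Theta_nbhd p \<beta>0 \<alpha>0)"
proof -
  have D: "open (Theta_dom p \<beta>0 \<alpha>0)"
    by (intro open_Times open_greaterThanLessThan open_Diff open_levels closed_singleton)
  have sub: "Theta_dom p \<beta>0 \<alpha>0 \<subseteq> UNIV \<times> (levels zs - {p})" by auto
  have Ck: "Ck_on k (Theta_dom p \<beta>0 \<alpha>0) (Theta p)" for k
    by (rule Ck_on_subset[OF D open_Theta_dom sub Ck_on_Theta[OF p]])
  have s1: "smooth_map_on (Theta_dom p \<beta>0 \<alpha>0) (Theta p)"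
    unfolding smooth_map_on_def using D Ck by blast
  have s2: "inj (frechet_derivative (Theta p) (at x))" if "x \<in> Theta_dom p \<beta>0 \<alpha>0" for x
  proof -
    have x: "x \<in> UNIV \<times> (levels zs - {p})" using sub that by (rule subsetD)
    show ?thesis
      by (rule inj_frechet_derivative[OF Theta_has_derivative[OF p x] Theta_immersion[OF p x Theta_has_derivative[OF p x]]])
  qed
  have s3: "homeomorphism (Theta_dom p \<beta>0 \<alpha>0) (Theta_nbhd p \<beta>0 \<alpha>0) (Theta p) (Theta_coord p \<beta>0 \<alpha>0)"
  proof (rule homeomorphismI)
    show "continuous_on (Theta_dom p \<beta>0 \<alpha>0) (Theta p)" using Ck[of 0] by simp
    show "continuous_on (Theta_nbhd p \<beta>0 \<alpha>0) (Theta_coord p \<beta>0 \<alpha>0)" by (rule openin_Theta_nbhd(2)[OF p])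
    show "Theta p ` Theta_dom p \<beta>0 \<alpha>0 \<subseteq> Theta_nbhd p \<beta>0 \<alpha>0"
      by (rule image_subsetI, rule Theta_in_nbhd(1)[OF p])
    show "Theta_coord p \<beta>0 \<alpha>0 ` Theta_nbhd p \<beta>0 \<alpha>0 \<subseteq> Theta_dom p \<beta>0 \<alpha>0"
      by (rule image_subsetI, rule Theta_of_coord(2)[OF p])
    show "Theta_coord p \<beta>0 \<alpha>0 (Theta p x) = x" if "x \<in> Theta_dom p \<beta>0 \<alpha>0" for x
      by (rule Theta_in_nbhd(2)[OF p that])
    show "Theta p (Theta_coord p \<beta>0 \<alpha>0 q) = q" if "q \<in> Theta_nbhd p \<beta>0 \<alpha>0" for q
      by (rule Theta_of_coord(1)[OF p that])
  qed
  show ?thesis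
    unfolding regular_param_def
    by (rule conjI[OF s1], rule conjI, rule ballI, erule s2, rule exI[of _ "Theta_coord p \<beta>0 \<alpha>0"], rule s3)
qed

text \<open>Points over the same quotient point differ by a rotation, so rotating the section along
  an oval fills the entire preimage of that oval.\<close>

lemma torus_level:
  assumes c: "c \<in> levels zs" and p: "p \<in> {-1, 1}" "c \<noteq> p"
  shows "{q \<in> unit_bundle l \<gamma>. first_integral m (quot_proj q) = c} = range (\<lambda>x :: real \<times> real. Theta p (x, c))"
proof
  have cp: "c \<in> levels zs - {p}" using c p(2) by simp
  show "range (\<lambda>x. Theta p (x, c)) \<subseteq> {q \<in> unit_bundle l \<gamma>. first_integral m (quot_proj q) = c}"
    using Theta_mem[of "(_, c)" p] cp p(1) lev_mem(2)[OF c] by (auto simp: quot_proj_Theta)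
  show "{q \<in> unit_bundle l \<gamma>. first_integral m (quot_proj q) = c} \<subseteq> range (\<lambda>x. Theta p (x, c))"
  proof
    fix q assume "q \<in> {q \<in> unit_bundle l \<gamma>. first_integral m (quot_proj q) = c}"
    then have q: "q \<in> unit_bundle l \<gamma>" "first_integral m (quot_proj q) = c" by simp_all
    have N: "quot_proj q \<in> quot_bundle l \<gamma>" unfolding quot_bundle_def using q(1) by simp
    have "quot_proj q \<in> range (\<lambda>\<beta>. lev zs (\<beta>, c))" using level_set_eq[OF c] N q(2) by blast
    then obtain b where b: "quot_proj q = lev zs (b, c)" by blast
    have "snd (quot_proj q) \<noteq> - p" using pole_first_integral[OF N _ p(1)] q(2) p(2) by blast
    from rotate_sec_ex[OF p(1) q(1) this] obtain a where a: "q = rotate_bundle a (sec p (lev zs (b, c)))"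
      unfolding b by blast
    have "q = Theta p ((b, a), c)" unfolding Theta_def fst_conv snd_conv by (rule a)
    then show "q \<in> range (\<lambda>x. Theta p (x, c))" by blast
  qed
qed

text \<open>The angles are rescaled by 2 pi to turn the periods of \<open>cis\<close> into the
  integer lattice. Injectivity modulo the lattice holds because the projection determines \<beta>
  and \<open>ang\<close> determines the rotation.\<close>

lemma embedded_torus_level:
  assumes c: "c \<in> levels zs" and p: "p \<in> {-1, 1}" "c \<noteq> p"
  shows "embedded_torus {q \<in> unit_bundle l \<gamma>. first_integral m (quot_proj q) = c}"
proof -
  define L where "L = (\<lambda>x :: real \<times> real. ((2 * pi * fst x, 2 * pi * snd x), 0 :: real))"
  define F where "F = (\<lambda>x. Theta p (((0, 0), c) + L x))"
  have L: "bounded_linear L"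
    unfolding L_def by (intro bounded_linear_Pair bounded_linear_const_mult bounded_linear_fst bounded_linear_snd bounded_linear_zero)
  have cp: "c \<in> levels zs - {p}" using c p(2) by simp
  have dom: "((0, 0), c) + L x \<in> UNIV \<times> (levels zs - {p})" for x using cp by (simp add: L_def)
  have eqF: "F x = Theta p ((2 * pi * fst x, 2 * pi * snd x), c)" for x by (simp add: F_def L_def)
  have "Ck_on k UNIV F" for k
    unfolding F_def by (rule Ck_on_affine_comp[OF open_UNIV open_Theta_dom L dom Ck_on_Theta[OF p(1)]])
  then have s1: "smooth_map_on UNIV F" unfolding smooth_map_on_def by simp
  have s2: "inj (frechet_derivative F (at x))" for x
  proof -
    let ?T = "frechet_derivative (Theta p) (at (((0, 0), c) + L x))"
    note T = Theta_has_derivative[OF p(1) dom[of x]]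
    have "((\<lambda>x. ((0, 0), c) + L x) has_derivative L) (at x)"
      using has_derivative_add[OF has_derivative_const bounded_linear_imp_has_derivative[OF L]] by simp
    from has_derivative_compose[OF this T]
    have d: "(F has_derivative (\<lambda>v. ?T (L v))) (at x)" unfolding F_def .
    have "v = 0" if "?T (L v) = 0" for v
    proof -
      have "L v = 0" by (rule Theta_immersion[OF p(1) dom T that])
      then show ?thesis by (simp add: L_def prod_eq_iff)
    qed
    from inj_frechet_derivative[OF d this] show ?thesis .
  qed
  have per: "cis (2 * pi * s) = cis (2 * pi * t) \<longleftrightarrow> s - t \<in> \<int>" for s t :: real
  proof -
    have "cis (2 * pi * s) = cis (2 * pi * t) \<longleftrightarrow> (\<exists>n::int. 2 * pi * t = 2 * pi * (s + of_int n))"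
      unfolding cis_eq_iff_int by (simp add: distrib_left)
    also have "\<dots> \<longleftrightarrow> (\<exists>n::int. t = s + of_int n)" by simp
    also have "\<dots> \<longleftrightarrow> s - t \<in> \<int>"
    proof
      assume "\<exists>n::int. t = s + of_int n"
      then obtain n :: int where "t = s + of_int n" by blast
      then have "s - t = of_int (- n)" by simp
      then show "s - t \<in> \<int>" by (rule ssubst) (rule Ints_of_int)
    next
      assume "s - t \<in> \<int>"
      then obtain n where "s - t = of_int n" by (rule Ints_cases)
      then have "t = s + of_int (- n)" by simp
      then show "\<exists>n::int. t = s + of_int n" by blast
    qed
    finally show ?thesis .
  qed
  have s3: "F x = F y \<longleftrightarrow> fst x - fst y \<in> \<int> \<and> snd x - snd y \<in> \<int>" for x y
  proof
    assume "F x = F y"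
    from Theta_eq[OF this[unfolded eqF] p(1)] cp
    show "fst x - fst y \<in> \<int> \<and> snd x - snd y \<in> \<int>" unfolding per[symmetric] by simp
  next
    assume "fst x - fst y \<in> \<int> \<and> snd x - snd y \<in> \<int>"
    then have e: "cis (2 * pi * fst x) = cis (2 * pi * fst y)" "cis (2 * pi * snd x) = cis (2 * pi * snd y)"
      unfolding per[symmetric] by simp_all
    show "F x = F y"
      unfolding eqF Theta_def fst_conv snd_conv rotate_bundle_eq lev_periodic[OF e(1)] e(2) ..
  qed
  have "range F = range (\<lambda>x :: real \<times> real. Theta p (x, c))"
  proof
    show "range F \<subseteq> range (\<lambda>x. Theta p (x, c))" unfolding eqF by blast
    show "range (\<lambda>x. Theta p (x, c)) \<subseteq> range F"
    proof (rule image_subsetI)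
      fix x :: "real \<times> real"
      show "Theta p (x, c) \<in> range F"
        by (rule range_eqI[of _ _ "(fst x / (2 * pi), snd x / (2 * pi))"]) (simp add: eqF)
    qed
  qed
  then have s4: "{q \<in> unit_bundle l \<gamma>. first_integral m (quot_proj q) = c} = range F"
    by (simp only: torus_level[OF c p])
  show ?thesis
    unfolding embedded_torus_def
    by (rule exI[of _ F], rule conjI[OF s1], rule conjI, rule allI, rule s2, rule conjI, intro allI, rule s3, rule s4)
qed

end

section \<open>The range of the first integral\<close>

locale magnetic_extrema = magnetic +
  fixes tp tm :: real
  assumes tp: "tp \<in> {0<..<l}" "\<And>t. t \<in> {0..l} - {tp} \<Longrightarrow> integral_pm 1 m \<gamma> t < integral_pm 1 m \<gamma> tp"
    and tm: "tm \<in> {0<..<l}" "\<And>t. t \<in> {0..l} - {tm} \<Longrightarrow> integral_pm (-1) m \<gamma> tm < integral_pm (-1) m \<gamma> t"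
begin

definition energies :: "real set" where
  "energies = {integral_pm (-1) m \<gamma> tm<..<integral_pm 1 m \<gamma> tp}"

text \<open>With z = \<Gamma> t the condition H c z > 0 says |z + c| < m \<gamma>. So the centre of
  height \<Gamma> t serves exactly the energies between the two boundary integrals at t.\<close>

lemma levels_iff:
  assumes t: "t \<in> {0<..<l}"
  shows "c \<in> levels (Gam \<gamma> t) \<longleftrightarrow> integral_pm (-1) m \<gamma> t < c \<and> c < integral_pm 1 m \<gamma> t"
proof -
  have tm: "t \<in> {0..l}" using t by simp
  have pos: "0 < m * \<gamma> t" using m_pos \<gamma>_pos[OF t] by simp
  have "c \<in> levels (Gam \<gamma> t) \<longleftrightarrow> (Gam \<gamma> t + c)\<^sup>2 / m\<^sup>2 < (\<gamma> t)\<^sup>2"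
    unfolding levels_def H_def Ge_eq[OF Gam_mem[OF tm]] G_Gam[OF tm] by simp
  also have "\<dots> \<longleftrightarrow> (Gam \<gamma> t + c)\<^sup>2 < (m * \<gamma> t)\<^sup>2"
    unfolding pos_divide_less_eq[OF m2_pos] by (simp add: power_mult_distrib mult.commute)
  also have "\<dots> \<longleftrightarrow> \<not> \<bar>m * \<gamma> t\<bar> \<le> \<bar>Gam \<gamma> t + c\<bar>"
    unfolding abs_le_square_iff by (simp add: not_le)
  also have "\<dots> \<longleftrightarrow> - (m * \<gamma> t) - Gam \<gamma> t < c \<and> c < m * \<gamma> t - Gam \<gamma> t"
    using pos by auto
  finally show ?thesis by (simp add: integral_pm_def)
qed

text \<open>A centre for each energy. If -c lies in (-1, 1), the height z = -c works, as z + c = 0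
  leaves H = G > 0. If c \<ge> 1, the maximizer \<open>tp\<close> works: its lower bound is below 1
  because \<Gamma> > -1. If c \<le> -1, \<open>tm\<close> works by symmetry.\<close>

lemma energies_levels:
  assumes c: "c \<in> energies"
  shows "\<exists>t\<in>{0<..<l}. c \<in> levels (Gam \<gamma> t)"
proof -
  have c12: "integral_pm (-1) m \<gamma> tm < c" "c < integral_pm 1 m \<gamma> tp" using c by (auto simp: energies_def)
  consider "- c \<in> {-1<..<1}" | "1 \<le> c" | "c \<le> -1" by force
  then show ?thesis
  proof cases
    case 1
    have t: "\<tau> (- c) \<in> {0<..<l}" by (rule \<tau>_mem_open[OF 1])
    have "Gam \<gamma> (\<tau> (- c)) = - c" using Gam_\<tau>[of "- c"] 1 by simp
    then have "c \<in> levels (Gam \<gamma> (\<tau> (- c)))"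
      unfolding levels_iff[OF t] using m_pos \<gamma>_pos[OF t] by (simp add: integral_pm_def)
    then show ?thesis using t by blast
  next
    case 2
    have "0 < m * \<gamma> tp" using m_pos \<gamma>_pos[OF tp(1)] by simp
    then have "integral_pm (-1) m \<gamma> tp < c"
      using Gam_mem_open[OF tp(1)] 2 by (simp add: integral_pm_def)
    then show ?thesis using levels_iff[OF tp(1)] c12 tp(1) by blast
  next
    case 3
    have "0 < m * \<gamma> tm" using m_pos \<gamma>_pos[OF tm(1)] by simp
    then have "c < integral_pm 1 m \<gamma> tm"
      using Gam_mem_open[OF tm(1)] 3 by (simp add: integral_pm_def)
    then show ?thesis using levels_iff[OF tm(1)] c12 tm(1) by blast
  qed
qed

lemma levels_energies:
  assumes t: "t \<in> {0<..<l}" and c: "c \<in> levels (Gam \<gamma> t)"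
  shows "c \<in> energies"
proof -
  have "integral_pm 1 m \<gamma> t \<le> integral_pm 1 m \<gamma> tp" using tp(2)[of t] t by (cases "t = tp") auto
  moreover have "integral_pm (-1) m \<gamma> tm \<le> integral_pm (-1) m \<gamma> t" using tm(2)[of t] t by (cases "t = tm") auto
  ultimately show ?thesis using c unfolding levels_iff[OF t] energies_def by simp
qed

text \<open>The estimate has two steps, from sin \<phi> to its bound and from t to the extremum.
  Equality requires both to be sharp, which singles out one point of the quotient.\<close>

lemma first_integral_range:
  assumes y: "y \<in> quot_bundle l \<gamma>"
  shows "first_integral m y < integral_pm 1 m \<gamma> tp \<longleftrightarrow> y \<noteq> quot_pt l \<gamma> (tp, pi / 2)"
    and "integral_pm (-1) m \<gamma> tm < first_integral m y \<longleftrightarrow> y \<noteq> quot_pt l \<gamma> (tm, - pi / 2)"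
proof -
  obtain t \<phi> where t: "t \<in> {0..l}" and yt: "y = (\<gamma> t * cis \<phi>, Gam \<gamma> t)" by (rule quot_bundleE[OF y])
  have FI: "first_integral m y = m * \<gamma> t * sin \<phi> - Gam \<gamma> t" by (simp add: first_integral_eq yt)
  have nn: "0 \<le> m * \<gamma> t" using m_pos \<gamma>_nonneg[OF t] by simp
  have "m * \<gamma> t * sin \<phi> \<le> m * \<gamma> t * 1" "m * \<gamma> t * (- 1) \<le> m * \<gamma> t * sin \<phi>"
    by (rule mult_left_mono[OF _ nn], simp)+
  then have le: "first_integral m y \<le> integral_pm 1 m \<gamma> t" "integral_pm (-1) m \<gamma> t \<le> first_integral m y"
    by (simp_all add: FI integral_pm_def)
  have cisI: "cis \<phi> = \<i> * of_real s" if "sin \<phi> = s" "s * s = 1" for s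
  proof -
    have "cos \<phi> = 0" using that sin_cos_squared_add3[of \<phi>] by simp
    then show ?thesis using that by (simp add: complex_eq_iff)
  qed
  show "first_integral m y < integral_pm 1 m \<gamma> tp \<longleftrightarrow> y \<noteq> quot_pt l \<gamma> (tp, pi / 2)"
  proof (cases "t = tp")
    case False
    then have "first_integral m y < integral_pm 1 m \<gamma> tp" using le(1) tp(2)[of t] t by auto
    moreover have "Gam \<gamma> t \<noteq> Gam \<gamma> tp" using Gam_eq_iff[OF np t, of tp] tp(1) False by simp
    ultimately show ?thesis unfolding quot_pt_eq[OF tp(1)] yt by simp
  next
    case True
    have pos: "0 < m * \<gamma> tp" using m_pos \<gamma>_pos[OF tp(1)] by simp
    have "first_integral m y < integral_pm 1 m \<gamma> tp \<longleftrightarrow> m * \<gamma> tp * sin \<phi> < m * \<gamma> tp * 1"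
      unfolding FI True integral_pm_def by simp
    also have "\<dots> \<longleftrightarrow> sin \<phi> < 1" unfolding mult_less_cancel_left_pos[OF pos] ..
    also have "\<dots> \<longleftrightarrow> sin \<phi> \<noteq> 1" using sin_le_one[of \<phi>] by (auto simp: less_le)
    also have "\<dots> \<longleftrightarrow> cis \<phi> \<noteq> \<i>" using cisI[of 1] by (auto simp: complex_eq_iff)
    finally show ?thesis unfolding quot_pt_eq[OF tp(1)] yt True using \<gamma>_pos[OF tp(1)] by simp
  qed
  show "integral_pm (-1) m \<gamma> tm < first_integral m y \<longleftrightarrow> y \<noteq> quot_pt l \<gamma> (tm, - pi / 2)"
  proof (cases "t = tm")
    case False
    then have "integral_pm (-1) m \<gamma> tm < first_integral m y" using le(2) tm(2)[of t] t by auto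
    moreover have "Gam \<gamma> t \<noteq> Gam \<gamma> tm" using Gam_eq_iff[OF np t, of tm] tm(1) False by simp
    ultimately show ?thesis unfolding quot_pt_eq[OF tm(1)] yt by simp
  next
    case True
    have pos: "0 < m * \<gamma> tm" using m_pos \<gamma>_pos[OF tm(1)] by simp
    have "integral_pm (-1) m \<gamma> tm < first_integral m y \<longleftrightarrow> m * \<gamma> tm * (- 1) < m * \<gamma> tm * sin \<phi>"
      unfolding FI True integral_pm_def by simp
    also have "\<dots> \<longleftrightarrow> - 1 < sin \<phi>" unfolding mult_less_cancel_left_pos[OF pos] ..
    also have "\<dots> \<longleftrightarrow> sin \<phi> \<noteq> - 1" using sin_ge_minus_one[of \<phi>] by (auto simp: less_le)
    also have "\<dots> \<longleftrightarrow> cis \<phi> \<noteq> - \<i>" using cisI[of "- 1"] by (auto simp: complex_eq_iff)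
    also have "- \<i> = cis (- pi / 2)" by (simp add: complex_eq_iff)
    also have "cis \<phi> \<noteq> cis (- pi / 2) \<longleftrightarrow> of_real (\<gamma> tm) * cis \<phi> \<noteq> of_real (\<gamma> tm) * cis (- pi / 2)"
      using less_imp_neq[OF \<gamma>_pos[OF tm(1)]] unfolding mult_cancel_left of_real_eq_0_iff by auto
    finally show ?thesis unfolding quot_pt_eq[OF tm(1)] yt True prod.inject by blast
  qed
qed

lemma quot_complement_eq:
  "quot_bundle l \<gamma> - {quot_pt l \<gamma> (tm, - pi / 2), quot_pt l \<gamma> (tp, pi / 2)} =
    {y \<in> quot_bundle l \<gamma>. first_integral m y \<in> energies}"
  using first_integral_range unfolding energies_def by auto

lemma polar_chart_at:
  assumes "t \<in> {0<..<l}"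
  shows "polar_chart l \<gamma> m (Gam \<gamma> t)"
  by unfold_locales (rule Gam_mem_open[OF assms])

section \<open>The foliations of the quotient and of the unit tangent bundle\<close>

lemma quot_foliation:
  "\<exists>F. foliation TYPE(real) TYPE(real)
      (quot_bundle l \<gamma> - {quot_pt l \<gamma> (tm, - pi / 2), quot_pt l \<gamma> (tp, pi / 2)}) F \<and>
    (\<forall>L\<in>F. closed_orbit (quot_bundle l \<gamma>) (quot_magnetic_field m l \<gamma>) L)"
proof (intro exI conjI ballI)
  let ?W = "quot_bundle l \<gamma> - {quot_pt l \<gamma> (tm, - pi / 2), quot_pt l \<gamma> (tp, pi / 2)}"
  show "foliation TYPE(real) TYPE(real) ?W ((\<lambda>c. {y \<in> quot_bundle l \<gamma>. first_integral m y = c}) ` energies)"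
  proof (rule foliation_level_sets[OF quot_complement_eq])
    fix c assume "c \<in> energies"
    then obtain t where t: "t \<in> {0<..<l}" "c \<in> levels (Gam \<gamma> t)" using energies_levels by blast
    interpret polar_chart l \<gamma> m "Gam \<gamma> t" by (rule polar_chart_at[OF t(1)])
    have "continuous_on UNIV (\<lambda>\<beta>. lev (Gam \<gamma> t) (\<beta>, c))"
      by (intro continuous_at_imp_continuous_on ballI has_vector_derivative_continuous[OF lev_deriv_beta[OF t(2)]])
    then have "connected (range (\<lambda>\<beta>. lev (Gam \<gamma> t) (\<beta>, c)))"
      by (rule connected_continuous_image) simp
    then show "connected {y \<in> quot_bundle l \<gamma>. first_integral m y = c} \<and> {y \<in> quot_bundle l \<gamma>. first_integral m y = c} \<noteq> {}"
      unfolding level_set_eq[OF t(2)] by blast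
  next
    fix y assume y: "y \<in> ?W"
    define c where "c = first_integral m y"
    have yN: "y \<in> quot_bundle l \<gamma>" "c \<in> energies" using y unfolding quot_complement_eq c_def by auto
    then obtain t where t: "t \<in> {0<..<l}" "c \<in> levels (Gam \<gamma> t)" using energies_levels by blast
    interpret polar_chart l \<gamma> m "Gam \<gamma> t" by (rule polar_chart_at[OF t(1)])
    have "y \<in> range (\<lambda>\<beta>. lev (Gam \<gamma> t) (\<beta>, c))"
      using yN(1) unfolding level_set_eq[OF t(2), symmetric] by (simp add: c_def)
    then obtain b where b: "y = lev (Gam \<gamma> t) (b, c)" by blast
    let ?A = "{b - pi<..<b + pi}" and ?U = "lev_nbhd b"
    have 1: "y \<in> ?U" unfolding b by (rule lev_in_nbhd(1)[OF _ t(2)]) simp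
    have "?U \<subseteq> ?W"
      using levels_energies[OF t(1)] unfolding quot_complement_eq lev_nbhd_def by blast
    then have 2: "openin (top_of_set ?W) ?U" by (rule openin_subset_trans[OF openin_lev_nbhd]) blast
    have 3: "\<forall>a\<in>?A. \<forall>c'\<in>levels (Gam \<gamma> t). first_integral m (lev (Gam \<gamma> t) (a, c')) = c'"
      using lev_mem(2) by blast
    have 4: "connected ?A" by simp
    show "\<exists>(A::real set) (B::real set) \<psi> U. y \<in> U \<and> openin (top_of_set ?W) U \<and> connected A \<and>
        regular_param (A \<times> B) \<psi> U \<and> (\<forall>a\<in>A. \<forall>b\<in>B. first_integral m (\<psi> (a, b)) = b)"
      by (rule exI[of _ ?A], rule exI[of _ "levels (Gam \<gamma> t)"], rule exI[of _ "lev (Gam \<gamma> t)"], rule exI[of _ ?U],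
          intro conjI 1 2 3 4 regular_param_lev)
  qed
  fix L assume "L \<in> (\<lambda>c. {y \<in> quot_bundle l \<gamma>. first_integral m y = c}) ` energies"
  then obtain c where c: "c \<in> energies" "L = {y \<in> quot_bundle l \<gamma>. first_integral m y = c}" by blast
  then obtain t where t: "t \<in> {0<..<l}" "c \<in> levels (Gam \<gamma> t)" using energies_levels by blast
  interpret polar_chart l \<gamma> m "Gam \<gamma> t" by (rule polar_chart_at[OF t(1)])
  show "closed_orbit (quot_bundle l \<gamma>) (quot_magnetic_field m l \<gamma>) L"
    unfolding c(2) level_set_eq[OF t(2)] by (rule closed_orbit_level[OF t(2)])
qed

lemma bundle_circle_iff:
  assumes t: "t \<in> {0<..<l}" and q: "q \<in> unit_bundle l \<gamma>"
  shows "q \<in> bundle_circle l \<gamma> t \<phi> \<longleftrightarrow> quot_proj q = quot_pt l \<gamma> (t, \<phi>)"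
proof -
  have b: "bpt t \<phi> 0 \<in> unit_bundle l \<gamma>" using bpt_mem[OF t] regular_subset by blast
  have "quot_pt l \<gamma> (t, \<phi>) = quot_proj (bpt t \<phi> 0)" by (simp add: quot_pt_def bundle_pt_bpt[OF t])
  then have "quot_proj q = quot_pt l \<gamma> (t, \<phi>) \<longleftrightarrow> (\<exists>\<alpha>. q = rotate_bundle \<alpha> (bpt t \<phi> 0))"
    using quot_proj_eq_iff[OF np b q] by auto
  also have "\<dots> \<longleftrightarrow> (\<exists>\<alpha>. q = bpt t \<phi> \<alpha>)"
    using rotate_bundle_pt[OF np t, of _ \<phi> 0] by (simp add: bundle_pt_bpt[OF t])
  finally show ?thesis unfolding bundle_circle_eq[OF t] by blast
qed

lemma bundle_complement_eq:
  "unit_bundle l \<gamma> - (bundle_circle l \<gamma> tm (- pi / 2) \<union> bundle_circle l \<gamma> tp (pi / 2)) =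
    {q \<in> unit_bundle l \<gamma>. first_integral m (quot_proj q) \<in> energies}"
proof (rule set_eqI)
  fix q
  show "q \<in> unit_bundle l \<gamma> - (bundle_circle l \<gamma> tm (- pi / 2) \<union> bundle_circle l \<gamma> tp (pi / 2)) \<longleftrightarrow>
    q \<in> {q \<in> unit_bundle l \<gamma>. first_integral m (quot_proj q) \<in> energies}"
  proof (cases "q \<in> unit_bundle l \<gamma>")
    case True
    then have N: "quot_proj q \<in> quot_bundle l \<gamma>" unfolding quot_bundle_def by simp
    show ?thesis
      using first_integral_range[OF N] bundle_circle_iff[OF tm(1) True, of "- pi / 2"]
        bundle_circle_iff[OF tp(1) True, of "pi / 2"] True unfolding energies_def by simp
  qed simp
qed

lemma bundle_foliation:
  "\<exists>F. foliation TYPE(real \<times> real) TYPE(real)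
      (unit_bundle l \<gamma> - (bundle_circle l \<gamma> tm (- pi / 2) \<union> bundle_circle l \<gamma> tp (pi / 2))) F \<and>
    (\<forall>L\<in>F. embedded_torus L \<and> flow_invariant (unit_bundle l \<gamma>) (magnetic_field m l \<gamma>) L)"
proof (intro exI conjI ballI)
  let ?W = "unit_bundle l \<gamma> - (bundle_circle l \<gamma> tm (- pi / 2) \<union> bundle_circle l \<gamma> tp (pi / 2))"
  show "foliation TYPE(real \<times> real) TYPE(real) ?W
      ((\<lambda>c. {q \<in> unit_bundle l \<gamma>. first_integral m (quot_proj q) = c}) ` energies)"
  proof (rule foliation_level_sets[OF bundle_complement_eq])
    fix c assume "c \<in> energies"
    then obtain t where t: "t \<in> {0<..<l}" "c \<in> levels (Gam \<gamma> t)" using energies_levels by blast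
    \<comment> \<open>Level c meets the pole of height -p only when c = p; with this choice the
      section for p is defined along the whole oval.\<close>
    define p :: real where "p = (if c = 1 then -1 else 1)"
    have p: "p \<in> {-1, 1}" "c \<noteq> p" by (auto simp: p_def)
    interpret polar_chart l \<gamma> m "Gam \<gamma> t" by (rule polar_chart_at[OF t(1)])
    have "continuous_on (UNIV \<times> (levels (Gam \<gamma> t) - {p})) (Theta p)"
      using Ck_on_Theta[OF p(1), of 0] by simp
    then have "continuous_on UNIV (\<lambda>x :: real \<times> real. Theta p (x, c))"
      by (rule continuous_on_compose2[where f = "\<lambda>x. (x, c)"])
        (use t(2) p(2) in \<open>auto intro: continuous_on_Pair continuous_on_id continuous_on_const\<close>)
    then have "connected (range (\<lambda>x :: real \<times> real. Theta p (x, c)))"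
      by (rule connected_continuous_image) (rule connected_UNIV)
    then show "connected {q \<in> unit_bundle l \<gamma>. first_integral m (quot_proj q) = c} \<and>
        {q \<in> unit_bundle l \<gamma>. first_integral m (quot_proj q) = c} \<noteq> {}"
      unfolding torus_level[OF t(2) p] by blast
  next
    fix q assume q: "q \<in> ?W"
    define c where "c = first_integral m (quot_proj q)"
    have qM: "q \<in> unit_bundle l \<gamma>" "c \<in> energies" using q unfolding bundle_complement_eq c_def by auto
    then obtain t where t: "t \<in> {0<..<l}" "c \<in> levels (Gam \<gamma> t)" using energies_levels by blast
    define p :: real where "p = (if c = 1 then -1 else 1)"
    have p: "p \<in> {-1, 1}" "c \<noteq> p" by (auto simp: p_def)
    interpret polar_chart l \<gamma> m "Gam \<gamma> t" by (rule polar_chart_at[OF t(1)])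
    have "q \<in> range (\<lambda>x :: real \<times> real. Theta p (x, c))"
      using qM(1) unfolding torus_level[OF t(2) p, symmetric] by (simp add: c_def)
    then obtain b a where q_eq: "q = Theta p ((b, a), c)" by auto
    \<comment> \<open>Removing the energy p from the transverse set keeps the neighbouring ovals
      away from that pole as well; c itself differs from p.\<close>
    let ?A = "{b - pi<..<b + pi} \<times> {a - pi<..<a + pi}" and ?B = "levels (Gam \<gamma> t) - {p}"
      and ?U = "Theta_nbhd p b a"
    have 1: "q \<in> ?U" unfolding q_eq by (rule Theta_in_nbhd(1)[OF p(1)]) (use t(2) p(2) in simp)
    have "?U \<subseteq> ?W"
      using levels_energies[OF t(1)] unfolding bundle_complement_eq Theta_nbhd_def lev_nbhd_def by blast
    then have 2: "openin (top_of_set ?W) ?U" by (rule openin_subset_trans[OF openin_Theta_nbhd(1)[OF p(1)]]) blast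
    have 3: "\<forall>x\<in>?A. \<forall>c'\<in>?B. first_integral m (quot_proj (Theta p (x, c'))) = c'"
      unfolding quot_proj_Theta[OF p(1)] fst_conv snd_conv using lev_mem(2) by blast
    have 4: "connected ?A" by (intro connected_Times connected_Ioo)
    show "\<exists>(A::(real \<times> real) set) (B::real set) \<psi> U. q \<in> U \<and> openin (top_of_set ?W) U \<and> connected A \<and>
        regular_param (A \<times> B) \<psi> U \<and> (\<forall>a\<in>A. \<forall>b\<in>B. first_integral m (quot_proj (\<psi> (a, b))) = b)"
      by (rule exI[of _ ?A], rule exI[of _ ?B], rule exI[of _ "Theta p"], rule exI[of _ ?U],
          intro conjI 1 2 3 4 regular_param_Theta p(1))
  qed
  fix L assume "L \<in> (\<lambda>c. {q \<in> unit_bundle l \<gamma>. first_integral m (quot_proj q) = c}) ` energies"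
  then obtain c where c: "c \<in> energies" "L = {q \<in> unit_bundle l \<gamma>. first_integral m (quot_proj q) = c}" by blast
  then obtain t where t: "t \<in> {0<..<l}" "c \<in> levels (Gam \<gamma> t)" using energies_levels by blast
  define p :: real where "p = (if c = 1 then -1 else 1)"
  have p: "p \<in> {-1, 1}" "c \<noteq> p" by (auto simp: p_def)
  interpret polar_chart l \<gamma> m "Gam \<gamma> t" by (rule polar_chart_at[OF t(1)])
  show "embedded_torus L" unfolding c(2) by (rule embedded_torus_level[OF t(2) p])
  show "flow_invariant (unit_bundle l \<gamma>) (magnetic_field m l \<gamma>) L"
    unfolding flow_invariant_def
  proof (intro conjI allI impI)
    show "L \<subseteq> unit_bundle l \<gamma>" unfolding c(2) by blast
    fix J \<zeta> assume J: "open J \<and> is_interval J \<and> integral_curve (unit_bundle l \<gamma>) (magnetic_field m l \<gamma>) J \<zeta> \<and> (\<exists>s\<in>J. \<zeta> s \<in> L)"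
    then obtain s where s: "s \<in> J" "\<zeta> s \<in> L" by blast
    show "\<zeta> ` J \<subseteq> L"
    proof (rule image_subsetI)
      fix s' assume s': "s' \<in> J"
      have "\<zeta> s' \<in> unit_bundle l \<gamma>" using J s' unfolding integral_curve_def by blast
      moreover have "first_integral m (quot_proj (\<zeta> s')) = first_integral m (quot_proj (\<zeta> s))"
        by (rule first_integral_invariant[of J]) (use J s s' in auto)
      ultimately show "\<zeta> s' \<in> L" using s(2) unfolding c(2) by simp
    qed
  qed
qed

end

theorem proposition4p6:
  fixes \<gamma> :: "real \<Rightarrow> real" and l m :: real
  assumes "normalized_profile l \<gamma>" and "0 < m"
  shows
    "Crit_pm (-1) m l \<gamma> \<subseteq> {0<..<l} \<and> Crit_pm 1 m l \<gamma> \<subseteq> {0<..<l} \<and>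
     Crit m l \<gamma> =
       quot_pt l \<gamma> ` (Crit_pm (-1) m l \<gamma> \<times> {- pi / 2} \<union> Crit_pm 1 m l \<gamma> \<times> {pi / 2}) \<and>
     (\<forall>\<sigma>\<in>{-1, 1}. \<forall>t\<in>{0..l}.
        t \<in> Crit_pm \<sigma> m l \<gamma> \<longleftrightarrow> \<sigma> * m * profile_deriv l \<gamma> 1 t = \<gamma> t) \<and>
     (\<forall>\<sigma>\<in>{-1, 1}. \<forall>t\<in>Crit_pm \<sigma> m l \<gamma>.
        closed_orbit (unit_bundle l \<gamma>) (magnetic_field m l \<gamma>) (bundle_circle l \<gamma> t (\<sigma> * pi / 2))) \<and>
     {L. closed_orbit (unit_bundle l \<gamma>) (magnetic_field m l \<gamma>) L \<and>
         (\<exists>t\<in>{0<..<l}. fst ` L = latitude \<gamma> t)} =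
       {bundle_circle l \<gamma> t (\<sigma> * pi / 2) | \<sigma> t. \<sigma> \<in> {-1, 1} \<and> t \<in> Crit_pm \<sigma> m l \<gamma>} \<and>
     ((\<forall>t\<in>{0..l}. 0 < magnetic_curvature m l \<gamma> t) \<longrightarrow>
       (\<exists>tp\<in>{0..l}. \<exists>tm\<in>{0..l}.
          Crit_pm 1 m l \<gamma> = {tp} \<and>
          (\<forall>t\<in>{0..l} - {tp}. integral_pm 1 m \<gamma> t < integral_pm 1 m \<gamma> tp) \<and>
          Crit_pm (-1) m l \<gamma> = {tm} \<and>
          (\<forall>t\<in>{0..l} - {tm}. integral_pm (-1) m \<gamma> tm < integral_pm (-1) m \<gamma> t) \<and>
          (\<exists>F. foliation TYPE(real) TYPE(real)
                 (quot_bundle l \<gamma> - {quot_pt l \<gamma> (tm, - pi / 2), quot_pt l \<gamma> (tp, pi / 2)}) F \<and>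
               (\<forall>L\<in>F. closed_orbit (quot_bundle l \<gamma>) (quot_magnetic_field m l \<gamma>) L)) \<and>
          (\<exists>F. foliation TYPE(real \<times> real) TYPE(real)
                 (unit_bundle l \<gamma> -
                    (bundle_circle l \<gamma> tm (- pi / 2) \<union> bundle_circle l \<gamma> tp (pi / 2))) F \<and>
               (\<forall>L\<in>F. embedded_torus L \<and>
                       flow_invariant (unit_bundle l \<gamma>) (magnetic_field m l \<gamma>) L))))"
  (is "?I1 \<and> ?I2 \<and> ?C \<and> ?E \<and> ?O \<and> ?Lat = ?Circ \<and> (?K \<longrightarrow> ?Fol)")
proof -
  note m = assms(2)
  interpret profile l \<gamma> by unfold_locales (rule assms(1))
  have I1: ?I1 using Crit_pm_interior[OF m, of "-1"] by blast
  have I2: ?I2 using Crit_pm_interior[OF m, of 1] by blast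
  have E: ?E by (simp add: Crit_pm_iff d\<gamma>_def del: profile_deriv.simps One_nat_def)
  have O: ?O using closed_orbit_circle[OF m] by blast
  have Lat: "?Lat = ?Circ"
  proof
    show "?Lat \<subseteq> ?Circ"
    proof
      fix L assume "L \<in> ?Lat"
      then obtain t where "closed_orbit (unit_bundle l \<gamma>) (magnetic_field m l \<gamma>) L" "t \<in> {0<..<l}"
        "fst ` L = latitude \<gamma> t" by blast
      from latitude_orbit[OF m this] show "L \<in> ?Circ" by blast
    qed
    show "?Circ \<subseteq> ?Lat"
    proof
      fix L assume "L \<in> ?Circ"
      then obtain \<sigma> t where *: "\<sigma> \<in> {-1, 1}" "t \<in> Crit_pm \<sigma> m l \<gamma>" "L = bundle_circle l \<gamma> t (\<sigma> * pi / 2)" by blast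
      have "t \<in> {0<..<l}" by (rule Crit_pm_interior[OF m *(1,2)])
      moreover have "fst ` L = latitude \<gamma> t" unfolding *(3) by (rule fst_bundle_circle)
      moreover have "closed_orbit (unit_bundle l \<gamma>) (magnetic_field m l \<gamma>) L"
        unfolding *(3) by (rule closed_orbit_circle[OF m *(1,2)])
      ultimately show "L \<in> ?Lat" by blast
    qed
  qed
  have Fol: ?Fol if K: ?K
  proof -
    interpret magnetic l \<gamma> m by unfold_locales (use m K in blast)+
    have s: "(1::real) \<in> {-1, 1}" "(-1::real) \<in> {-1, 1}" by simp_all
    obtain tp where plus: "tp \<in> {0<..<l}" "Crit_pm 1 m l \<gamma> = {tp}"
      "\<And>t. t \<in> {0..l} - {tp} \<Longrightarrow> 1 * integral_pm 1 m \<gamma> t < 1 * integral_pm 1 m \<gamma> tp"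
      using Crit_pm_unique[OF s(1)] by blast
    obtain tm where minus: "tm \<in> {0<..<l}" "Crit_pm (-1) m l \<gamma> = {tm}"
      "\<And>t. t \<in> {0..l} - {tm} \<Longrightarrow> -1 * integral_pm (-1) m \<gamma> t < -1 * integral_pm (-1) m \<gamma> tm"
      using Crit_pm_unique[OF s(2)] by blast
    have max: "integral_pm 1 m \<gamma> t < integral_pm 1 m \<gamma> tp" if "t \<in> {0..l} - {tp}" for t
      using plus(3)[OF that] by simp
    have min: "integral_pm (-1) m \<gamma> tm < integral_pm (-1) m \<gamma> t" if "t \<in> {0..l} - {tm}" for t
      using minus(3)[OF that] by simp
    interpret magnetic_extrema l \<gamma> m tp tm
      by unfold_locales (fact plus(1) max minus(1) min)+
    have "tp \<in> {0..l}" "tm \<in> {0..l}" using plus(1) minus(1) by simp_all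
    then show ?thesis
      by - (rule bexI[of _ tp], rule bexI[of _ tm], intro conjI ballI plus(2) minus(2) max min quot_foliation bundle_foliation)
  qed
  show ?thesis
    by (intro conjI impI I1 I2 E O Lat Fol Crit_eq[OF m])
qed

end
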